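(* Let $V_+,V_-\in\mathbb{C}$, $\alpha\in\mathbb{C}$, let $V(x)=V_+$ for $x\ge0$ and $V(x)=V_-$ for $x<0$, and let $\mathcal{L}_\alpha$ be the operator on $L^2(\mathbb{R})$ given by $$\mathrm{Dom}(\mathcal{L}_\alpha)=\{u\in H^1(\mathbb{R})\cap H^2(\mathbb{R}\setminus\{0\}):u'(0^+)-u'(0^-)=\alpha u(0)\},\qquad \mathcal{L}_\alpha u=-u''+V(x)u.$$ Then the spectrum of $\mathcal{L}_\alpha$ is composed of point spectrum and continuous spectrum, $\sigma(\mathcal{L}_\alpha)=\sigma_{\mathrm{c}}(\mathcal{L}_\alpha)\cup\sigma_{\mathrm{p}}(\mathcal{L}_\alpha)$, in which: - the continuous spectrum is also the essential spectrum: $$\sigma_{\mathrm{c}}(\mathcal{L}_\alpha)=\sigma_{\mathrm{e}k}(\mathcal{L}_\alpha)=[V_+,+\infty)\cup[V_-,+\infty)\qquad\text{for }k\in\{1,2,3,4,5\};$$ - the point spectrum is also the discrete spectrum: $$\sigma_{\mathrm{p}}(\mathcal{L}_\alpha)=\sigma_{\mathrm{dis}}(\mathcal{L}_\alpha)=\begin{cases}\{z(\alpha)\}&\text{if }\alpha\in\Omega,\\ \emptyset&\text{if }\alpha\in\mathbb{C}\setminus\Omega,\end{cases}$$ where $$z(\alpha):=\frac{V_++V_-}{2}-\frac{(V_+-V_-)^2}{4\alpha^2}-\frac{\alpha^2}{4},\qquad \Omega:=\left\{\alpha\in\mathbb{C}:\ |\langle V_+-V_-,\alpha\rangle_{\mathbb{R}^2}|<-|\alpha|^2\,\mathrm{Re}\,\alpha\right\}.$$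 When $\alpha\in\Omega$, the eigenspace of $z(\alpha)$ is $\mathrm{Ker}(\mathcal{L}_\alpha-z(\alpha))=\mathrm{span}\{u_\alpha\}$, where $$u_\alpha(x):=\begin{cases}e^{\left(\frac{\alpha}{2}+\frac{V_+-V_-}{2\alpha}\right)x},&x\ge0,\\ e^{-\left(\frac{\alpha}{2}-\frac{V_+-V_-}{2\alpha}\right)x},&x\le0.\end{cases}$$
   Context: For $C\in\mathbb{C}$, $[C,+\infty):=\{C+t:t\ge0\}$. For $X=X_1+iX_2$, $Y=Y_1+iY_2\in\mathbb{C}$ (with $X_j,Y_j$ real), $\langle X,Y\rangle_{\mathbb{R}^2}=X_1Y_1+X_2Y_2$. For a closed densely defined operator $S$ on a Hilbert space $\mathcal{H}$: $\sigma_{\mathrm{p}}(S)$ is the set of $z$ such that $S-z$ is not injective; $\sigma_{\mathrm{c}}(S)$ is the set of $z$ such that $S-z$ is injective, $\overline{\mathrm{Ran}(S-z)}=\mathcal{H}$ and $\mathrm{Ran}(S-z)\subsetneq\mathcal{H}$; $\sigma_{\mathrm{dis}}(S)$ is the set of isolated eigenvalues $z$ of $S$ which have finite algebraic multiplicity and such that $\mathrm{Ran}(S-z)$ is closed. Essential spectra (in the sense of Edmunds–Evans): $\sigma_{\mathrm{e}k}(S)=\mathbb{C}\setminus\Delta_k(S)$, $k=1,\dots,5$, where $\Delta_1(S)$ is the set of $z$ such that $S-z$ is semi-Fredholm, i.e. has closed range and $\dim\mathrm{Ker}(S-z)<\infty$ or $\mathrm{codim}\,\mathrm{Ran}(S-z)<\infty$;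 $\Delta_2(S)$ is the set of $z$ such that $\mathrm{Ran}(S-z)$ is closed and $\dim\mathrm{Ker}(S-z)<\infty$; $\Delta_3(S)$ is the set of $z$ such that $S-z$ is Fredholm (closed range, finite-dimensional kernel, finite-codimensional range); $\Delta_4(S)$ is the set of $z$ such that $S-z$ is Fredholm of index $0$; $\Delta_5(S)$ is the union of all connected components of $\Delta_1(S)$ that intersect the resolvent set $\rho(S)$. *)

theory Defs
  imports "HOL-Analysis.Analysis"
begin

section \<open>Unbounded operators and their spectra\<close>

text \<open>Scalar multiplication by complex numbers on a real normed space; the library has no class
  of complex normed spaces.\<close>

class complex_normed_vector = real_normed_vector +
  fixes scaleC :: "complex \<Rightarrow> 'a \<Rightarrow> 'a"  (infixr \<open>*C\<close> 75)
  assumes scaleC_add_right: "a *C (x + y) = a *C x + a *C y"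
    and scaleC_add_left: "(a + b) *C x = a *C x + b *C x"
    and scaleC_scaleC: "a *C b *C x = (a * b) *C x"
    and scaleC_of_real: "complex_of_real r *C x = r *\<^sub>R x"
    and norm_scaleC: "norm (a *C x) = cmod a * norm x"

global_interpretation complex_vector: vector_space "scaleC :: complex \<Rightarrow> 'a \<Rightarrow> 'a::complex_normed_vector"
  defines cspan = complex_vector.span
    and cdim = complex_vector.dim
  by unfold_locales
    (use scaleC_of_real[of 1] in \<open>auto simp: scaleC_add_right scaleC_add_left scaleC_scaleC\<close>)

text \<open>An unbounded operator is identified with its graph, so that \<^const>\<open>Domain\<close>, \<^const>\<open>Range\<close>
  and the iterates \<open>T ^^ n\<close> of relations are the domain, the range and the powers (on their
  natural domains) of the operator.\<close>

type_synonym 'h operator = "('h \<times> 'h) set"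

definition op_graph :: "'h set \<Rightarrow> ('h \<Rightarrow> 'h) \<Rightarrow> 'h operator" where
  "op_graph D T = {(u, T u) |u. u \<in> D}"

definition op_minus :: "'h::complex_normed_vector operator \<Rightarrow> complex \<Rightarrow> 'h operator" where
  "op_minus S z = {(u, f - z *C u) |u f. (u, f) \<in> S}"

definition op_inj :: "'h operator \<Rightarrow> bool" where
  "op_inj T \<longleftrightarrow> (\<forall>u v f. (u, f) \<in> T \<and> (v, f) \<in> T \<longrightarrow> u = v)"

definition op_ker :: "'h::zero operator \<Rightarrow> 'h set" where
  "op_ker T = {u. (u, 0) \<in> T}"

definition resolvent_set :: "'h::complex_normed_vector operator \<Rightarrow> complex set" where
  "resolvent_set S = {z. op_inj (op_minus S z) \<and> Range (op_minus S z) = UNIV \<and>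
     (\<exists>K. \<forall>(u, f) \<in> op_minus S z. norm u \<le> K * norm f)}"

definition spectrum :: "'h::complex_normed_vector operator \<Rightarrow> complex set" where
  "spectrum S = - resolvent_set S"

definition point_spectrum :: "'h::complex_normed_vector operator \<Rightarrow> complex set" where
  "point_spectrum S = {z. \<not> op_inj (op_minus S z)}"

definition continuous_spectrum :: "'h::complex_normed_vector operator \<Rightarrow> complex set" where
  "continuous_spectrum S = {z. op_inj (op_minus S z) \<and>
     closure (Range (op_minus S z)) = UNIV \<and> Range (op_minus S z) \<noteq> UNIV}"

definition finite_dim :: "'h::complex_normed_vector set \<Rightarrow> bool" where
  "finite_dim M \<longleftrightarrow> (\<exists>B. finite B \<and> M \<subseteq> cspan B)"

text \<open>The classes of the elements of \<open>B\<close> span the quotient of the whole space by the subspace \<open>M\<close>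
  iff \<open>cspan (M \<union> B) = UNIV\<close>.\<close>

definition finite_codim :: "'h::complex_normed_vector set \<Rightarrow> bool" where
  "finite_codim M \<longleftrightarrow> (\<exists>B. finite B \<and> cspan (M \<union> B) = UNIV)"

definition codim :: "'h::complex_normed_vector set \<Rightarrow> nat" where
  "codim M = (LEAST n. \<exists>B. finite B \<and> card B = n \<and> cspan (M \<union> B) = UNIV)"

text \<open>The algebraic multiplicity of \<open>z\<close> is the dimension of its root space.\<close>

definition root_space :: "'h::complex_normed_vector operator \<Rightarrow> complex \<Rightarrow> 'h set" where
  "root_space S z = (\<Union>n. op_ker (op_minus S z ^^ n))"

definition discrete_spectrum :: "'h::complex_normed_vector operator \<Rightarrow> complex set" where
  "discrete_spectrum S = {z \<in> point_spectrum S. z isolated_in spectrum S \<and>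
     finite_dim (root_space S z) \<and> closed (Range (op_minus S z))}"

definition semi_fredholm :: "'h::complex_normed_vector operator \<Rightarrow> bool" where
  "semi_fredholm T \<longleftrightarrow> closed (Range T) \<and> (finite_dim (op_ker T) \<or> finite_codim (Range T))"

definition fredholm :: "'h::complex_normed_vector operator \<Rightarrow> bool" where
  "fredholm T \<longleftrightarrow> closed (Range T) \<and> finite_dim (op_ker T) \<and> finite_codim (Range T)"

definition fredholm_index :: "'h::complex_normed_vector operator \<Rightarrow> int" where
  "fredholm_index T = int (cdim (op_ker T)) - int (codim (Range T))"

definition Delta1 :: "'h::complex_normed_vector operator \<Rightarrow> complex set" where
  "Delta1 S = {z. semi_fredholm (op_minus S z)}"

definition Delta2 :: "'h::complex_normed_vector operator \<Rightarrow> complex set" where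
  "Delta2 S = {z. closed (Range (op_minus S z)) \<and> finite_dim (op_ker (op_minus S z))}"

definition Delta3 :: "'h::complex_normed_vector operator \<Rightarrow> complex set" where
  "Delta3 S = {z. fredholm (op_minus S z)}"

definition Delta4 :: "'h::complex_normed_vector operator \<Rightarrow> complex set" where
  "Delta4 S = {z. fredholm (op_minus S z) \<and> fredholm_index (op_minus S z) = 0}"

definition Delta5 :: "'h::complex_normed_vector operator \<Rightarrow> complex set" where
  "Delta5 S = \<Union>{C \<in> components (Delta1 S). C \<inter> resolvent_set S \<noteq> {}}"

text \<open>Only meaningful for \<open>k \<in> {1, 2, 3, 4, 5}\<close>.\<close>

definition essential_spectrum :: "nat \<Rightarrow> 'h::complex_normed_vector operator \<Rightarrow> complex set" where
  "essential_spectrum k S =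
     - (if k = 1 then Delta1 S else if k = 2 then Delta2 S else if k = 3 then Delta3 S
        else if k = 4 then Delta4 S else Delta5 S)"


section \<open>The space of square-integrable functions on the real line\<close>

definition square_integrable :: "(real \<Rightarrow> complex) \<Rightarrow> bool" where
  "square_integrable f \<longleftrightarrow>
     f \<in> borel_measurable lborel \<and> integrable lborel (\<lambda>x. (cmod (f x))\<^sup>2)"

lemma square_integrable_zero: "square_integrable (\<lambda>x. 0)"
  by (simp add: square_integrable_def)

quotient_type L2R = "real \<Rightarrow> complex" / partial:
  "\<lambda>f g. square_integrable f \<and> square_integrable g \<and> (AE x in lborel. f x = g x)"
proof (rule part_equivpI)
  show "\<exists>f. square_integrable f \<and> square_integrable f \<and> (AE x in lborel. f x = f x)"
    using square_integrable_zero by auto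
  show "symp (\<lambda>f g. square_integrable f \<and> square_integrable g \<and> (AE x in lborel. f x = g x))"
    by (auto simp: symp_def eq_commute)
  show "transp (\<lambda>f g. square_integrable f \<and> square_integrable g \<and> (AE x in lborel. f x = g x))"
    unfolding transp_def by (auto elim: AE_mp)
qed

lemma square_integrable_add:
  assumes "square_integrable f" "square_integrable g"
  shows "square_integrable (\<lambda>x. f x + g x)"
proof -
  have m [measurable]: "f \<in> borel_measurable lborel" "g \<in> borel_measurable lborel"
    using assms by (auto simp: square_integrable_def)
  have bnd: "(cmod (f x + g x))\<^sup>2 \<le> 2 * (cmod (f x))\<^sup>2 + 2 * (cmod (g x))\<^sup>2" for x
  proof -
    have "(cmod (f x + g x))\<^sup>2 \<le> (cmod (f x) + cmod (g x))\<^sup>2"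
      by (intro power_mono norm_triangle_ineq) auto
    also have "\<dots> \<le> 2 * (cmod (f x))\<^sup>2 + 2 * (cmod (g x))\<^sup>2"
      using sum_squares_bound[of "cmod (f x)" "cmod (g x)"] by (simp add: power2_sum)
    finally show ?thesis .
  qed
  have "integrable lborel (\<lambda>x. 2 * (cmod (f x))\<^sup>2 + 2 * (cmod (g x))\<^sup>2)"
    using assms by (auto simp: square_integrable_def)
  then have "integrable lborel (\<lambda>x. (cmod (f x + g x))\<^sup>2)"
    by (rule Bochner_Integration.integrable_bound) (use bnd in \<open>auto simp: abs_of_nonneg\<close>)
  then show ?thesis
    using m unfolding square_integrable_def by auto
qed

lemma square_integrable_mult_bounded:
  assumes "square_integrable f" "w \<in> borel_measurable lborel" "\<And>x. cmod (w x) \<le> K"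
  shows "square_integrable (\<lambda>x. w x * f x)"
proof -
  have m [measurable]: "f \<in> borel_measurable lborel" "w \<in> borel_measurable lborel"
    using assms by (auto simp: square_integrable_def)
  have bnd: "(cmod (w x * f x))\<^sup>2 \<le> K\<^sup>2 * (cmod (f x))\<^sup>2" for x
    using assms(3)[of x] by (auto simp: norm_mult power_mult_distrib intro!: mult_right_mono power_mono)
  have "integrable lborel (\<lambda>x. K\<^sup>2 * (cmod (f x))\<^sup>2)"
    using assms by (auto simp: square_integrable_def)
  then have "integrable lborel (\<lambda>x. (cmod (w x * f x))\<^sup>2)"
    by (rule Bochner_Integration.integrable_bound) (use bnd in \<open>auto simp: abs_of_nonneg\<close>)
  then show ?thesis
    using m unfolding square_integrable_def by auto
qed

lemma square_integrable_scale: "square_integrable f \<Longrightarrow> square_integrable (\<lambda>x. c * f x)"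
  by (rule square_integrable_mult_bounded[where K = "cmod c"]) auto

lemma square_integrable_prod:
  assumes "square_integrable f" "square_integrable g"
  shows "integrable lborel (\<lambda>x. f x * cnj (g x))"
proof -
  have m [measurable]: "f \<in> borel_measurable borel" "g \<in> borel_measurable borel"
    using assms by (auto simp: square_integrable_def)
  have "integrable lborel (\<lambda>x. (cmod (f x))\<^sup>2 + (cmod (g x))\<^sup>2)"
    using assms by (auto simp: square_integrable_def)
  moreover have "cmod (f x * cnj (g x)) \<le> (cmod (f x))\<^sup>2 + (cmod (g x))\<^sup>2" for x
    using sum_squares_bound[of "cmod (f x)" "cmod (g x)"] mult_nonneg_nonneg[of "cmod (f x)" "cmod (g x)"]
    by (simp add: norm_mult del: mult_nonneg_nonneg)
  moreover have "(\<lambda>x. f x * cnj (g x)) \<in> borel_measurable lborel"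
    using borel_measurable_continuous_onI[OF continuous_on_cnj[OF continuous_on_id]]
    by (simp add: borel_measurable_times measurable_compose[OF m(2)])
  ultimately show ?thesis
    by (elim Bochner_Integration.integrable_bound) auto
qed

instantiation L2R :: real_vector
begin

lift_definition zero_L2R :: L2R is "\<lambda>x. 0"
  by (simp add: square_integrable_zero)

lift_definition plus_L2R :: "L2R \<Rightarrow> L2R \<Rightarrow> L2R" is "\<lambda>f g x. f x + g x"
  by (auto intro: square_integrable_add elim: AE_mp)

lift_definition uminus_L2R :: "L2R \<Rightarrow> L2R" is "\<lambda>f x. - f x"
  using square_integrable_scale[of _ "-1"] by (auto elim: AE_mp)

definition minus_L2R :: "L2R \<Rightarrow> L2R \<Rightarrow> L2R" where
  "minus_L2R u v = u + - v"

lift_definition scaleR_L2R :: "real \<Rightarrow> L2R \<Rightarrow> L2R" is "\<lambda>r f x. of_real r * f x"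
  by (auto intro: square_integrable_scale elim: AE_mp)

instance
proof
  fix u v w :: L2R and a b :: real
  show "u + v + w = u + (v + w)"
    by transfer (auto intro!: square_integrable_add simp: add.assoc)
  show "u + v = v + u"
    by transfer (auto intro!: square_integrable_add simp: add.commute)
  show "0 + u = u"
    by transfer auto
  show "- u + u = 0"
    by transfer (auto simp: square_integrable_zero)
  show "u - v = u + - v"
    by (rule minus_L2R_def)
  show "a *\<^sub>R (u + v) = a *\<^sub>R u + a *\<^sub>R v"
    by transfer (auto intro!: square_integrable_add square_integrable_scale simp: distrib_left)
  show "(a + b) *\<^sub>R u = a *\<^sub>R u + b *\<^sub>R u"
    by transfer (auto intro!: square_integrable_add square_integrable_scale simp: distrib_right)
  show "a *\<^sub>R b *\<^sub>R u = (a * b) *\<^sub>R u"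
    by transfer (auto intro!: square_integrable_scale simp: mult.assoc)
  show "1 *\<^sub>R u = u"
    by transfer auto
qed

end


lift_definition cinner_L2R :: "L2R \<Rightarrow> L2R \<Rightarrow> complex" is "\<lambda>f g. \<integral>x. f x * cnj (g x) \<partial>lborel"
proof -
  fix f f' g g' :: "real \<Rightarrow> complex"
  assume f: "square_integrable f \<and> square_integrable f' \<and> (AE x in lborel. f x = f' x)"
    and g: "square_integrable g \<and> square_integrable g' \<and> (AE x in lborel. g x = g' x)"
  have "AE x in lborel. f x * cnj (g x) = f' x * cnj (g' x)"
    using f g by (auto elim: AE_mp)
  then show "(\<integral>x. f x * cnj (g x) \<partial>lborel) = (\<integral>x. f' x * cnj (g' x) \<partial>lborel)"
    using f g square_integrable_prod
    by (intro integral_cong_AE) (auto intro: borel_measurable_integrable)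
qed

lemma cinner_L2R_commute: "cinner_L2R u v = cnj (cinner_L2R v u)"
proof (transfer, goal_cases)
  case (1 f g)
  have "(\<lambda>x. f x * cnj (g x)) = (\<lambda>x. cnj (g x * cnj (f x)))"
    by (simp add: mult.commute)
  then show ?case
    by (simp only: Bochner_Integration.integral_cnj)
qed

lemma cinner_L2R_self: "cinner_L2R u u = of_real (\<integral>x. (cmod (rep_L2R u x))\<^sup>2 \<partial>lborel)"
proof -
  have "cinner_L2R u u = (\<integral>x. of_real ((cmod (rep_L2R u x))\<^sup>2) \<partial>lborel)"
    by (simp add: cinner_L2R_def flip: complex_norm_square del: of_real_power)
  then show ?thesis
    by (simp only: integral_complex_of_real)
qed

instantiation L2R :: real_inner
begin

definition inner_L2R :: "L2R \<Rightarrow> L2R \<Rightarrow> real" where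
  "inner_L2R u v = Re (cinner_L2R u v)"

definition norm_L2R :: "L2R \<Rightarrow> real" where
  "norm_L2R u = sqrt (inner u u)"

definition sgn_L2R :: "L2R \<Rightarrow> L2R" where
  "sgn_L2R u = u /\<^sub>R norm u"

definition dist_L2R :: "L2R \<Rightarrow> L2R \<Rightarrow> real" where
  "dist_L2R u v = norm (u - v)"

definition uniformity_L2R :: "(L2R \<times> L2R) filter" where
  "uniformity_L2R = (INF e\<in>{0<..}. principal {(u, v). dist u v < e})"

definition open_L2R :: "L2R set \<Rightarrow> bool" where
  "open_L2R U \<longleftrightarrow> (\<forall>u\<in>U. eventually (\<lambda>(u', v). u' = u \<longrightarrow> v \<in> U) uniformity)"

instance
proof
  fix u v w :: L2R and r :: real and U :: "L2R set"
  show "dist u v = norm (u - v)" by (rule dist_L2R_def)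
  show "sgn u = u /\<^sub>R norm u" by (rule sgn_L2R_def)
  show "uniformity = (INF e\<in>{0<..}. principal {(u::L2R, v). dist u v < e})" by (rule uniformity_L2R_def)
  show "open U \<longleftrightarrow> (\<forall>u\<in>U. eventually (\<lambda>(u', v). u' = u \<longrightarrow> v \<in> U) uniformity)" by (rule open_L2R_def)
  show "norm u = sqrt (inner u u)" by (rule norm_L2R_def)
  show "inner u v = inner v u"
    unfolding inner_L2R_def using cinner_L2R_commute[of u v] by simp
  show "inner (u + v) w = inner u w + inner v w"
    unfolding inner_L2R_def
    by transfer (simp add: distrib_right square_integrable_prod)
  show "inner (r *\<^sub>R u) v = r * inner u v"
    unfolding inner_L2R_def by transfer (simp add: mult.assoc)
  show "0 \<le> inner u u"
    unfolding inner_L2R_def cinner_L2R_self by simp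
  show "inner u u = 0 \<longleftrightarrow> u = 0"
  proof -
    have "square_integrable (rep_L2R u)"
      using Quotient3_rep_reflp[OF Quotient3_L2R] by blast
    then have "inner u u = 0 \<longleftrightarrow> (AE x in lborel. rep_L2R u x = 0)"
      unfolding inner_L2R_def cinner_L2R_self
      by (auto simp: square_integrable_def integral_nonneg_eq_0_iff_AE)
    also have "\<dots> \<longleftrightarrow> u = 0"
      using Quotient3_rel[OF Quotient3_L2R, of "rep_L2R u" "\<lambda>x. 0"] Quotient3_abs_rep[OF Quotient3_L2R, of u]
        \<open>square_integrable (rep_L2R u)\<close>
      by (simp add: square_integrable_zero zero_L2R_def)
    finally show ?thesis .
  qed
qed

end

instantiation L2R :: complex_normed_vector
begin

lift_definition scaleC_L2R :: "complex \<Rightarrow> L2R \<Rightarrow> L2R" is "\<lambda>c f x. c * f x"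
  by (auto intro: square_integrable_scale elim: AE_mp)

instance
proof
  fix u v :: L2R and a b :: complex and r :: real
  show "a *C (u + v) = a *C u + a *C v"
    by transfer (auto intro!: square_integrable_add square_integrable_scale simp: distrib_left)
  show "(a + b) *C u = a *C u + b *C u"
    by transfer (auto intro!: square_integrable_add square_integrable_scale simp: distrib_right)
  show "a *C b *C u = (a * b) *C u"
    by transfer (auto intro!: square_integrable_scale simp: mult.assoc)
  show "complex_of_real r *C u = r *\<^sub>R u"
    by transfer (auto intro!: square_integrable_scale)
  have "cinner_L2R (a *C u) (a *C u) = of_real ((cmod a)\<^sup>2) * cinner_L2R u u"
  proof (transfer, goal_cases)
    case (1 a f)
    have "(\<lambda>x. a * f x * cnj (a * f x)) = (\<lambda>x. of_real ((cmod a)\<^sup>2) * (f x * cnj (f x)))"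
      by (simp add: complex_norm_square mult_ac del: of_real_power)
    then show ?case
      by (simp only: integral_mult_right_zero)
  qed
  then show "norm (a *C u) = cmod a * norm u"
    by (simp add: norm_L2R_def inner_L2R_def real_sqrt_mult)
qed

end


section \<open>Sobolev spaces and traces\<close>

definition test_function :: "real set \<Rightarrow> (real \<Rightarrow> real) \<Rightarrow> bool" where
  "test_function \<Omega> \<phi> \<longleftrightarrow> (\<forall>n x. (deriv ^^ n) \<phi> differentiable at x) \<and>
     compact (closure {x. \<phi> x \<noteq> 0}) \<and> closure {x. \<phi> x \<noteq> 0} \<subseteq> \<Omega>"

text \<open>In what follows \<open>\<Omega>\<close> is an open set with null complement (the line or the punctured line), so
  that \<open>L\<^sup>2(\<Omega>)\<close> and \<open>L\<^sup>2(\<real>)\<close> are the same space.\<close>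

definition weak_deriv :: "real set \<Rightarrow> L2R \<Rightarrow> L2R \<Rightarrow> bool" where
  "weak_deriv \<Omega> u v \<longleftrightarrow> (\<forall>\<phi>. test_function \<Omega> \<phi> \<longrightarrow>
     (\<integral>x. rep_L2R u x * of_real (deriv \<phi> x) \<partial>lborel) = - (\<integral>x. rep_L2R v x * of_real (\<phi> x) \<partial>lborel))"

definition weak_D :: "real set \<Rightarrow> L2R \<Rightarrow> L2R" where
  "weak_D \<Omega> u = (THE v. weak_deriv \<Omega> u v)"

primrec sobolev :: "nat \<Rightarrow> real set \<Rightarrow> L2R set" where
  "sobolev 0 \<Omega> = UNIV"
| "sobolev (Suc k) \<Omega> = {u. \<exists>v. weak_deriv \<Omega> u v \<and> v \<in> sobolev k \<Omega>}"

abbreviation punctured_line :: "real set" where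
  "punctured_line \<equiv> - {0}"

text \<open>Elements of \<open>H\<^sup>1(\<Omega>)\<close> have a representative that is continuous on \<open>\<Omega>\<close>; its values on \<open>\<Omega>\<close> are
  unique, and for the punctured line it has one-sided limits at 0.\<close>

definition cont_rep :: "real set \<Rightarrow> L2R \<Rightarrow> real \<Rightarrow> complex" where
  "cont_rep \<Omega> u = (SOME h. continuous_on \<Omega> h \<and> (AE x in lborel. x \<in> \<Omega> \<longrightarrow> h x = rep_L2R u x))"


section \<open>The operator\<close>

definition step_potential :: "complex \<Rightarrow> complex \<Rightarrow> real \<Rightarrow> complex" where
  "step_potential Vp Vm x = (if x \<ge> 0 then Vp else Vm)"

lift_definition step_mult :: "complex \<Rightarrow> complex \<Rightarrow> L2R \<Rightarrow> L2R" is
  "\<lambda>Vp Vm f x. step_potential Vp Vm x * f x"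
proof -
  fix Vp Vm and f g :: "real \<Rightarrow> complex"
  have "step_potential Vp Vm \<in> borel_measurable lborel"
    unfolding step_potential_def by measurable
  moreover have "cmod (step_potential Vp Vm x) \<le> cmod Vp + cmod Vm" for x
    by (simp add: step_potential_def)
  ultimately show "?thesis Vp Vm f g"
    if "square_integrable f \<and> square_integrable g \<and> (AE x in lborel. f x = g x)"
    using that square_integrable_mult_bounded by (auto elim: AE_mp)
qed

definition dom_L :: "complex \<Rightarrow> L2R set" where
  "dom_L \<alpha> = {u \<in> sobolev 1 UNIV \<inter> sobolev 2 punctured_line.
     Lim (at_right 0) (cont_rep punctured_line (weak_D punctured_line u))
       - Lim (at_left 0) (cont_rep punctured_line (weak_D punctured_line u))
     = \<alpha> * cont_rep UNIV u 0}"

text \<open>The derivatives in the action of the operator are taken in the punctured line, where they do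
  not see the jump of \<open>u'\<close> at 0.\<close>

definition L_op :: "complex \<Rightarrow> complex \<Rightarrow> complex \<Rightarrow> L2R operator" where
  "L_op Vp Vm \<alpha> = op_graph (dom_L \<alpha>)
     (\<lambda>u. - weak_D punctured_line (weak_D punctured_line u) + step_mult Vp Vm u)"

definition half_line :: "complex \<Rightarrow> complex set" where
  "half_line C = {C + of_real t |t::real. t \<ge> 0}"

definition z_eig :: "complex \<Rightarrow> complex \<Rightarrow> complex \<Rightarrow> complex" where
  "z_eig Vp Vm \<alpha> = (Vp + Vm) / 2 - (Vp - Vm)\<^sup>2 / (4 * \<alpha>\<^sup>2) - \<alpha>\<^sup>2 / 4"

definition Omega_set :: "complex \<Rightarrow> complex \<Rightarrow> complex set" where
  "Omega_set Vp Vm = {\<alpha>. \<bar>(Vp - Vm) \<bullet> \<alpha>\<bar> < - (cmod \<alpha>)\<^sup>2 * Re \<alpha>}"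

definition u_eig :: "complex \<Rightarrow> complex \<Rightarrow> complex \<Rightarrow> real \<Rightarrow> complex" where
  "u_eig Vp Vm \<alpha> x =
     (if x \<ge> 0 then exp ((\<alpha> / 2 + (Vp - Vm) / (2 * \<alpha>)) * of_real x)
      else exp (- (\<alpha> / 2 - (Vp - Vm) / (2 * \<alpha>)) * of_real x))"

lemma integrable_exp_minus_abs:
  assumes "m > 0"
  shows "integrable lborel (\<lambda>x::real. exp (- m * \<bar>x\<bar>))"
proof -
  let ?g = "\<lambda>x::real. indicator {0..} x *\<^sub>R exp (- m * x)"
  have "(\<lambda>x. exp (- m * x)) integrable_on {0..}"
    using has_integral_exp_minus_to_infinity[OF assms, of 0] by (auto simp: integrable_on_def)
  then have "(\<lambda>x. exp (- m * x)) absolutely_integrable_on {0..}"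
    by (rule nonnegative_absolutely_integrable_1) auto
  then have g: "integrable lborel ?g"
    by (subst (asm) set_integrable_def, subst (asm) integrable_completion) auto
  then have "integrable lborel (\<lambda>x. ?g (0 + (-1) * x))"
    by (rule lborel_integrable_real_affine) auto
  with g have "integrable lborel (\<lambda>x. ?g x + ?g (0 + (-1) * x))"
    by (rule Bochner_Integration.integrable_add)
  then show ?thesis
    by (rule Bochner_Integration.integrable_bound) (auto simp: indicator_def)
qed

lemma square_integrable_u_eig:
  assumes "\<alpha> \<in> Omega_set Vp Vm"
  shows "square_integrable (u_eig Vp Vm \<alpha>)"
proof -
  define d where "d = (Vp - Vm) \<bullet> \<alpha>"
  define m where "m = - (Re \<alpha> + \<bar>d\<bar> / (cmod \<alpha>)\<^sup>2)"
  have d: "\<bar>d\<bar> < - (cmod \<alpha>)\<^sup>2 * Re \<alpha>"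
    using assms by (simp add: Omega_set_def d_def)
  then have [simp]: "\<alpha> \<noteq> 0" by auto
  have m: "m > 0"
    using d by (simp add: m_def field_simps)
  have re: "Re ((Vp - Vm) / (2 * \<alpha>)) = d / (2 * (cmod \<alpha>)\<^sup>2)"
    unfolding Re_divide' by (simp add: d_def inner_complex_def norm_mult power_mult_distrib field_simps)
  have cmod_exp: "(cmod (exp (w * of_real x)))\<^sup>2 = exp (2 * Re w * x)" for w and x :: real
    by (simp add: exp_double mult.assoc)
  have div: "d / (cmod \<alpha>)\<^sup>2 \<le> \<bar>d\<bar> / (cmod \<alpha>)\<^sup>2" "(- d) / (cmod \<alpha>)\<^sup>2 \<le> \<bar>d\<bar> / (cmod \<alpha>)\<^sup>2"
    by (rule divide_right_mono; simp)+
  have bnd: "(cmod (u_eig Vp Vm \<alpha> x))\<^sup>2 \<le> exp (- m * \<bar>x\<bar>)" for x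
  proof (cases "x \<ge> 0")
    case True
    have "(cmod (u_eig Vp Vm \<alpha> x))\<^sup>2 = exp ((Re \<alpha> + d / (cmod \<alpha>)\<^sup>2) * x)"
      using True by (simp only: u_eig_def if_True cmod_exp plus_complex.sel re) simp
    also have "\<dots> \<le> exp (- m * \<bar>x\<bar>)"
      using True div by (auto simp: m_def intro!: mult_right_mono)
    finally show ?thesis .
  next
    case False
    have "(cmod (u_eig Vp Vm \<alpha> x))\<^sup>2 = exp ((Re \<alpha> - d / (cmod \<alpha>)\<^sup>2) * (- x))"
      using False
      by (simp only: u_eig_def if_False cmod_exp uminus_complex.sel minus_complex.sel re)
        (simp add: algebra_simps)
    also have "\<dots> \<le> exp (- m * \<bar>x\<bar>)"
      using False div mult_right_mono[of "Re \<alpha> - d / (cmod \<alpha>)\<^sup>2" "- m" "- x"] by (auto simp: m_def)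
    finally show ?thesis .
  qed
  have meas: "u_eig Vp Vm \<alpha> \<in> borel_measurable lborel"
    unfolding u_eig_def by measurable
  moreover have "integrable lborel (\<lambda>x. (cmod (u_eig Vp Vm \<alpha> x))\<^sup>2)"
    by (rule Bochner_Integration.integrable_bound[OF integrable_exp_minus_abs[OF m]])
      (use bnd meas in \<open>auto simp: abs_of_nonneg\<close>)
  ultimately show ?thesis
    by (simp add: square_integrable_def)
qed

end

theory Submission
  imports Defs "HOL-Real_Asymp.Real_Asymp"
begin

text \<open>For \<open>z\<close> write \<open>k\<close> for the square roots of \<open>Vp - z\<close> and \<open>Vm - z\<close> with nonnegative real part. On each
  half-line (the left one reflected onto the right one) \<open>- u'' + k\<^sup>2 u = f\<close> factors as \<open>w = u' + k u\<close>,
  \<open>- w' + k w = f\<close>. If \<open>Re k > 0\<close>, energy estimates for the two first-order equations show that the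
  square-integrable solutions are parametrised by \<open>c = u 0\<close> and satisfy
  \<open>u' 0 + k c = \<integral> exp (- k x) f x dx\<close>. Adding the two boundary identities turns the jump condition into the
  scalar equation \<open>(kp + km + \<alpha>) c = \<integral> f E\<close> with \<open>E\<close> the function that decays like \<open>exp (- k \<bar>x\<bar>)\<close> on
  either side. So \<open>z\<close> is in the resolvent set unless \<open>kp + km + \<alpha> = 0\<close>, which is \<open>\<alpha> \<in> \<Omega>\<close> and
  \<open>z = z(\<alpha>)\<close>; then the kernel is spanned by \<open>E\<close>, the range is \<open>{f. \<integral> f E = 0}\<close>, and the eigenvalue is
  algebraically simple because \<open>\<integral> E\<^sup>2 \<noteq> 0\<close>. If \<open>Re k = 0\<close> on one side, nonzero homogeneous solutions do not
  decay there, \<open>exp (k x) / (1 + x)\<close> is not in the range, and arbitrary Cauchy data at 0 can be reached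
  after an arbitrarily small change of \<open>f\<close>, so the range is dense.\<close>

section \<open>Smooth functions and test functions\<close>

text \<open>The obstacle is the distance between the operator, given on equivalence classes by weak
  derivatives and an unspecified continuous representative, and the explicit ODE argument. It is
  crossed once: \<open>graph_imp_half_sols\<close> and \<open>half_sols_imp_graph\<close> identify
  the graph with pairs of half-line systems \<open>half_sol\<close> matched at 0, and the spectral
  statements are read off these pairs. Since the right-hand side is only square integrable, the
  equations are kept in integrated form (\<open>primitive\<close>) instead of pointwise form.

  Factoring the second-order equation turns the resolvent bound into two scalar energy estimates, in
  place of a convolution estimate for a Green's function.

  The essential spectra coincide because of a dichotomy. On the half-lines the range is dense and
  proper, hence not closed, which excludes every Fredholm-type property at once. Off them the
  operator is Fredholm of index 0, whether or not the point is an eigenvalue. Only the fifth set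
  needs topology: the complement of the half-lines is connected and contains a resolvent
  point.\<close>

definition smooth :: "(real \<Rightarrow> real) \<Rightarrow> bool" where
  "smooth f \<longleftrightarrow> (\<forall>n x. (deriv ^^ n) f differentiable at x)"

text \<open>Iterating \<open>deriv\<close> never leaves a family that is closed under
  differentiation. Smoothness of a concrete function is thus reduced to finding such a family around
  it.\<close>

lemma smooth_coinduct:
  assumes S: "\<And>f. f \<in> S \<Longrightarrow> \<exists>g\<in>S. \<forall>x. (f has_real_derivative g x) (at x)" and f: "f \<in> S"
  shows "smooth f"
proof -
  have d: "deriv g \<in> S \<and> (\<forall>x. g differentiable at x)" if g: "g \<in> S" for g
  proof -
    obtain g' where g': "g' \<in> S" "\<And>x. (g has_real_derivative g' x) (at x)"
      using S g by blast
    then have "deriv g = g'"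
      by (intro ext DERIV_imp_deriv)
    then show ?thesis
      using g' real_differentiable_def by blast
  qed
  have "(deriv ^^ n) f \<in> S" for n
    by (induction n) (use d f in auto)
  then show ?thesis
    using d unfolding smooth_def by blast
qed

lemma smooth_has_derivative: "smooth f \<Longrightarrow> (f has_real_derivative deriv f x) (at x)"
  unfolding smooth_def by (metis DERIV_deriv_iff_real_differentiable funpow_0)

lemma smooth_deriv: "smooth f \<Longrightarrow> smooth (deriv f)"
  unfolding smooth_def by (metis funpow_swap1 funpow.simps(2) o_apply)

lemma smooth_continuous: "smooth f \<Longrightarrow> continuous_on A f"
  by (meson DERIV_continuous_on smooth_has_derivative has_field_derivative_at_within)

text \<open>The generated algebra is closed under differentiation, so \<open>smooth_coinduct\<close>
  gives smoothness of sums, products and affine substitutions together, without a Leibniz formula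
  for higher derivatives.\<close>

inductive smooth_alg :: "(real \<Rightarrow> real) \<Rightarrow> bool" where
  base: "smooth f \<Longrightarrow> smooth_alg f"
| const: "smooth_alg (\<lambda>x. c)"
| add: "smooth_alg f \<Longrightarrow> smooth_alg g \<Longrightarrow> smooth_alg (\<lambda>x. f x + g x)"
| mult: "smooth_alg f \<Longrightarrow> smooth_alg g \<Longrightarrow> smooth_alg (\<lambda>x. f x * g x)"
| affine: "smooth_alg f \<Longrightarrow> smooth_alg (\<lambda>x. f (a + b * x))"

lemma smooth_alg_derivative:
  "smooth_alg f \<Longrightarrow> \<exists>g. smooth_alg g \<and> (\<forall>x. (f has_real_derivative g x) (at x))"
proof (induction rule: smooth_alg.induct)
  case (base f)
  then show ?case
    using smooth_alg.base[OF smooth_deriv] smooth_has_derivative by blast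
next
  case (const c)
  show ?case
    by (rule exI[of _ "\<lambda>x. 0"]) (auto intro: smooth_alg.const)
next
  case (add f g)
  then obtain f' g' where "smooth_alg f'" "smooth_alg g'"
    "\<And>x. (f has_real_derivative f' x) (at x)" "\<And>x. (g has_real_derivative g' x) (at x)" by blast
  then show ?case
    by (intro exI[of _ "\<lambda>x. f' x + g' x"]) (auto intro: smooth_alg.add DERIV_add)
next
  case (mult f g)
  then obtain f' g' where "smooth_alg f'" "smooth_alg g'"
    "\<And>x. (f has_real_derivative f' x) (at x)" "\<And>x. (g has_real_derivative g' x) (at x)" by blast
  with mult show ?case
    by (intro exI[of _ "\<lambda>x. f x * g' x + f' x * g x"])
      (auto intro!: smooth_alg.add smooth_alg.mult DERIV_mult')
next
  case (affine f a b)
  then obtain f' where f': "smooth_alg f'" "\<And>x. (f has_real_derivative f' x) (at x)" by blast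
  have "((\<lambda>x. f (a + b * x)) has_real_derivative f' (a + b * x) * b) (at x)" for x
    by (rule DERIV_chain2[OF f'(2)]) (auto intro!: derivative_eq_intros)
  then show ?case
    by (intro exI[of _ "\<lambda>x. f' (a + b * x) * b"]) (auto intro!: smooth_alg.mult smooth_alg.const smooth_alg.affine f'(1))
qed

lemma smooth_alg_iff: "smooth_alg f \<longleftrightarrow> smooth f"
  using smooth_coinduct[of "Collect smooth_alg" f] smooth_alg_derivative smooth_alg.base by auto

lemmas smooth_const = smooth_alg.const[unfolded smooth_alg_iff]
  and smooth_add = smooth_alg.add[unfolded smooth_alg_iff]
  and smooth_mult = smooth_alg.mult[unfolded smooth_alg_iff]
  and smooth_affine = smooth_alg.affine[unfolded smooth_alg_iff]

lemma smooth_antiderivative: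
  assumes "\<And>x. (F has_real_derivative f x) (at x)" "smooth f"
  shows "smooth F"
proof -
  have "deriv F = f"
    using assms(1) by (intro ext DERIV_imp_deriv)
  then have "(deriv ^^ Suc n) F = (deriv ^^ n) f" for n
    by (simp only: funpow_Suc_right o_apply)
  then show ?thesis
    using assms unfolding smooth_def
    by (metis funpow_0 not0_implies_Suc real_differentiable_def)
qed

text \<open>For \<open>p = 1\<close> this is the classical flat function exp(-1/x) extended by 0.
  The polynomial factor in 1/x makes the family closed under differentiation.\<close>

definition flat_exp :: "real poly \<Rightarrow> real \<Rightarrow> real" where
  "flat_exp p x = (if x > 0 then poly p (1 / x) * exp (- (1 / x)) else 0)"

lemma poly_times_exp_minus_tendsto_0: "((\<lambda>y::real. poly p y * exp (- y)) \<longlongrightarrow> 0) at_top"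
proof -
  have "((\<lambda>y. \<Sum>i\<le>degree p. coeff p i * (y ^ i / exp y)) \<longlongrightarrow> (\<Sum>i\<le>degree p. coeff p i * 0)) at_top"
    by (intro tendsto_intros tendsto_power_div_exp_0)
  then show ?thesis
    by (simp add: poly_altdef sum_distrib_right exp_minus divide_inverse mult.assoc)
qed

text \<open>With y = 1/x, differentiating p(y) exp(-y) gives y^2 (p - p')(y) exp(-y), again of the
  same form. At 0 the difference quotient from the right is y p(y) exp(-y), which tends to 0 as y
  grows.\<close>

lemma flat_exp_derivative:
  "(flat_exp p has_real_derivative flat_exp ([:0, 0, 1:] * (p - pderiv p)) x) (at x)"
proof -
  consider "x > 0" | "x = 0" | "x < 0" by linarith
  then show ?thesis
  proof cases
    case 1
    have "((\<lambda>x. poly p (1 / x) * exp (- (1 / x))) has_real_derivative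
        flat_exp ([:0, 0, 1:] * (p - pderiv p)) x) (at x)"
      using 1 by (auto intro!: derivative_eq_intros poly_DERIV[THEN DERIV_chain2]
          simp: flat_exp_def field_simps power2_eq_square)
    then show ?thesis
      by (rule has_field_derivative_transform_within_open[of _ _ _ "{0<..}"]) (use 1 in \<open>auto simp: flat_exp_def\<close>)
  next
    case 2
    have "((\<lambda>y. poly ([:0, 1:] * p) y * exp (- y)) \<longlongrightarrow> 0) at_top"
      by (rule poly_times_exp_minus_tendsto_0)
    then have "((\<lambda>y. poly ([:0, 1:] * p) (inverse y) * exp (- inverse y)) \<longlongrightarrow> 0) (at_right 0)"
      using filterlim_compose[OF _ filterlim_inverse_at_top_right] by blast
    then have R: "((\<lambda>y. flat_exp p y / y) \<longlongrightarrow> 0) (at_right 0)"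
      by (rule Lim_transform_eventually)
        (auto simp: eventually_at_filter flat_exp_def divide_inverse mult_ac)
    have "((\<lambda>y. flat_exp p y / y) \<longlongrightarrow> 0) (at_left 0)"
      by (rule tendsto_eventually) (auto simp: eventually_at_filter flat_exp_def)
    then have "((\<lambda>y. flat_exp p y / y) \<longlongrightarrow> 0) (at 0)"
      using R filterlim_split_at by blast
    then show ?thesis
      using 2 by (simp add: has_field_derivative_iff flat_exp_def)
  next
    case 3
    have "((\<lambda>x. 0) has_real_derivative flat_exp ([:0, 0, 1:] * (p - pderiv p)) x) (at x)"
      using 3 by (simp add: flat_exp_def)
    then show ?thesis
      by (rule has_field_derivative_transform_within_open[of _ _ _ "{..<0}"]) (use 3 in \<open>auto simp: flat_exp_def\<close>)
  qed
qed

lemma smooth_flat_exp: "smooth (flat_exp p)"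
  by (rule smooth_coinduct[of "range flat_exp"]) (use flat_exp_derivative in blast)+

text \<open>The dilation by \<open>n\<close> pushes both factors to 1 inside the interval while the
  support stays put, so these test functions converge boundedly to the indicator of the open
  interval.\<close>

definition bump :: "real \<Rightarrow> real \<Rightarrow> nat \<Rightarrow> real \<Rightarrow> real" where
  "bump a b n x = flat_exp 1 (real n * (x - a)) * flat_exp 1 (real n * (b - x))"

lemma smooth_bump: "smooth (bump a b n)"
proof -
  have "smooth (\<lambda>x. flat_exp 1 (- (real n * a) + real n * x) * flat_exp 1 (real n * b + (- real n) * x))"
    by (intro smooth_mult smooth_affine smooth_flat_exp)
  moreover have "bump a b n = (\<lambda>x. flat_exp 1 (- (real n * a) + real n * x) * flat_exp 1 (real n * b + (- real n) * x))"
    by (simp add: fun_eq_iff bump_def algebra_simps)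
  ultimately show ?thesis by simp
qed

lemma bump_bounds: "0 \<le> bump a b n x" "bump a b n x \<le> 1"
  by (auto simp: bump_def flat_exp_def mult_le_one)

lemma bump_eq_0: "x \<notin> {a<..<b} \<Longrightarrow> bump a b n x = 0"
  by (auto simp: bump_def flat_exp_def not_less mult_le_0_iff zero_less_mult_iff)

lemma bump_pos: "a < x \<Longrightarrow> x < b \<Longrightarrow> n > 0 \<Longrightarrow> bump a b n x > 0"
  by (auto simp: bump_def flat_exp_def)

lemma bump_tendsto: "(\<lambda>n. bump a b n x) \<longlonglongrightarrow> indicator {a<..<b} x"
proof (cases "x \<in> {a<..<b}")
  case True
  have "(\<lambda>n. exp (- (1 / (real n * c)))) \<longlonglongrightarrow> 1" if "c > 0" for c
    using that by real_asymp
  from tendsto_mult[OF this[of "x - a"] this[of "b - x"]] True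
  have "(\<lambda>n. exp (- (1 / (real n * (x - a)))) * exp (- (1 / (real n * (b - x))))) \<longlonglongrightarrow> 1"
    by simp
  then have "(\<lambda>n. bump a b n x) \<longlonglongrightarrow> 1"
    by (rule Lim_transform_eventually)
      (use True in \<open>auto simp: bump_def flat_exp_def intro!: eventually_mono[OF eventually_gt_at_top[of 0]]\<close>)
  then show ?thesis using True by simp
qed (use bump_eq_0 in simp)

section \<open>Test functions and their supports\<close>

lemma test_function_iff:
  "test_function \<Omega> \<phi> \<longleftrightarrow> smooth \<phi> \<and> compact (closure {x. \<phi> x \<noteq> 0}) \<and> closure {x. \<phi> x \<noteq> 0} \<subseteq> \<Omega>"
  by (auto simp: test_function_def smooth_def)

lemma test_functionI:
  assumes "smooth \<phi>" "\<And>x. x \<notin> {a..b} \<Longrightarrow> \<phi> x = 0" "{a..b} \<subseteq> \<Omega>"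
  shows "test_function \<Omega> \<phi>"
proof -
  have "closure {x. \<phi> x \<noteq> 0} \<subseteq> {a..b}"
    by (rule closure_minimal) (use assms(2) in \<open>force simp del: not_le\<close>)+
  moreover from this have "compact (closure {x. \<phi> x \<noteq> 0})"
    using bounded_subset compact_eq_bounded_closed bounded_closed_interval by (metis closed_closure)
  ultimately show ?thesis
    using assms by (auto simp: test_function_iff)
qed

lemma test_function_bump: "{a..b} \<subseteq> \<Omega> \<Longrightarrow> test_function \<Omega> (bump a b n)"
  by (rule test_functionI[OF smooth_bump]) (auto intro!: bump_eq_0)

text \<open>The support is compact, hence bounded, and if \<open>\<Omega>\<close> omits 0 it also
  stays at positive distance from 0; \<open>a\<close> carries information only in that case.\<close>

lemma test_function_support:
  assumes "test_function \<Omega> \<phi>"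
  obtains a b where "a > 0" "b>a" "\<And>x. \<bar>x\<bar> > b \<Longrightarrow> \<phi> x = 0"
    "\<Omega> \<subseteq> - {0} \<Longrightarrow> \<forall>x. \<bar>x\<bar> < a \<longrightarrow> \<phi> x = 0"
proof -
  let ?C = "closure {x. \<phi> x \<noteq> 0}"
  have c: "bounded ?C" "closed ?C" "?C \<subseteq> \<Omega>"
    using assms by (auto simp: test_function_iff compact_imp_bounded)
  then obtain b where b: "\<And>x. x \<in> ?C \<Longrightarrow> \<bar>x\<bar> \<le> b"
    by (auto simp: bounded_iff)
  have "\<exists>a>0. \<Omega> \<subseteq> - {0} \<longrightarrow> (\<forall>x. \<bar>x\<bar> < a \<longrightarrow> \<phi> x = 0)"
  proof (cases "\<Omega> \<subseteq> - {0}")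
    case True
    then have "0 \<in> - ?C" "open (- ?C)" using c by auto
    then obtain a where "a > 0" "\<And>x. \<bar>x\<bar> < a \<Longrightarrow> x \<notin> ?C"
      by (force simp: open_contains_ball subset_iff dist_real_def)
    then show ?thesis
      using closure_subset[of "{x. \<phi> x \<noteq> 0}"] by blast
  qed (use zero_less_one in blast)
  then obtain a where a: "a > 0" "\<Omega> \<subseteq> - {0} \<Longrightarrow> \<forall>x. \<bar>x\<bar> < a \<longrightarrow> \<phi> x = 0" by blast
  show ?thesis
    by (rule that[of a "max b (a + 1)"]) (use a b closure_subset[of "{x. \<phi> x \<noteq> 0}"] in \<open>auto simp: subset_iff\<close>, force)
qed

section \<open>Primitives of locally integrable functions on the half-line\<close>

abbreviation AE_pos :: "(real \<Rightarrow> bool) \<Rightarrow> bool" (binder \<open>AEpos \<close> 10) where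
  "AE_pos P \<equiv> AE x in lborel. x > 0 \<longrightarrow> P x"

text \<open>Local absolute continuity on the closed half-line with derivative \<open>f\<close>, in
  integrated form: \<open>f\<close> matters only up to null sets, and \<open>F 0\<close> is a
  genuine boundary value.\<close>

definition primitive :: "(real \<Rightarrow> complex) \<Rightarrow> (real \<Rightarrow> complex) \<Rightarrow> bool" where
  "primitive F f \<longleftrightarrow> (\<forall>x\<ge>0. set_integrable lborel {0..x} f \<and> F x = F 0 + (LBINT t:{0..x}. f t))"

lemma primitive_integrable: "primitive F f \<Longrightarrow> set_integrable lborel {0..x} f"
  unfolding primitive_def by (cases "x \<ge> 0") (blast, simp)

lemma primitive_eq: "primitive F f \<Longrightarrow> x \<ge> 0 \<Longrightarrow> F x = F 0 + (LBINT t:{0..x}. f t)"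
  unfolding primitive_def by blast

lemma primitiveI:
  assumes "\<And>x. x \<ge> 0 \<Longrightarrow> set_integrable lborel {0..x} f"
    and "\<And>x. x \<ge> 0 \<Longrightarrow> F x = F 0 + (LBINT t:{0..x}. f t)"
  shows "primitive F f"
  using assms unfolding primitive_def by blast

lemma primitive_add:
  assumes "primitive F f" "primitive G g"
  shows "primitive (\<lambda>x. F x + G x) (\<lambda>x. f x + g x)"
proof (rule primitiveI)
  fix x :: real assume "x \<ge> 0"
  then show "F x + G x = F 0 + G 0 + (LBINT t:{0..x}. f t + g t)"
    using primitive_eq[OF assms(1), of x] primitive_eq[OF assms(2), of x]
    by (simp add: assms[THEN primitive_integrable])
qed (simp add: assms[THEN primitive_integrable])

lemma primitive_scale:
  assumes "primitive F f"
  shows "primitive (\<lambda>x. c * F x) (\<lambda>x. c * f x)"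
proof (rule primitiveI)
  fix x :: real assume "x \<ge> 0"
  then show "c * F x = c * F 0 + (LBINT t:{0..x}. c * f t)"
    using primitive_eq[OF assms, of x] by (simp add: distrib_left)
qed (simp add: primitive_integrable[OF assms])

lemma primitive_cnj: "primitive F f \<Longrightarrow> primitive (\<lambda>x. cnj (F x)) (\<lambda>x. cnj (f x))"
proof -
  have c: "(\<lambda>x. indicator A x *\<^sub>R cnj (f x)) = (\<lambda>x. cnj (indicator A x *\<^sub>R f x))" for A and f :: "real \<Rightarrow> complex"
    by (auto simp: fun_eq_iff)
  assume F: "primitive F f"
  show ?thesis
  proof (rule primitiveI)
    fix x :: real assume "x \<ge> 0"
    then show "cnj (F x) = cnj (F 0) + (LBINT t:{0..x}. cnj (f t))"
      using arg_cong[where f = cnj, OF primitive_eq[OF F, of x]]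
      by (simp add: set_lebesgue_integral_def c del: complex_cnj_scaleR)
  qed (use primitive_integrable[OF F] in \<open>simp add: set_integrable_def c del: complex_cnj_scaleR\<close>)
qed

lemma primitive_cong:
  assumes "primitive F f" "\<And>x. x \<ge> 0 \<Longrightarrow> F x = G x" "\<And>x. x > 0 \<Longrightarrow> f x = g x"
  shows "primitive G g"
  unfolding primitive_def
proof (intro allI impI conjI)
  fix x :: real assume x: "x \<ge> 0"
  show "set_integrable lborel {0..x} g"
  proof -
    have "set_integrable lborel {0<..x} f"
      by (rule set_integrable_subset[OF primitive_integrable[OF assms(1), of x]]) auto
    then have "set_integrable lborel {0<..x} g"
      by (rule set_integrable_cong[THEN iffD1, rotated -1]) (auto simp: assms(3))
    then show ?thesis
      by (subst set_integrable_discrete_difference[where X = "{0}" and B = "{0<..x}"]) auto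
  qed
  have "(LBINT t:{0..x}. f t) = (LBINT t:{0..x}. g t)"
    using assms(3)
    by (subst (1 2) set_integral_discrete_difference[where X = "{0}" and B = "{0<..x}"])
      (auto intro!: set_lebesgue_integral_cong)
  then show "G x = G 0 + (LBINT t:{0..x}. g t)"
    using primitive_eq[OF assms(1) x] assms(2) x by simp
qed

lemma primitive_cong_AE:
  assumes "primitive F f" "AEpos x. f x = g x"
    "\<And>x. set_borel_measurable lborel {0..x} g"
  shows "primitive F g"
  unfolding primitive_def
proof (intro allI impI conjI)
  fix x :: real assume x: "x \<ge> 0"
  have [measurable]: "(\<lambda>t. indicator {0..x} t *\<^sub>R f t) \<in> borel_measurable borel"
    "(\<lambda>t. indicator {0..x} t *\<^sub>R g t) \<in> borel_measurable borel"
    using primitive_integrable[OF assms(1), of x] assms(3)[of x]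
    by (auto simp: set_integrable_def set_borel_measurable_def dest: borel_measurable_integrable)
  have ae: "AE t in lborel. indicator {0..x} t *\<^sub>R f t = indicator {0..x} t *\<^sub>R g t"
    using assms(2) AE_lborel_singleton[of 0] by eventually_elim (auto simp: indicator_def)
  show "set_integrable lborel {0..x} g"
    using primitive_integrable[OF assms(1), of x] unfolding set_integrable_def
    by (subst (asm) integrable_cong_AE[OF _ _ ae]) auto
  have "(LBINT t:{0..x}. f t) = (LBINT t:{0..x}. g t)"
    unfolding set_lebesgue_integral_def by (rule integral_cong_AE[OF _ _ ae]) auto
  then show "F x = F 0 + (LBINT t:{0..x}. g t)"
    using primitive_eq[OF assms(1) x] by simp
qed

lemma LBINT_singleton: "(LBINT t:{a}. h t) = (0 :: complex)"
  unfolding set_lebesgue_integral_def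
  by (rule integral_eq_zero_AE) (use AE_lborel_singleton[of a] in \<open>auto elim!: eventually_mono\<close>)

lemma primitive_indefinite:
  assumes "\<And>x. set_integrable lborel {0..x} f"
  shows "primitive (\<lambda>x. c + (LBINT t:{0..x}. f t)) f"
  using assms by (simp add: primitive_def LBINT_singleton)

lemma primitive_FTC:
  assumes F: "\<And>x. x \<ge> 0 \<Longrightarrow> (F has_vector_derivative f x) (at x within {0..})"
    and f: "continuous_on {0..} f"
  shows "primitive F f"
  unfolding primitive_def
proof (intro allI impI conjI)
  fix x :: real assume x: "x \<ge> 0"
  have c: "continuous_on {0..x} f"
    by (rule continuous_on_subset[OF f]) auto
  show "set_integrable lborel {0..x} f"
    by (rule borel_integrable_atLeastAtMost'[OF c])
  have "integral\<^sup>L lborel (\<lambda>t. indicator {0..x} t *\<^sub>R f t) = F x - F 0"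
    by (rule integral_FTC_atLeastAtMost[OF x _ c])
      (auto intro: has_vector_derivative_within_subset[OF F])
  then show "F x = F 0 + (LBINT t:{0..x}. f t)"
    by (simp add: set_lebesgue_integral_def)
qed

lemma primitive_continuous:
  assumes "primitive F f"
  shows "continuous_on {0..} F"
proof -
  have "continuous_on {0..X} F" for X
  proof -
    have "continuous_on {0..X} (\<lambda>x. F 0 + integral {0..x} f)"
      by (intro continuous_intros indefinite_integral_continuous_1
          set_borel_integral_eq_integral primitive_integrable[OF assms])
    then show ?thesis
      by (rule continuous_on_eq)
        (simp add: primitive_eq[OF assms, symmetric]
          set_borel_integral_eq_integral(2)[OF primitive_integrable[OF assms], symmetric])
  qed
  then have "continuous (at x within {0..x + 1}) F" if "x \<ge> 0" for x
    using that by (simp add: continuous_on_eq_continuous_within)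
  moreover have "at x within {0..} = at x within {0..x + 1}" for x :: real
    by (rule at_within_nhd[of x "{..<x + 1}"]) auto
  ultimately show ?thesis
    by (simp add: continuous_on_eq_continuous_within)
qed

text \<open>The product rule for absolutely continuous functions, from Fubini: the product of the
  two integrals is an integral over a square, which is cut along the diagonal into the triangles t
  <= s and s < t. The inner integrals over the triangles are the increments of \<open>G\<close> and
  \<open>F\<close>.\<close>

lemma primitive_mult:
  assumes Ff: "primitive F f" and Gg: "primitive G g"
  shows "primitive (\<lambda>x. F x * G x) (\<lambda>x. f x * G x + F x * g x)"
  unfolding primitive_def
proof (intro allI impI)
  fix x :: real assume x: "x \<ge> 0"
  define f' where "f' t = indicator {0..x} t *\<^sub>R f t" for t
  define g' where "g' t = indicator {0..x} t *\<^sub>R g t" for t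
  have int [simp]: "integrable lborel f'" "integrable lborel g'"
    using primitive_integrable[OF Ff, of x] primitive_integrable[OF Gg, of x]
    by (simp_all add: f'_def[abs_def] g'_def[abs_def] set_integrable_def)
  then have [measurable]: "f' \<in> borel_measurable borel" "g' \<in> borel_measurable borel"
    using borel_measurable_integrable[OF int(1)] borel_measurable_integrable[OF int(2)] by simp_all
  have H: "integrable (lborel \<Otimes>\<^sub>M lborel) (\<lambda>(s, t). f' s * g' t)"
    by (rule lborel_pair.Fubini_integrable) (auto simp: norm_mult)
  have H1: "integrable (lborel \<Otimes>\<^sub>M lborel) (\<lambda>(s, t). f' s * (indicator {t. t \<le> s} t *\<^sub>R g' t))"
    by (rule Bochner_Integration.integrable_bound[OF H]) (auto split: split_indicator)
  have H2: "integrable (lborel \<Otimes>\<^sub>M lborel) (\<lambda>(s, t). (indicator {s. s < t} s *\<^sub>R f' s) * g' t)"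
    by (rule Bochner_Integration.integrable_bound[OF H]) (auto split: split_indicator)
  have G: "f' s * (\<integral>t. indicator {t. t \<le> s} t *\<^sub>R g' t \<partial>lborel) = indicator {0..x} s *\<^sub>R (f s * (G s - G 0))" for s
  proof (cases "s \<in> {0..x}")
    case True
    then have "(\<integral>t. indicator {t. t \<le> s} t *\<^sub>R g' t \<partial>lborel) = (LBINT t:{0..s}. g t)"
      unfolding set_lebesgue_integral_def g'_def
      by (intro Bochner_Integration.integral_cong) (auto split: split_indicator)
    then show ?thesis
      using True primitive_eq[OF Gg, of s] by (simp add: f'_def)
  qed (simp add: f'_def)
  have F: "(\<integral>s. indicator {s. s < t} s *\<^sub>R f' s \<partial>lborel) * g' t = indicator {0..x} t *\<^sub>R ((F t - F 0) * g t)" for t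
  proof (cases "t \<in> {0..x}")
    case True
    have "(\<integral>s. indicator {s. s < t} s *\<^sub>R f' s \<partial>lborel) = (LBINT s:{0..<t}. f s)"
      unfolding set_lebesgue_integral_def f'_def
      by (intro Bochner_Integration.integral_cong) (use True in \<open>auto split: split_indicator\<close>)
    also have "\<dots> = (LBINT s:{0..t}. f s)"
      by (rule set_integral_discrete_difference[where X = "{t}"]) auto
    finally show ?thesis
      using True primitive_eq[OF Ff, of t] by (simp add: g'_def)
  qed (simp add: g'_def)
  have i1: "integrable lborel (\<lambda>s. indicator {0..x} s *\<^sub>R (f s * (G s - G 0)))"
    using lborel_pair.integrable_fst[OF H1] by (simp add: G del: mult_scaleR_right)
  have i2: "integrable lborel (\<lambda>t. indicator {0..x} t *\<^sub>R ((F t - F 0) * g t))"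
    using lborel_pair.integrable_snd[OF H2] by (simp add: F del: mult_scaleR_left)
  have fi: "integrable lborel (\<lambda>t. G 0 * f' t)" "integrable lborel (\<lambda>t. F 0 * g' t)"
    by auto
  have split: "indicator {0..x} t *\<^sub>R (f t * G t + F t * g t) =
      (indicator {0..x} t *\<^sub>R (f t * (G t - G 0)) + indicator {0..x} t *\<^sub>R ((F t - F 0) * g t))
      + (G 0 * f' t + F 0 * g' t)" for t
    by (simp add: f'_def g'_def split: split_indicator) (simp add: algebra_simps)
  show "set_integrable lborel {0..x} (\<lambda>x. f x * G x + F x * g x) \<and>
      F x * G x = F 0 * G 0 + (LBINT t:{0..x}. f t * G t + F t * g t)"
  proof
    show "set_integrable lborel {0..x} (\<lambda>x. f x * G x + F x * g x)"
      unfolding set_integrable_def split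
      by (intro Bochner_Integration.integrable_add i1 i2 fi)
    have "(\<integral>s. f' s \<partial>lborel) * (\<integral>t. g' t \<partial>lborel) = (\<integral>s. (\<integral>t. f' s * g' t \<partial>lborel) \<partial>lborel)"
      by simp
    also have "\<dots> = (\<integral>(s, t). f' s * g' t \<partial>(lborel \<Otimes>\<^sub>M lborel))"
      by (rule lborel_pair.integral_fst[OF H])
    also have "\<dots> = (\<integral>p. (case p of (s, t) \<Rightarrow> f' s * (indicator {t. t \<le> s} t *\<^sub>R g' t))
        + (case p of (s, t) \<Rightarrow> (indicator {s. s < t} s *\<^sub>R f' s) * g' t) \<partial>(lborel \<Otimes>\<^sub>M lborel))"
      by (intro Bochner_Integration.integral_cong) (auto split: split_indicator)
    also have "\<dots> = (\<integral>s. (\<integral>t. f' s * (indicator {t. t \<le> s} t *\<^sub>R g' t) \<partial>lborel) \<partial>lborel)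
        + (\<integral>t. (\<integral>s. (indicator {s. s < t} s *\<^sub>R f' s) * g' t \<partial>lborel) \<partial>lborel)"
      by (subst Bochner_Integration.integral_add[OF H1 H2])
        (simp only: lborel_pair.integral_fst[OF H1] lborel_pair.integral_snd[OF H2])
    also have "\<dots> = (\<integral>s. indicator {0..x} s *\<^sub>R (f s * (G s - G 0)) \<partial>lborel)
        + (\<integral>t. indicator {0..x} t *\<^sub>R ((F t - F 0) * g t) \<partial>lborel)"
      by (simp add: G F del: mult_scaleR_left mult_scaleR_right)
    finally have *: "(LBINT t:{0..x}. f t) * (LBINT t:{0..x}. g t) = \<dots>"
      by (simp add: f'_def g'_def set_lebesgue_integral_def)
    have "(LBINT t:{0..x}. f t * G t + F t * g t) =
      ((\<integral>s. indicator {0..x} s *\<^sub>R (f s * (G s - G 0)) \<partial>lborel)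
        + (\<integral>t. indicator {0..x} t *\<^sub>R ((F t - F 0) * g t) \<partial>lborel))
      + (G 0 * (LBINT t:{0..x}. f t) + F 0 * (LBINT t:{0..x}. g t))"
      unfolding set_lebesgue_integral_def split
      using i1 i2 int fi
      by (simp add: Bochner_Integration.integral_add[OF Bochner_Integration.integrable_add[OF i1 i2] Bochner_Integration.integrable_add[OF fi]])
        (simp add: f'_def[abs_def] g'_def[abs_def])
    then show "F x * G x = F 0 * G 0 + (LBINT t:{0..x}. f t * G t + F t * g t)"
      using * primitive_eq[OF Ff x] primitive_eq[OF Gg x] by (simp add: algebra_simps)
  qed
qed

lemma primitive_exp: "primitive (\<lambda>x. exp (k * of_real x)) (\<lambda>x. k * exp (k * of_real x))"
proof (rule primitive_FTC)
  fix x :: real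
  have "((\<lambda>z. exp (k * z)) has_field_derivative k * exp (k * of_real x)) (at (of_real x))"
    by (auto intro!: derivative_eq_intros)
  then show "((\<lambda>x. exp (k * of_real x)) has_vector_derivative k * exp (k * of_real x)) (at x within {0..})"
    by (rule has_vector_derivative_real_field)
qed (intro continuous_intros)

section \<open>Square-integrable functions\<close>

lemma square_integrable_cong:
  "square_integrable f \<Longrightarrow> g \<in> borel_measurable lborel \<Longrightarrow> AE x in lborel. f x = g x \<Longrightarrow> square_integrable g"
proof -
  assume f: "square_integrable f" and g [measurable]: "g \<in> borel_measurable lborel"
    and ae: "AE x in lborel. f x = g x"
  have [measurable]: "f \<in> borel_measurable lborel" using f by (simp add: square_integrable_def)
  have "AE x in lborel. (cmod (f x))\<^sup>2 = (cmod (g x))\<^sup>2" using ae by eventually_elim simp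
  from integrable_cong_AE[OF _ _ this] f g show ?thesis
    by (simp add: square_integrable_def)
qed

lemma square_integrable_rep: "square_integrable (rep_L2R u)"
  using Quotient3_rep_reflp[OF Quotient3_L2R] by blast

lemma abs_rep_L2R: "abs_L2R (rep_L2R u) = u"
  by (rule Quotient3_abs_rep[OF Quotient3_L2R])

lemma abs_L2R_eq_iff:
  "square_integrable f \<Longrightarrow> square_integrable g \<Longrightarrow> abs_L2R f = abs_L2R g \<longleftrightarrow> (AE x in lborel. f x = g x)"
  using Quotient3_rel[OF Quotient3_L2R, of f g] by auto

lemma rep_abs_L2R: "square_integrable f \<Longrightarrow> AE x in lborel. rep_L2R (abs_L2R f) x = f x"
  using abs_L2R_eq_iff[OF square_integrable_rep, of f "abs_L2R f"] by (simp add: abs_rep_L2R)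

lemma norm_abs_L2R:
  assumes "square_integrable g"
  shows "norm (abs_L2R g) = sqrt (\<integral>x. (cmod (g x))\<^sup>2 \<partial>lborel)"
proof -
  have "(\<integral>x. (cmod (rep_L2R (abs_L2R g) x))\<^sup>2 \<partial>lborel) = (\<integral>x. (cmod (g x))\<^sup>2 \<partial>lborel)"
    using rep_abs_L2R[OF assms] assms square_integrable_rep[of "abs_L2R g"]
    by (intro integral_cong_AE) (auto simp: square_integrable_def)
  then show ?thesis
    by (simp add: norm_L2R_def inner_L2R_def cinner_L2R_self)
qed

lemma abs_L2R_add:
  "square_integrable f \<Longrightarrow> square_integrable g \<Longrightarrow> abs_L2R f + abs_L2R g = abs_L2R (\<lambda>x. f x + g x)"
  by (rule plus_L2R.abs_eq) auto

lemma abs_L2R_scaleC: "square_integrable f \<Longrightarrow> c *C abs_L2R f = abs_L2R (\<lambda>x. c * f x)"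
  by (rule scaleC_L2R.abs_eq) auto

lemma abs_L2R_uminus: "square_integrable f \<Longrightarrow> - abs_L2R f = abs_L2R (\<lambda>x. - f x)"
  by (rule uminus_L2R.abs_eq) auto

lemma cinner_abs_L2R:
  "square_integrable f \<Longrightarrow> square_integrable g \<Longrightarrow>
    cinner_L2R (abs_L2R f) (abs_L2R g) = (\<integral>x. f x * cnj (g x) \<partial>lborel)"
  by (rule cinner_L2R.abs_eq) auto

lemma cinner_scaleC_left: "cinner_L2R (c *C u) v = c * cinner_L2R u v"
  by transfer (simp add: mult.assoc)

lemma cinner_add_left: "cinner_L2R (u + v) w = cinner_L2R u w + cinner_L2R v w"
  by transfer (simp add: distrib_right square_integrable_prod)

lemma norm_cinner_L2R_le: "cmod (cinner_L2R u v) \<le> norm u * norm v"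
proof (cases "cinner_L2R u v = 0")
  case False
  \<comment> \<open>A unimodular factor that rotates the complex product onto its modulus, so that
    the Cauchy-Schwarz inequality of the real inner product applies.\<close>
  define c where "c = cnj (cinner_L2R u v) / cmod (cinner_L2R u v)"
  have "cmod c = 1"
    using False by (simp add: c_def norm_divide)
  have "complex_of_real (cmod (cinner_L2R u v)) = cinner_L2R (c *C u) v"
    using False by (simp add: cinner_scaleC_left c_def mult.commute complex_norm_square[symmetric] power2_eq_square)
  then have "cmod (cinner_L2R u v) = inner (c *C u) v"
    by (simp add: inner_L2R_def) (metis Re_complex_of_real)
  also have "\<dots> \<le> norm (c *C u) * norm v"
    by (rule norm_cauchy_schwarz)
  finally show ?thesis
    using \<open>cmod c = 1\<close> by (simp add: norm_scaleC)
qed auto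

lemma square_integrable_cnj: "square_integrable f \<Longrightarrow> square_integrable (\<lambda>x. cnj (f x))"
  unfolding square_integrable_def by (auto simp: borel_measurable_complex_iff)

lemma norm_abs_L2R_cnj: "square_integrable f \<Longrightarrow> norm (abs_L2R (\<lambda>x. cnj (f x))) = norm (abs_L2R f)"
  by (simp add: norm_abs_L2R square_integrable_cnj)

text \<open>Functions on the half-line are placed into \<open>L2R\<close> by extension by zero, so
  that \<open>hsq\<close> and \<open>hnorm\<close> inherit sums, triangle inequality and
  Cauchy-Schwarz from the line.\<close>

definition half_cut :: "(real \<Rightarrow> complex) \<Rightarrow> real \<Rightarrow> complex" where
  "half_cut f x = (if 0 < x then f x else 0)"

definition hsq :: "(real \<Rightarrow> complex) \<Rightarrow> bool" where
  "hsq f \<longleftrightarrow> square_integrable (half_cut f)"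

definition hnorm :: "(real \<Rightarrow> complex) \<Rightarrow> real" where
  "hnorm f = norm (abs_L2R (half_cut f))"

lemma hnorm_nonneg [simp]: "0 \<le> hnorm f"
  by (simp add: hnorm_def)

lemma half_cut_eqI: "(\<And>x. x > 0 \<Longrightarrow> f x = g x) \<Longrightarrow> half_cut f = half_cut g"
  by (auto simp: half_cut_def)

lemma hsq_cong: "(\<And>x. x > 0 \<Longrightarrow> f x = g x) \<Longrightarrow> hsq f \<longleftrightarrow> hsq g"
  using half_cut_eqI[of f g] by (simp add: hsq_def)

lemma half_cut_indicator: "half_cut f x = indicator {0<..} x *\<^sub>R f x"
  by (auto simp: half_cut_def)

lemma half_cut_measurable: "f \<in> borel_measurable borel \<Longrightarrow> half_cut f \<in> borel_measurable borel"
  by (simp add: half_cut_indicator[abs_def] borel_measurable_scaleR)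

lemma hsq_square_integrable: "square_integrable f \<Longrightarrow> hsq f"
proof -
  have "square_integrable (\<lambda>x. indicator {0<..} x * f x)" if "square_integrable f"
    by (rule square_integrable_mult_bounded[OF that, where K = 1]) (auto simp: indicator_def)
  moreover have "(\<lambda>x. indicator {0<..} x * f x) = half_cut f"
    by (auto simp: half_cut_def)
  ultimately show "square_integrable f \<Longrightarrow> hsq f"
    by (simp add: hsq_def)
qed

lemma hnorm_square: "hsq f \<Longrightarrow> (hnorm f)\<^sup>2 = (\<integral>x. (cmod (half_cut f x))\<^sup>2 \<partial>lborel)"
  unfolding hnorm_def hsq_def by (simp add: norm_abs_L2R)

lemma
  assumes "hsq f" "hsq g"
  shows hsq_add: "hsq (\<lambda>x. f x + g x)"
    and hnorm_add: "hnorm (\<lambda>x. f x + g x) \<le> hnorm f + hnorm g"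
proof -
  have eq: "half_cut (\<lambda>x. f x + g x) = (\<lambda>x. half_cut f x + half_cut g x)"
    by (auto simp: half_cut_def)
  show "hsq (\<lambda>x. f x + g x)"
    using assms square_integrable_add by (simp add: hsq_def eq)
  have "abs_L2R (half_cut (\<lambda>x. f x + g x)) = abs_L2R (half_cut f) + abs_L2R (half_cut g)"
    using assms by (simp add: abs_L2R_add hsq_def eq)
  then show "hnorm (\<lambda>x. f x + g x) \<le> hnorm f + hnorm g"
    by (simp add: hnorm_def norm_triangle_ineq)
qed

lemma
  assumes "hsq f"
  shows hsq_scale: "hsq (\<lambda>x. c * f x)"
    and hnorm_scale: "hnorm (\<lambda>x. c * f x) = cmod c * hnorm f"
proof -
  have eq: "half_cut (\<lambda>x. c * f x) = (\<lambda>x. c * half_cut f x)"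
    by (auto simp: half_cut_def)
  show "hsq (\<lambda>x. c * f x)"
    using assms square_integrable_scale by (simp add: hsq_def eq)
  have "abs_L2R (half_cut (\<lambda>x. c * f x)) = c *C abs_L2R (half_cut f)"
    using assms by (simp add: abs_L2R_scaleC hsq_def eq)
  then show "hnorm (\<lambda>x. c * f x) = cmod c * hnorm f"
    by (simp add: hnorm_def norm_scaleC)
qed

lemma hsq_mult_bounded:
  assumes "hsq f" "w \<in> borel_measurable borel" "\<And>x. x > 0 \<Longrightarrow> cmod (w x) \<le> K"
  shows "hsq (\<lambda>x. w x * f x)"
proof -
  have "0 \<le> K" by (rule order_trans[OF norm_ge_zero assms(3)[of 1]]) simp
  have "square_integrable (\<lambda>x. half_cut w x * half_cut f x)"
  proof (rule square_integrable_mult_bounded[where K = K])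
    show "cmod (half_cut w x) \<le> K" for x
      using assms(3) \<open>0 \<le> K\<close> by (simp add: half_cut_def)
  qed (use assms in \<open>auto simp: hsq_def half_cut_measurable\<close>)
  moreover have "(\<lambda>x. half_cut w x * half_cut f x) = half_cut (\<lambda>x. w x * f x)"
    by (auto simp: half_cut_def)
  ultimately show ?thesis by (simp add: hsq_def)
qed

lemma hsq_norm_square:
  assumes "hsq f"
  shows "set_integrable lborel {0..X} (\<lambda>x. (cmod (f x))\<^sup>2)"
    and "(LBINT x:{0..X}. (cmod (f x))\<^sup>2) \<le> (hnorm f)\<^sup>2"
proof -
  have i: "integrable lborel (\<lambda>x. (cmod (half_cut f x))\<^sup>2)"
    using assms by (simp add: hsq_def square_integrable_def)
  have eq: "indicator {0<..X} x *\<^sub>R (cmod (f x))\<^sup>2 = indicator {0<..X} x *\<^sub>R (cmod (half_cut f x))\<^sup>2" for x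
    by (auto simp: half_cut_def split: split_indicator)
  have i2: "integrable lborel (\<lambda>x. indicator {0<..X} x *\<^sub>R (cmod (half_cut f x))\<^sup>2)"
    by (rule integrable_mult_indicator[OF _ i]) simp
  show "set_integrable lborel {0..X} (\<lambda>x. (cmod (f x))\<^sup>2)"
    using i2 by (subst set_integrable_discrete_difference[where X = "{0}" and B = "{0<..X}"])
      (auto simp only: set_integrable_def eq, auto)
  have "(LBINT x:{0..X}. (cmod (f x))\<^sup>2) = (LBINT x:{0<..X}. (cmod (f x))\<^sup>2)"
    by (rule set_integral_discrete_difference[where X = "{0}"]) auto
  also have "\<dots> \<le> (\<integral>x. (cmod (half_cut f x))\<^sup>2 \<partial>lborel)"
    unfolding set_lebesgue_integral_def eq
    by (rule integral_mono[OF i2 i]) (auto split: split_indicator)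
  finally show "(LBINT x:{0..X}. (cmod (f x))\<^sup>2) \<le> (hnorm f)\<^sup>2"
    by (simp add: hnorm_square[OF assms])
qed

lemma hsq_prod:
  assumes "hsq f" "hsq g"
  shows "set_integrable lborel {0<..} (\<lambda>x. f x * g x)"
    and "cmod (LBINT x:{0<..}. f x * g x) \<le> hnorm f * hnorm g"
proof -
  have eq: "indicator {0<..} x *\<^sub>R (f x * g x) = half_cut f x * cnj (cnj (half_cut g x))" for x
    by (auto simp: half_cut_def)
  have sq: "square_integrable (half_cut f)" "square_integrable (\<lambda>x. cnj (half_cut g x))"
    using assms by (auto simp: hsq_def square_integrable_cnj)
  show "set_integrable lborel {0<..} (\<lambda>x. f x * g x)"
    unfolding set_integrable_def eq by (rule square_integrable_prod[OF sq])
  have "cmod (cinner_L2R (abs_L2R (half_cut f)) (abs_L2R (\<lambda>x. cnj (half_cut g x)))) \<le> hnorm f * norm (abs_L2R (\<lambda>x. cnj (half_cut g x)))"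
    unfolding hnorm_def by (rule norm_cinner_L2R_le)
  then show "cmod (LBINT x:{0<..}. f x * g x) \<le> hnorm f * hnorm g"
    using assms unfolding set_lebesgue_integral_def eq
    by (simp only: cinner_abs_L2R[OF sq] norm_abs_L2R_cnj hsq_def hnorm_def)
qed

lemma half_cut_measurable_continuous:
  assumes "continuous_on {0..} y"
  shows "half_cut y \<in> borel_measurable borel"
proof -
  have "continuous_on {0<..} y"
    by (rule continuous_on_subset[OF assms]) auto
  then have "(\<lambda>x. indicator {0<..} x *\<^sub>R y x) \<in> borel_measurable borel"
    by (rule borel_measurable_continuous_on_indicator[rotated]) simp
  then show ?thesis by (simp add: half_cut_indicator[abs_def])
qed

lemma continuous_set_integrable:
  fixes y :: "real \<Rightarrow> 'a::{banach, second_countable_topology}"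
  assumes "continuous_on {0..} y"
  shows "set_integrable lborel {0..X} y"
  by (rule borel_integrable_atLeastAtMost'[OF continuous_on_subset[OF assms]]) auto

lemma set_integrable_mult_continuous:
  fixes g w :: "real \<Rightarrow> complex"
  assumes g: "set_integrable lborel {0..X} g" and c: "continuous_on {0..} w"
  shows "set_integrable lborel {0..X} (\<lambda>x. g x * w x)"
proof -
  obtain K where K: "\<And>x. x \<in> {0..X} \<Longrightarrow> cmod (w x) \<le> K"
    using compact_imp_bounded[OF compact_continuous_image[of "{0..X}" w]] continuous_on_subset[OF c, of "{0..X}"]
    unfolding bounded_iff by (metis compact_Icc imageI atLeastAtMost_iff atLeast_iff subsetI)
  have m: "(\<lambda>x. indicator {0..X} x *\<^sub>R w x) \<in> borel_measurable lborel" "(\<lambda>x. indicator {0..X} x *\<^sub>R g x) \<in> borel_measurable lborel"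
    using continuous_set_integrable[OF c, of X] g unfolding set_integrable_def by (blast dest: borel_measurable_integrable)+
  have "integrable lborel (\<lambda>x. (indicator {0..X} x *\<^sub>R g x) * (indicator {0..X} x *\<^sub>R w x))"
  proof (rule Bochner_Integration.integrable_bound)
    show "integrable lborel (\<lambda>x. of_real K * (indicator {0..X} x *\<^sub>R g x))"
      using g by (intro integrable_mult_right) (simp add: set_integrable_def)
    show "(\<lambda>x. (indicator {0..X} x *\<^sub>R g x) * (indicator {0..X} x *\<^sub>R w x)) \<in> borel_measurable lborel"
      by (intro borel_measurable_times m)
    show "AE x in lborel. cmod ((indicator {0..X} x *\<^sub>R g x) * (indicator {0..X} x *\<^sub>R w x))
        \<le> cmod (of_real K * (indicator {0..X} x *\<^sub>R g x))"
    proof (intro AE_I2)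
      fix x show "cmod ((indicator {0..X} x *\<^sub>R g x) * (indicator {0..X} x *\<^sub>R w x))
        \<le> cmod (of_real K * (indicator {0..X} x *\<^sub>R g x))"
        using K[of x] abs_ge_self[of K] mult_left_mono[of "cmod (w x)" "\<bar>K\<bar>" "cmod (g x)"]
        by (auto simp: norm_mult mult.commute split: split_indicator)
    qed
  qed
  moreover have "(\<lambda>x. (indicator {0..X} x *\<^sub>R g x) * (indicator {0..X} x *\<^sub>R w x)) = (\<lambda>x. indicator {0..X} x *\<^sub>R (g x * w x))"
    by (auto split: split_indicator)
  ultimately show ?thesis by (simp add: set_integrable_def)
qed

lemma hsq_set_integrable:
  assumes "hsq f"
  shows "set_integrable lborel {0..X} f"
proof -
  have f: "set_integrable lborel {0..X} (\<lambda>x. 1 + (cmod (f x))\<^sup>2)"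
    by (intro set_integral_add(1) hsq_norm_square(1) assms borel_integrable_atLeastAtMost' continuous_intros)
  have "set_integrable lborel {0<..X} f"
    unfolding set_integrable_def
  proof (rule Bochner_Integration.integrable_bound)
    show "integrable lborel (\<lambda>x. indicator {0..X} x *\<^sub>R (1 + (cmod (f x))\<^sup>2))"
      using f by (simp add: set_integrable_def)
    have "(\<lambda>x. indicator {0<..X} x *\<^sub>R half_cut f x) \<in> borel_measurable lborel"
      using assms by (auto simp: hsq_def square_integrable_def)
    moreover have "(\<lambda>x. indicator {0<..X} x *\<^sub>R half_cut f x) = (\<lambda>x. indicator {0<..X} x *\<^sub>R f x)"
      by (auto simp: half_cut_def split: split_indicator)
    ultimately show "(\<lambda>x. indicator {0<..X} x *\<^sub>R f x) \<in> borel_measurable lborel" by simp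
    have "c \<le> 1 + c\<^sup>2" for c :: real
      using sum_squares_bound[of 1 c] zero_le_power2[of c] unfolding one_power2 by linarith
    then show "AE x in lborel. norm (indicator {0<..X} x *\<^sub>R f x) \<le> norm (indicator {0..X} x *\<^sub>R (1 + (cmod (f x))\<^sup>2))"
      by (auto split: split_indicator)
  qed
  then show ?thesis
    by (subst set_integrable_discrete_difference[where X = "{0}" and B = "{0<..X}"]) auto
qed

lemma hsq_locally_integrable:
  "hsq f \<Longrightarrow> continuous_on {0..} w \<Longrightarrow> set_integrable lborel {0..X} (\<lambda>x. w x * f x)"
  using set_integrable_mult_continuous[OF hsq_set_integrable, of f w X] by (simp add: mult.commute)

text \<open>Monotone convergence over the intervals from 0 to n. This is how energy estimates on
  bounded intervals, uniform in the endpoint, yield square integrability.\<close>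

lemma hsqI_bounded:
  assumes y: "continuous_on {0..} y" and B: "\<And>X. X \<ge> 0 \<Longrightarrow> (LBINT x:{0..X}. (cmod (y x))\<^sup>2) \<le> B"
  shows "hsq y" "(hnorm y)\<^sup>2 \<le> B"
proof -
  define s where "s n x = indicator {0..real n} x *\<^sub>R (cmod (y x))\<^sup>2" for n x
  have c2: "continuous_on {0..} (\<lambda>x. (cmod (y x))\<^sup>2)"
    by (intro continuous_intros y)
  have s: "integrable lborel (s n)" for n
    using continuous_set_integrable[OF c2] by (simp add: s_def[abs_def] set_integrable_def)
  have mono: "incseq (\<lambda>n. integral\<^sup>L lborel (s n))"
    by (intro incseq_SucI integral_mono s) (auto simp: s_def split: split_indicator)
  moreover have b: "integral\<^sup>L lborel (s n) \<le> B" for n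
    using B[of "real n"] by (simp add: s_def[abs_def] set_lebesgue_integral_def)
  ultimately obtain L where L: "(\<lambda>n. integral\<^sup>L lborel (s n)) \<longlonglongrightarrow> L"
    by (metis incseq_convergent)
  have "L \<le> B"
    by (rule LIMSEQ_le_const2[OF L]) (use b in auto)
  have m: "half_cut y \<in> borel_measurable lborel"
    using half_cut_measurable_continuous[OF y] by simp
  have lim: "AE x in lborel. (\<lambda>n. s n x) \<longlonglongrightarrow> (cmod (half_cut y x))\<^sup>2"
  proof -
    have "(\<lambda>n. s n x) \<longlonglongrightarrow> (cmod (half_cut y x))\<^sup>2" if "x \<noteq> 0" for x
    proof (rule tendsto_eventually)
      obtain N where "x \<le> real N" using real_arch_simple by blast
      then show "\<forall>\<^sub>F n in sequentially. s n x = (cmod (half_cut y x))\<^sup>2"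
        using that by (intro eventually_sequentiallyI[of N]) (auto simp: s_def half_cut_def split: split_indicator)
    qed
    then show ?thesis
      by (rule eventually_mono[OF AE_lborel_singleton[of 0]])
  qed
  have mono: "AE x in lborel. mono (\<lambda>n. s n x)"
    by (intro AE_I2 incseq_SucI) (auto simp: s_def split: split_indicator)
  have "integrable lborel (\<lambda>x. (cmod (half_cut y x))\<^sup>2)"
    by (rule integrable_monotone_convergence[OF s mono lim L]) (use m in auto)
  then show "hsq y"
    using m by (simp add: hsq_def square_integrable_def)
  have "integral\<^sup>L lborel (\<lambda>x. (cmod (half_cut y x))\<^sup>2) = L"
    by (rule integral_monotone_convergence[OF s mono lim L]) (use m in auto)
  with \<open>hsq y\<close> \<open>L \<le> B\<close> show "(hnorm y)\<^sup>2 \<le> B"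
    by (simp add: hnorm_square)
qed

lemma hsq_not_bounded_below:
  assumes "hsq w" "c > 0" "\<forall>\<^sub>F x in at_top. c \<le> cmod (w x)"
  shows False
proof -
  obtain X0 where X0: "\<And>x. x \<ge> X0 \<Longrightarrow> c \<le> cmod (w x)"
    using assms(3) by (auto simp: eventually_at_top_linorder)
  define a where "a = max X0 1"
  \<comment> \<open>An interval this long contributes at least c^2 T = (hnorm w)^2 + c^2, more than
    the whole norm allows.\<close>
  define T where "T = (hnorm w)\<^sup>2 / c\<^sup>2 + 1"
  have T: "T > 0" by (simp add: T_def add_nonneg_pos)
  have int: "set_integrable lborel {a..a+T} (\<lambda>x. (cmod (w x))\<^sup>2)"
    by (rule set_integrable_subset[OF hsq_norm_square(1)[OF assms(1), of "a + T"]]) (auto simp: a_def)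
  have "(LBINT x:{a..a+T}. c\<^sup>2) \<le> (LBINT x:{a..a+T}. (cmod (w x))\<^sup>2)"
    using X0 \<open>c > 0\<close>
    by (intro set_integral_mono int)
      (auto simp: a_def intro!: power_mono borel_integrable_atLeastAtMost')
  also have "\<dots> \<le> (LBINT x:{0..a+T}. (cmod (w x))\<^sup>2)"
    unfolding set_lebesgue_integral_def
    using hsq_norm_square(1)[OF assms(1), of "a + T"] int
    by (intro integral_mono) (auto simp: a_def set_integrable_def split: split_indicator)
  also have "\<dots> \<le> (hnorm w)\<^sup>2"
    by (rule hsq_norm_square(2)[OF assms(1)])
  finally have "c\<^sup>2 * T \<le> (hnorm w)\<^sup>2"
    using T by (simp add: set_lebesgue_integral_def mult.commute)
  then show False
    using \<open>c > 0\<close> by (simp add: T_def field_simps)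
qed

section \<open>First-order equations on the half-line\<close>

lemma primitive_cong': "primitive F f \<Longrightarrow> F = G \<Longrightarrow> f = g \<Longrightarrow> primitive G g"
  by simp

lemma
  assumes "primitive y y'"
  shows energy_identity: "X \<ge> 0 \<Longrightarrow> (cmod (y X))\<^sup>2 = (cmod (y 0))\<^sup>2 + (LBINT t:{0..X}. 2 * Re (y' t * cnj (y t)))"
    and energy_integrable: "set_integrable lborel {0..X} (\<lambda>t. 2 * Re (y' t * cnj (y t)))"
proof -
  have eq: "y' t * cnj (y t) + y t * cnj (y' t) = of_real (2 * Re (y' t * cnj (y t)))" for t
    by (simp add: complex_eq_iff)
  have p: "primitive (\<lambda>x. of_real ((cmod (y x))\<^sup>2)) (\<lambda>t. of_real (2 * Re (y' t * cnj (y t))))"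
    using primitive_mult[OF assms primitive_cnj[OF assms]] unfolding eq complex_norm_square .
  have "complex_integrable lborel (\<lambda>t. of_real (indicator {0..X} t * (2 * Re (y' t * cnj (y t)))))"
    using primitive_integrable[OF p, of X] by (simp add: set_integrable_def scaleR_conv_of_real)
  then show "set_integrable lborel {0..X} (\<lambda>t. 2 * Re (y' t * cnj (y t)))"
    unfolding complex_of_real_integrable_eq by (simp add: set_integrable_def)
  show "(cmod (y X))\<^sup>2 = (cmod (y 0))\<^sup>2 + (LBINT t:{0..X}. 2 * Re (y' t * cnj (y t)))" if "X \<ge> 0"
    using primitive_eq[OF p that] unfolding set_integral_complex_of_real
    by (simp only: of_real_eq_iff flip: of_real_add)
qed

lemma two_Re_mult_le:
  assumes "a > 0"
  shows "2 * Re (g * cnj y) \<le> a * (cmod y)\<^sup>2 + (cmod g)\<^sup>2 / a"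
proof -
  have "2 * Re (g * cnj y) \<le> 2 * cmod (g * cnj y)"
    by (intro mult_left_mono complex_Re_le_cmod) simp
  also have "\<dots> = 2 * (cmod y * cmod g)"
    by (simp add: norm_mult)
  also have "\<dots> \<le> a * (cmod y)\<^sup>2 + (cmod g)\<^sup>2 / a"
    using assms sum_squares_bound[of "a * cmod y" "cmod g"]
    by (simp add: field_simps power2_eq_square)
  finally show ?thesis .
qed

text \<open>After multiplication by the conjugate of \<open>y\<close>, s times the derivative of
  |y|^2 is 2 (Re k) |y|^2 plus a mixed term with \<open>g\<close>. Young's inequality with weight
  \<open>Re k\<close> absorbs the mixed term into half of the good one. The sign \<open>s\<close>
  covers the decaying and the growing equation together and decides which endpoint term is
  favourable.\<close>

lemma energy_estimate:
  assumes y: "primitive y (\<lambda>x. of_real s * k * y x + g x)" and s: "s = 1 \<or> s = - 1"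
    and k: "Re k > 0" and g: "hsq g" and X: "X \<ge> 0"
  shows "(LBINT t:{0..X}. (cmod (y t))\<^sup>2) \<le> (s * ((cmod (y X))\<^sup>2 - (cmod (y 0))\<^sup>2) + (hnorm g)\<^sup>2 / Re k) / Re k"
proof -
  define a where "a = Re k"
  have a: "a > 0" using k by (simp add: a_def)
  have iy: "set_integrable lborel {0..X} (\<lambda>t. (cmod (y t))\<^sup>2)"
    by (intro continuous_set_integrable continuous_intros primitive_continuous[OF y])
  let ?e = "\<lambda>t. 2 * Re ((of_real s * k * y t + g t) * cnj (y t))"
  have le: "a * (cmod (y t))\<^sup>2 - (cmod (g t))\<^sup>2 / a \<le> s * ?e t" for t
  proof -
    have "Re (k * y t * cnj (y t)) = a * (cmod (y t))\<^sup>2"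
      by (simp add: mult.assoc complex_norm_square[symmetric] a_def del: of_real_power)
    moreover have "of_real s * ((of_real s * k * y t + g t) * cnj (y t)) = k * y t * cnj (y t) - (- of_real s * g t) * cnj (y t)"
      using s by (auto simp: algebra_simps)
    from arg_cong[OF this, of Re] have "s * Re ((of_real s * k * y t + g t) * cnj (y t)) =
        Re (k * y t * cnj (y t)) - Re ((- of_real s * g t) * cnj (y t))"
      by (simp only: Re_complex_of_real minus_complex.sel times_complex.sel Im_complex_of_real mult_zero_left diff_zero)
    moreover have "2 * Re ((- of_real s * g t) * cnj (y t)) \<le> a * (cmod (y t))\<^sup>2 + (cmod (g t))\<^sup>2 / a"
      using two_Re_mult_le[OF a, of "- of_real s * g t" "y t"] s by (auto simp: norm_mult simp del: times_complex.sel)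
    ultimately show ?thesis
      by (simp only: mult.left_commute[of s 2] right_diff_distrib)
  qed
  have "a * (LBINT t:{0..X}. (cmod (y t))\<^sup>2) - (hnorm g)\<^sup>2 / a
      \<le> a * (LBINT t:{0..X}. (cmod (y t))\<^sup>2) - (LBINT t:{0..X}. (cmod (g t))\<^sup>2) / a"
    using hsq_norm_square(2)[OF g] a by (intro diff_left_mono divide_right_mono) auto
  also have "\<dots> = (LBINT t:{0..X}. a * (cmod (y t))\<^sup>2 - (cmod (g t))\<^sup>2 / a)"
    using iy hsq_norm_square(1)[OF g] by (subst set_integral_diff(2)) auto
  also have "\<dots> \<le> (LBINT t:{0..X}. s * ?e t)"
    by (intro set_integral_mono set_integrable_mult_right energy_integrable[OF y] le set_integral_diff(1)
        set_integrable_divide iy hsq_norm_square(1)[OF g])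
  also have "\<dots> = s * ((cmod (y X))\<^sup>2 - (cmod (y 0))\<^sup>2)"
    using energy_identity[OF y X] by simp
  finally show ?thesis
    unfolding a_def[symmetric] using a by (simp add: field_simps)
qed

lemma
  assumes y: "primitive y (\<lambda>x. - k * y x + g x)" and k: "Re k > 0" and g: "hsq g"
  shows energy_decay_hsq: "hsq y"
    and energy_decay: "Re k * (hnorm y)\<^sup>2 \<le> (cmod (y 0))\<^sup>2 + (hnorm g)\<^sup>2 / Re k"
proof -
  have "(LBINT t:{0..X}. (cmod (y t))\<^sup>2) \<le> ((cmod (y 0))\<^sup>2 + (hnorm g)\<^sup>2 / Re k) / Re k" if "X \<ge> 0" for X
    by (rule order_trans[OF energy_estimate[of y "- 1" k g, OF _ _ k g that]])
      (use y k in \<open>auto intro!: divide_right_mono\<close>)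
  note b = hsqI_bounded[OF primitive_continuous[OF y] this]
  show "hsq y" by (rule b(1))
  show "Re k * (hnorm y)\<^sup>2 \<le> (cmod (y 0))\<^sup>2 + (hnorm g)\<^sup>2 / Re k"
    using b(2) k by (simp only: pos_le_divide_eq mult.commute)
qed

text \<open>For s = 1 the term |w X|^2 has the wrong sign. The a priori bound \<open>B\<close>
  replaces it; \<open>decaying_solution_bound\<close> supplies such a bound.\<close>

lemma
  assumes w: "primitive w (\<lambda>x. k * w x - f x)" and k: "Re k > 0" and f: "hsq f"
    and B: "\<And>x. x \<ge> 0 \<Longrightarrow> cmod (w x) \<le> B"
  shows energy_growth_hsq: "hsq w"
    and energy_growth: "Re k * (hnorm w)\<^sup>2 \<le> B\<^sup>2 + (hnorm f)\<^sup>2 / Re k"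
proof -
  have f': "hsq (\<lambda>x. - f x)" "hnorm (\<lambda>x. - f x) = hnorm f"
    using hsq_scale[OF f, of "- 1"] hnorm_scale[OF f, of "- 1"] by simp_all
  have "(LBINT t:{0..X}. (cmod (w t))\<^sup>2) \<le> (B\<^sup>2 + (hnorm f)\<^sup>2 / Re k) / Re k" if X: "X \<ge> 0" for X
  proof -
    have "(cmod (w X))\<^sup>2 - (cmod (w 0))\<^sup>2 \<le> B\<^sup>2"
      by (rule order_trans[OF _ power_mono[OF B[OF X], of 2]]) auto
    then show ?thesis
      by (intro order_trans[OF energy_estimate[of w 1 k "\<lambda>x. - f x", OF _ _ k f'(1) X]])
        (use w k in \<open>auto simp: f'(2) intro!: divide_right_mono\<close>)
  qed
  note b = hsqI_bounded[OF primitive_continuous[OF w] this]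
  show "hsq w" by (rule b(1))
  show "Re k * (hnorm w)\<^sup>2 \<le> B\<^sup>2 + (hnorm f)\<^sup>2 / Re k"
    using b(2) k by (simp only: pos_le_divide_eq mult.commute)
qed

lemma primitive_exp_mult:
  assumes "primitive w (\<lambda>x. k * w x + g x)"
  shows "primitive (\<lambda>x. exp (- k * of_real x) * w x) (\<lambda>x. exp (- k * of_real x) * g x)"
  using primitive_mult[OF primitive_exp[of "- k"] assms]
  by (rule primitive_cong') (auto simp: algebra_simps)

lemma integrating_factor:
  assumes "primitive w (\<lambda>x. k * w x + g x)" "x \<ge> 0"
  shows "exp (- k * of_real x) * w x = w 0 + (LBINT t:{0..x}. exp (- k * of_real t) * g t)"
  using primitive_eq[OF primitive_exp_mult[OF assms(1)] assms(2)] by simp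

lemma locally_integrable_exp_mult:
  "hsq f \<Longrightarrow> set_integrable lborel {0..x} (\<lambda>t. exp (k * of_real t) * f t)"
  by (intro hsq_locally_integrable continuous_intros)

lemma variation_of_constants:
  assumes "hsq g"
  shows "primitive (\<lambda>x. exp (k * of_real x) * (c + (LBINT t:{0..x}. exp (- k * of_real t) * g t)))
    (\<lambda>x. k * (exp (k * of_real x) * (c + (LBINT t:{0..x}. exp (- k * of_real t) * g t))) + g x)"
proof -
  have e: "exp (k * of_real x) * exp (- (k * of_real x)) = 1" for x
    by (simp flip: exp_add)
  from primitive_mult[OF primitive_exp[of k]
      primitive_indefinite[OF locally_integrable_exp_mult[OF assms, of _ "- k"], of c]]
  show ?thesis
    by (rule primitive_cong') (simp_all add: fun_eq_iff mult.assoc[symmetric] e)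
qed

lemma homogeneous:
  assumes "primitive w (\<lambda>x. k * w x)" "x \<ge> 0"
  shows "w x = w 0 * exp (k * of_real x)"
proof -
  have "exp (- k * of_real x) * w x = w 0"
    using integrating_factor[of w k "\<lambda>x. 0" x] assms by simp
  moreover have "w x = exp (k * of_real x) * (exp (- k * of_real x) * w x)"
    by (simp only: mult.assoc[symmetric] exp_add[symmetric]) simp
  ultimately show ?thesis
    by (simp only: mult.commute)
qed

text \<open>The Laplace transform of \<open>f\<close> at \<open>k\<close>. It is the only initial
  value for which w' = k w - f can have a square-integrable solution.\<close>

definition ell :: "complex \<Rightarrow> (real \<Rightarrow> complex) \<Rightarrow> complex" where
  "ell k f = (LBINT x:{0<..}. exp (- k * of_real x) * f x)"

lemma hsq_exp:
  assumes "Re k > 0"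
  shows "hsq (\<lambda>x. exp (- k * of_real x))"
proof (rule hsqI_bounded)
  show "continuous_on {0..} (\<lambda>x::real. exp (- k * of_real x))" by (intro continuous_intros)
  have i: "integrable lborel (\<lambda>x. exp (- (2 * Re k) * \<bar>x\<bar>))"
    using assms by (intro integrable_exp_minus_abs) simp
  show "(LBINT x:{0..X}. (cmod (exp (- k * of_real x)))\<^sup>2) \<le> (\<integral>x. exp (- (2 * Re k) * \<bar>x\<bar>) \<partial>lborel)" for X
    unfolding set_lebesgue_integral_def
  proof (rule integral_mono[OF _ i])
    show "integrable lborel (\<lambda>x. indicator {0..X} x *\<^sub>R (cmod (exp (- k * of_real x)))\<^sup>2)"
      by (rule continuous_set_integrable[unfolded set_integrable_def]) (intro continuous_intros)
    show "indicator {0..X} x *\<^sub>R (cmod (exp (- k * of_real x)))\<^sup>2 \<le> exp (- (2 * Re k) * \<bar>x\<bar>)" for x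
      by (auto simp: power2_eq_square mult_exp_exp split: split_indicator)
  qed
qed

lemma ell_integrable: "Re k > 0 \<Longrightarrow> hsq f \<Longrightarrow> set_integrable lborel {0<..} (\<lambda>x. exp (- k * of_real x) * f x)"
  by (intro hsq_prod hsq_exp)

lemma ell_split:
  assumes "Re k > 0" "hsq f" "X \<ge> 0"
  shows "ell k f = (LBINT t:{0..X}. exp (- k * of_real t) * f t) + (LBINT t:{X<..}. exp (- k * of_real t) * f t)"
proof -
  have "ell k f = (LBINT t:{0<..X} \<union> {X<..}. exp (- k * of_real t) * f t)"
    using assms(3) by (simp add: ell_def ivl_disj_un)
  also have "\<dots> = (LBINT t:{0<..X}. exp (- k * of_real t) * f t) + (LBINT t:{X<..}. exp (- k * of_real t) * f t)"
  proof (rule set_integral_Un)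
    show "set_integrable lborel {0<..X} (\<lambda>t. exp (- k * of_real t) * f t)"
      by (rule set_integrable_subset[OF ell_integrable[OF assms(1,2)]]) auto
    show "set_integrable lborel {X<..} (\<lambda>t. exp (- k * of_real t) * f t)"
      by (rule set_integrable_subset[OF ell_integrable[OF assms(1,2)]]) (use assms(3) in auto)
  qed auto
  also have "(LBINT t:{0<..X}. exp (- k * of_real t) * f t) = (LBINT t:{0..X}. exp (- k * of_real t) * f t)"
    by (rule set_integral_discrete_difference[where X = "{0}"]) auto
  finally show ?thesis .
qed

lemma ell_limit:
  assumes "Re k > 0" "hsq f"
  shows "((\<lambda>X. LBINT t:{0..X}. exp (- k * of_real t) * f t) \<longlongrightarrow> ell k f) at_top"
proof -
  have i: "set_integrable lborel {0..} (\<lambda>x. exp (- k * of_real x) * f x)"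
    using ell_integrable[OF assms]
    by (subst set_integrable_discrete_difference[where X = "{0}" and B = "{0<..}"]) auto
  have "ell k f = (LBINT t:{0..}. exp (- k * of_real t) * f t)"
    unfolding ell_def by (rule set_integral_discrete_difference[where X = "{0}"]) auto
  then show ?thesis
    using tendsto_set_lebesgue_integral_at_top[OF _ i] by simp
qed

text \<open>By the integrating factor, exp(-k x) w(x) tends to w(0) - \<open>ell k f\<close>. That
  product is square integrable because its weight has modulus at most 1, and a square-integrable
  function cannot have a nonzero limit in modulus.\<close>

lemma ell_unique:
  assumes w: "primitive w (\<lambda>x. k * w x - f x)" and k: "Re k > 0" and f: "hsq f" and hw: "hsq w"
  shows "w 0 = ell k f"
proof (rule ccontr)
  assume ne: "w 0 \<noteq> ell k f"
  define L where "L = w 0 - ell k f"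
  have eq: "exp (- k * of_real x) * w x = w 0 - (LBINT t:{0..x}. exp (- k * of_real t) * f t)" if "x \<ge> 0" for x
    using integrating_factor[of w k "\<lambda>x. - f x" x] w that
    by (simp add: set_integral_uminus locally_integrable_exp_mult[OF f, of _ "- k", simplified])
  have "((\<lambda>x. w 0 - (LBINT t:{0..x}. exp (- k * of_real t) * f t)) \<longlongrightarrow> L) at_top"
    unfolding L_def by (intro tendsto_intros ell_limit k f)
  then have "((\<lambda>x. exp (- k * of_real x) * w x) \<longlongrightarrow> L) at_top"
    by (rule Lim_transform_eventually) (intro eventually_at_top_linorderI[of 0] eq[symmetric])
  then have "((\<lambda>x. cmod (exp (- k * of_real x) * w x)) \<longlongrightarrow> cmod L) at_top"
    by (rule tendsto_norm)
  then have "\<forall>\<^sub>F x in at_top. cmod L / 2 < cmod (exp (- k * of_real x) * w x)"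
    by (rule order_tendstoD) (use ne in \<open>simp add: L_def\<close>)
  moreover have "hsq (\<lambda>x. exp (- k * of_real x) * w x)"
    by (rule hsq_mult_bounded[OF hw, where K = 1]) (use k in auto)
  ultimately show False
    using ne by (intro hsq_not_bounded_below[of "\<lambda>x. exp (- k * of_real x) * w x" "cmod L / 2"])
      (auto simp: L_def elim: eventually_mono)
qed

text \<open>With this initial value, w(X) is the integral over t > X of exp(-k (t - X)) f(t).
  Cauchy-Schwarz applies, and a translated exponential has the same norm for every
  \<open>X\<close>.\<close>

lemma decaying_solution_bound:
  assumes w: "primitive w (\<lambda>x. k * w x - f x)" and k: "Re k > 0" and f: "hsq f"
    and w0: "w 0 = ell k f" and X: "X \<ge> 0"
  shows "cmod (w X) \<le> hnorm (\<lambda>x. exp (- k * of_real x)) * hnorm f"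
proof -
  \<comment> \<open>The translate of the decaying exponential to the right of \<open>X\<close>; the
    argument is written as an affine map so that the change of variables for \<open>lborel\<close>
    applies.\<close>
  define e where "e x = half_cut (\<lambda>x. exp (- k * of_real x)) (- X + 1 * x)" for x
  have e_alt: "e x = (if x > X then exp (- k * of_real (x - X)) else 0)" for x
    by (simp add: e_def half_cut_def)
  have half_cut_e: "half_cut e = e"
    using X by (auto simp: half_cut_def e_alt)
  have sq: "square_integrable (half_cut (\<lambda>x. exp (- k * of_real x)))"
    using hsq_exp[OF k] by (simp add: hsq_def)
  have m: "e \<in> borel_measurable borel"
    unfolding e_def[abs_def]
    by (rule measurable_compose[where N = borel]) (use sq in \<open>auto simp: square_integrable_def\<close>)
  have he: "hsq e"
    unfolding hsq_def half_cut_e square_integrable_def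
    using sq m lborel_integrable_real_affine[of "\<lambda>x. (cmod (half_cut (\<lambda>x. exp (- k * of_real x)) x))\<^sup>2" 1 "- X"]
    by (auto simp: square_integrable_def e_def)
  have ne: "hnorm e = hnorm (\<lambda>x. exp (- k * of_real x))"
    using lborel_integral_real_affine[of 1 "\<lambda>x. (cmod (half_cut (\<lambda>x. exp (- k * of_real x)) x))\<^sup>2" "- X"] he sq
    unfolding hnorm_def hsq_def half_cut_e by (simp add: norm_abs_L2R e_def)
  have eq: "exp (- k * of_real X) * w X = w 0 - (LBINT t:{0..X}. exp (- k * of_real t) * f t)"
    using integrating_factor[of w k "\<lambda>x. - f x" X] w X
    by (simp add: set_integral_uminus locally_integrable_exp_mult[OF f, of _ "- k", simplified])
  have "w X = exp (k * of_real X) * (exp (- k * of_real X) * w X)"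
    by (simp add: mult.assoc[symmetric] exp_add[symmetric])
  also have "\<dots> = exp (k * of_real X) * (LBINT t:{X<..}. exp (- k * of_real t) * f t)"
    unfolding eq w0 ell_split[OF k f X] by simp
  also have "\<dots> = (LBINT t:{X<..}. exp (k * of_real X) * (exp (- k * of_real t) * f t))"
    by simp
  also have "\<dots> = (LBINT t:{0<..}. e t * f t)"
    unfolding set_lebesgue_integral_def
  proof (intro Bochner_Integration.integral_cong refl)
    fix t
    have "exp (k * of_real X) * exp (- k * of_real t) = exp (- k * of_real (t - X))"
      by (simp add: exp_add[symmetric] algebra_simps)
    then show "indicator {X<..} t *\<^sub>R (exp (k * of_real X) * (exp (- k * of_real t) * f t)) =
        indicator {0<..} t *\<^sub>R (e t * f t)"
      using X by (simp add: e_alt mult.assoc[symmetric] split: split_indicator)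
  qed
  finally show ?thesis
    using hsq_prod(2)[OF he f] ne by simp
qed

section \<open>Second-order equations on the half-line\<close>

text \<open>The equation -u'' + K u = f as a system with v = u'. Square integrability of
  \<open>v\<close> is included because the first-order unknown v + k u must be square
  integrable.\<close>

definition half_sol :: "complex \<Rightarrow> (real \<Rightarrow> complex) \<Rightarrow> (real \<Rightarrow> complex) \<Rightarrow> (real \<Rightarrow> complex) \<Rightarrow> bool" where
  "half_sol K f u v \<longleftrightarrow> primitive u v \<and> primitive v (\<lambda>x. K * u x - f x) \<and> hsq u \<and> hsq v"

lemma half_sol_factor:
  assumes "half_sol (k\<^sup>2) f u v"
  shows "primitive (\<lambda>x. v x + k * u x) (\<lambda>x. k * (v x + k * u x) - f x)"
    and "primitive u (\<lambda>x. - k * u x + (v x + k * u x))"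
    and "hsq (\<lambda>x. v x + k * u x)"
proof -
  have p: "primitive u v" "primitive v (\<lambda>x. k\<^sup>2 * u x - f x)" "hsq u" "hsq v"
    using assms by (auto simp: half_sol_def)
  show "primitive (\<lambda>x. v x + k * u x) (\<lambda>x. k * (v x + k * u x) - f x)"
    using primitive_add[OF p(2) primitive_scale[OF p(1), of k]]
    by (rule primitive_cong') (auto simp: algebra_simps power2_eq_square)
  show "primitive u (\<lambda>x. - k * u x + (v x + k * u x))"
    using p(1) by simp
  show "hsq (\<lambda>x. v x + k * u x)"
    by (intro hsq_add hsq_scale p)
qed

lemma half_sol_cong_AE:
  assumes s: "half_sol K f u v" and ae: "AEpos x. f x = g x" and g: "hsq g"
  shows "half_sol K g u v"
proof -
  have p: "primitive u v" "primitive v (\<lambda>x. K * u x - f x)" "hsq u" "hsq v"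
    using s by (auto simp: half_sol_def)
  have "primitive v (\<lambda>x. K * u x - g x)"
  proof (rule primitive_cong_AE[OF p(2)])
    show "AEpos x. K * u x - f x = K * u x - g x"
      using ae by eventually_elim simp
    have "set_integrable lborel {0..x} (\<lambda>x. K * u x - 1 * g x)" for x
      by (intro set_integral_diff(1) set_integrable_mult_right continuous_set_integrable
          primitive_continuous[OF p(1)] hsq_locally_integrable g continuous_intros)
    then show "set_borel_measurable lborel {0..x} (\<lambda>x. K * u x - g x)" for x
      by (simp add: set_integrable_def set_borel_measurable_def borel_measurable_integrable del: borel_measurable_diff)
  qed
  then show ?thesis using p by (simp add: half_sol_def)
qed

lemma half_sol_boundary:
  assumes "half_sol (k\<^sup>2) f u v" "Re k > 0" "hsq f"
  shows "v 0 + k * u 0 = ell k f"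
  by (rule ell_unique[OF half_sol_factor(1)[OF assms(1)] assms(2,3) half_sol_factor(3)[OF assms(1)]])

text \<open>The growing equation bounds v + k u by \<open>f\<close>, and the decaying equation then
  bounds \<open>u\<close> by its boundary value and v + k u. The constant depends on
  \<open>k\<close> alone, which is what makes the resolvent bounded.\<close>

lemma half_sol_bound:
  assumes k: "Re k > 0"
  obtains C where "C \<ge> 0" "\<And>f u v. hsq f \<Longrightarrow> half_sol (k\<^sup>2) f u v \<Longrightarrow>
    (hnorm u)\<^sup>2 \<le> C * ((cmod (u 0))\<^sup>2 + (hnorm f)\<^sup>2)"
proof -
  define a where "a = Re k"
  define e where "e = hnorm (\<lambda>x. exp (- k * of_real x))"
  define B where "B = (e\<^sup>2 + 1 / a) / a"
  have a: "a > 0" using k by (simp add: a_def)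
  have B: "B \<ge> 0" using a by (simp add: B_def)
  have "(hnorm u)\<^sup>2 \<le> (1 / a + B / a\<^sup>2) * ((cmod (u 0))\<^sup>2 + (hnorm f)\<^sup>2)"
    if f: "hsq f" and s: "half_sol (k\<^sup>2) f u v" for f u v
  proof -
    let ?w = "\<lambda>x. v x + k * u x"
    note w = half_sol_factor[OF s]
    have "a * (hnorm ?w)\<^sup>2 \<le> (e * hnorm f)\<^sup>2 + (hnorm f)\<^sup>2 / a"
      unfolding a_def e_def
      by (rule energy_growth[OF w(1) k f decaying_solution_bound[OF w(1) k f half_sol_boundary[OF s k f]]])
    then have hw: "(hnorm ?w)\<^sup>2 \<le> B * (hnorm f)\<^sup>2"
      using a by (simp add: B_def field_simps power2_eq_square)
    have "a * (hnorm u)\<^sup>2 \<le> (cmod (u 0))\<^sup>2 + (hnorm ?w)\<^sup>2 / a"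
      unfolding a_def by (rule energy_decay[OF w(2) k w(3)])
    also have "\<dots> \<le> (cmod (u 0))\<^sup>2 + B * (hnorm f)\<^sup>2 / a"
      using hw a by (intro add_left_mono divide_right_mono) auto
    finally have "(hnorm u)\<^sup>2 \<le> ((cmod (u 0))\<^sup>2 + B * (hnorm f)\<^sup>2 / a) / a"
      using a by (simp add: field_simps)
    also have "\<dots> = 1 / a * (cmod (u 0))\<^sup>2 + B / a\<^sup>2 * (hnorm f)\<^sup>2"
      using a by (simp add: field_simps power2_eq_square)
    also have "\<dots> \<le> (1 / a + B / a\<^sup>2) * (cmod (u 0))\<^sup>2 + (1 / a + B / a\<^sup>2) * (hnorm f)\<^sup>2"
      using a B by (intro add_mono mult_right_mono) auto
    finally show ?thesis
      by (simp add: distrib_left)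
  qed
  then show ?thesis
    by (rule that[rotated]) (use a B in auto)
qed

text \<open>The initial value of w = u' + k u is forced to be \<open>ell k f\<close>, whereas the
  decaying equation for \<open>u\<close> accepts any initial value. This is the free parameter
  \<open>c\<close>.\<close>

lemma half_sol_exists:
  assumes k: "Re k > 0" and f: "hsq f"
  obtains u v where "half_sol (k\<^sup>2) f u v" "u 0 = c"
proof -
  have mf: "hsq (\<lambda>x. - f x)"
    using hsq_scale[OF f, of "-1"] by simp
  define w where "w x = exp (k * of_real x) * (ell k f + (LBINT t:{0..x}. exp (- k * of_real t) * (- f t)))" for x
  have w: "primitive w (\<lambda>x. k * w x - f x)"
    using variation_of_constants[OF mf, of k "ell k f"] by (rule primitive_cong') (auto simp: w_def)
  have w0: "w 0 = ell k f"
    by (simp add: w_def LBINT_singleton)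
  have hw: "hsq w"
    by (rule energy_growth_hsq[OF w k f decaying_solution_bound[OF w k f w0]])
  define u where "u x = exp (- k * of_real x) * (c + (LBINT t:{0..x}. exp (- (- k) * of_real t) * w t))" for x
  have u: "primitive u (\<lambda>x. - k * u x + w x)"
    using variation_of_constants[OF hw, of "- k" c] by (rule primitive_cong') (auto simp: u_def)
  have hu: "hsq u"
    by (rule energy_decay_hsq[OF u k hw])
  define v where "v x = - k * u x + w x" for x
  have "primitive v (\<lambda>x. k\<^sup>2 * u x - f x)"
    using primitive_add[OF primitive_scale[OF u, of "- k"] w]
    by (rule primitive_cong') (auto simp: v_def algebra_simps power2_eq_square)
  moreover have "primitive u v"
    using u by (rule primitive_cong') (auto simp: v_def)
  moreover have "hsq v"
    unfolding v_def[abs_def] by (intro hsq_add hsq_scale hu hw)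
  ultimately have "half_sol (k\<^sup>2) f u v"
    using hu by (simp add: half_sol_def)
  moreover have "u 0 = c"
    by (simp add: u_def LBINT_singleton)
  ultimately show ?thesis using that by blast
qed

lemma half_sol_exp:
  assumes "Re k > 0"
  shows "half_sol (k\<^sup>2) (\<lambda>x. 0) (\<lambda>x. exp (- k * of_real x)) (\<lambda>x. - k * exp (- k * of_real x))"
  unfolding half_sol_def
proof (intro conjI hsq_scale hsq_exp assms primitive_exp)
  show "primitive (\<lambda>x. - k * exp (- k * of_real x)) (\<lambda>x. k\<^sup>2 * exp (- k * of_real x) - 0)"
    using primitive_scale[OF primitive_exp[of "- k"], of "- k"]
    by (rule primitive_cong') (auto simp: power2_eq_square mult.assoc)
qed

lemma half_sol_scale: "half_sol K f u v \<Longrightarrow> half_sol K (\<lambda>x. c * f x) (\<lambda>x. c * u x) (\<lambda>x. c * v x)"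
proof -
  assume "half_sol K f u v"
  then have p: "primitive u v" "primitive v (\<lambda>x. K * u x - f x)" "hsq u" "hsq v"
    by (auto simp: half_sol_def)
  have "primitive (\<lambda>x. c * v x) (\<lambda>x. K * (c * u x) - c * f x)"
    using primitive_scale[OF p(2), of c] by (rule primitive_cong') (auto simp: algebra_simps)
  then show ?thesis
    using primitive_scale[OF p(1)] p hsq_scale by (simp add: half_sol_def)
qed

lemma homogeneous_half_sol:
  assumes s: "half_sol (k\<^sup>2) (\<lambda>x. 0) u v" and k: "Re k > 0" and x: "x \<ge> 0"
  shows "u x = u 0 * exp (- k * of_real x)"
proof -
  have w: "primitive (\<lambda>x. v x + k * u x) (\<lambda>x. k * (v x + k * u x))"
    using half_sol_factor(1)[OF s] by simp
  have "hsq (\<lambda>x. 0)" by (simp add: hsq_def half_cut_def[abs_def] square_integrable_zero)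
  then have "v 0 + k * u 0 = 0"
    using half_sol_boundary[OF s k] by (simp add: ell_def)
  then have "v y + k * u y = 0" if "y \<ge> 0" for y
    using homogeneous[OF w that] by simp
  then have "primitive u (\<lambda>x. - k * u x)"
    by (intro primitive_cong[OF half_sol_factor(2)[OF s]]) auto
  from homogeneous[OF this x] show ?thesis .
qed

lemma homogeneous_half_sol_zero_data:
  assumes s: "half_sol (k\<^sup>2) (\<lambda>x. 0) u v" and "u 0 = 0" "v 0 = 0" and x: "x \<ge> 0"
  shows "u x = 0"
proof -
  have w: "primitive (\<lambda>x. v x + k * u x) (\<lambda>x. k * (v x + k * u x))"
    using half_sol_factor(1)[OF s] by simp
  have "v y + k * u y = 0" if "y \<ge> 0" for y
    using homogeneous[OF w that] assms by simp
  then have "primitive u (\<lambda>x. - k * u x)"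
    by (intro primitive_cong[OF half_sol_factor(2)[OF s]]) auto
  from homogeneous[OF this x] show ?thesis using assms by simp
qed

text \<open>The solution is a multiple of an exponential of modulus 1, so its modulus is
  constant.\<close>

lemma hsq_homogeneous_imaginary:
  assumes w: "primitive w (\<lambda>x. k * w x)" and h: "hsq w" and k: "Re k = 0" and x: "x \<ge> 0"
  shows "w x = 0"
proof -
  have n: "cmod (w y) = cmod (w 0)" if "y \<ge> 0" for y
    using homogeneous[OF w that] k by (simp add: norm_mult)
  have "w 0 = 0"
  proof (rule ccontr)
    assume "w 0 \<noteq> 0"
    moreover have "\<forall>\<^sub>F y in at_top. cmod (w 0) \<le> cmod (w y)"
      by (rule eventually_at_top_linorderI[of 0]) (metis n order_refl)
    ultimately show False
      using hsq_not_bounded_below[OF h, of "cmod (w 0)"] by simp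
  qed
  then show ?thesis using n[OF x] by simp
qed

text \<open>With imaginary \<open>k\<close> both factorisations, by \<open>k\<close> and by
  \<open>- k\<close>, are available, and each forces its first-order unknown to vanish.\<close>

lemma homogeneous_half_sol_imaginary:
  assumes s: "half_sol (k\<^sup>2) (\<lambda>x. 0) u v" and k: "Re k = 0" and x: "x \<ge> 0"
  shows "u x = 0" "v x = 0"
proof -
  have s': "half_sol ((- k)\<^sup>2) (\<lambda>x. 0) u v" using s by simp
  have 1: "v y + k * u y = 0" if "y \<ge> 0" for y
    using hsq_homogeneous_imaginary[OF _ half_sol_factor(3)[OF s] k that] half_sol_factor(1)[OF s] by simp
  have 2: "v y + - k * u y = 0" if "y \<ge> 0" for y
    using hsq_homogeneous_imaginary[of "\<lambda>y. v y + - k * u y" "- k" y]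
      half_sol_factor(1,3)[OF s'] k that by simp
  have v: "v y = 0" if "y \<ge> 0" for y
    using 1[OF that] 2[OF that] by simp
  then show "v x = 0" using x by simp
  \<comment> \<open>Since \<open>k\<close> may be 0, \<open>u\<close> cannot be recovered from k u =
    0; instead v = 0 makes \<open>u\<close> constant, and a square-integrable constant is 0.\<close>
  have "primitive u (\<lambda>x. 0 * u x)"
    by (rule primitive_cong[of u v]) (use s v in \<open>simp_all add: half_sol_def\<close>)
  moreover have "hsq u" using s by (simp add: half_sol_def)
  ultimately show "u x = 0"
    by (rule hsq_homogeneous_imaginary) (use x in simp_all)
qed

text \<open>The homogeneous solution damped by 1/(1+x), a weight that is square integrable but not
  integrable on the half-line.\<close>

definition resonant :: "complex \<Rightarrow> real \<Rightarrow> complex" where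
  "resonant k x = exp (k * of_real x) / of_real (1 + x)"

lemma hsq_resonant:
  assumes "Re k = 0"
  shows "hsq (resonant k)"
proof (rule hsqI_bounded)
  show c: "continuous_on {0..} (resonant k)"
    unfolding resonant_def by (intro continuous_intros) (simp only: of_real_eq_0_iff, auto)
  show "(LBINT x:{0..X}. (cmod (resonant k x))\<^sup>2) \<le> 1" if X: "X \<ge> 0" for X
  proof -
    have "(LBINT x:{0..X}. (cmod (resonant k x))\<^sup>2) = (LBINT x:{0..X}. 1 / (1 + x)\<^sup>2)"
      by (rule set_lebesgue_integral_cong)
        (use assms in \<open>auto simp: resonant_def norm_divide power_divide simp del: of_real_add\<close>)
    also have "\<dots> = - 1 / (1 + X) - (- 1 / (1 + 0))"
      unfolding set_lebesgue_integral_def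
      by (rule integral_FTC_atLeastAtMost)
        (use X in \<open>auto intro!: derivative_eq_intros continuous_intros
            simp: has_real_derivative_iff_has_vector_derivative[symmetric] power2_eq_square divide_simps\<close>)
    finally show ?thesis using X by simp
  qed
qed

text \<open>The integrating factor cancels the oscillation of the right-hand side, leaving the
  integral of 1/(1+t). Hence |v + k u| grows like a logarithm, against its square
  integrability.\<close>

lemma no_half_sol_resonant:
  assumes k: "Re k = 0" and s: "half_sol (k\<^sup>2) (resonant k) u v"
  shows False
proof -
  let ?w = "\<lambda>x. v x + k * u x"
  have e: "exp (- k * of_real t) * - resonant k t = - of_real (1 / (1 + t))" for t
    by (simp add: resonant_def mult_exp_exp)
  have I: "(LBINT t:{0..x}. 1 / (1 + t)) = ln (1 + x) - ln (1 + 0)" if "x \<ge> 0" for x :: real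
    unfolding set_lebesgue_integral_def
    by (rule integral_FTC_atLeastAtMost)
      (use that in \<open>auto intro!: derivative_eq_intros continuous_intros
          simp: has_real_derivative_iff_has_vector_derivative[symmetric]\<close>)
  have w: "exp (- k * of_real x) * ?w x = ?w 0 - of_real (ln (1 + x))" if "x \<ge> 0" for x
  proof -
    have "exp (- k * of_real x) * ?w x = ?w 0 + (LBINT t:{0..x}. exp (- k * of_real t) * - resonant k t)"
      using integrating_factor[of ?w k "\<lambda>t. - resonant k t" x] half_sol_factor(1)[OF s] that by simp
    also have "(LBINT t:{0..x}. exp (- k * of_real t) * - resonant k t) = - (LBINT t:{0..x}. complex_of_real (1 / (1 + t)))"
      unfolding e set_lebesgue_integral_def by simp
    finally show ?thesis
      unfolding set_integral_complex_of_real I[OF that] by simp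
  qed
  have lim: "filterlim (\<lambda>x::real. ln (1 + x)) at_top at_top" by real_asymp
  have "\<forall>\<^sub>F x in at_top. cmod (?w 0) + 1 \<le> ln (1 + x)"
    using lim by (simp add: filterlim_at_top)
  then have "\<forall>\<^sub>F x in at_top. 1 \<le> cmod (?w x)"
    using eventually_ge_at_top[of "0::real"]
  proof eventually_elim
    case (elim x)
    have "cmod (?w x) = cmod (?w 0 - of_real (ln (1 + x)))"
      using w[of x] elim k by (simp flip: w add: norm_mult)
    moreover have "cmod (of_real (ln (1 + x))) \<le> cmod (?w 0) + cmod (?w 0 - of_real (ln (1 + x)))"
      by (metis norm_minus_commute norm_triangle_sub)
    ultimately show ?case
      using elim by simp
  qed
  then show False
    by (rule hsq_not_bounded_below[OF half_sol_factor(3)[OF s], of 1, rotated]) simp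
qed

section \<open>Approximate solvability for imaginary exponents\<close>

lemma primitive_stop:
  assumes "primitive P p" "N \<ge> 0"
  shows "primitive (\<lambda>x. P (min x N)) (\<lambda>x. if x \<le> N then p x else 0)"
proof (rule primitiveI)
  fix x :: real assume x: "x \<ge> 0"
  have eq: "indicator {0..x} t *\<^sub>R (if t \<le> N then p t else 0) = indicator {0..min x N} t *\<^sub>R p t" for t
    by (auto split: split_indicator)
  show "set_integrable lborel {0..x} (\<lambda>x. if x \<le> N then p x else 0)"
    using primitive_integrable[OF assms(1), of "min x N"] by (simp add: set_integrable_def eq)
  have "P (min x N) = P 0 + (LBINT t:{0..min x N}. p t)"
    by (rule primitive_eq[OF assms(1)]) (use x assms(2) in simp)
  then show "P (min x N) = P (min 0 N) + (LBINT t:{0..x}. if t \<le> N then p t else 0)"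
    using assms(2) by (simp add: set_lebesgue_integral_def eq)
qed

lemma
  assumes m: "g \<in> borel_measurable borel" and "0 \<le> M" "0 \<le> N"
    and b: "\<And>x. 0 < x \<Longrightarrow> x \<le> N \<Longrightarrow> cmod (g x) \<le> M" "\<And>x. x > N \<Longrightarrow> g x = 0"
  shows hsq_compact_support: "hsq g" and hnorm_compact_support: "hnorm g \<le> M * sqrt N"
proof -
  have i: "integrable lborel (\<lambda>x. M\<^sup>2 * indicator {0..N} x)"
    by (intro integrable_mult_right integrable_real_indicator) (auto simp: emeasure_lborel_Icc_eq)
  have le: "(cmod (half_cut g x))\<^sup>2 \<le> M\<^sup>2 * indicator {0..N} x" for x
    using b(1)[of x] b(2)[of x] by (auto simp: half_cut_def not_le intro!: power_mono split: split_indicator)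
  have i2: "integrable lborel (\<lambda>x. (cmod (half_cut g x))\<^sup>2)"
    by (rule Bochner_Integration.integrable_bound[OF i]) (use half_cut_measurable[OF m] le in \<open>auto simp: abs_of_nonneg\<close>)
  then show h: "hsq g"
    using half_cut_measurable[OF m] by (simp add: hsq_def square_integrable_def)
  have "(hnorm g)\<^sup>2 \<le> (\<integral>x. M\<^sup>2 * indicator {0..N} x \<partial>lborel)"
    unfolding hnorm_square[OF h] by (rule integral_mono[OF i2 i le])
  also have "\<dots> = (M * sqrt N)\<^sup>2"
    using assms by (simp add: power_mult_distrib)
  finally show "hnorm g \<le> M * sqrt N"
    by (rule power2_le_imp_le) (use assms in simp)
qed

lemma hsq_continuous_compact_support:
  assumes c: "continuous_on {0..} y" and z: "\<And>x. x > X' \<Longrightarrow> y x = 0"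
  shows "hsq y"
proof (rule hsqI_bounded[OF c])
  fix X :: real
  have i: "set_integrable lborel {0..X} (\<lambda>x. (cmod (y x))\<^sup>2)" for X
    by (intro continuous_set_integrable continuous_intros c)
  show "(LBINT x:{0..X}. (cmod (y x))\<^sup>2) \<le> (LBINT x:{0..X'}. (cmod (y x))\<^sup>2)"
    unfolding set_lebesgue_integral_def
    by (intro integral_mono i[unfolded set_integrable_def]) (use z in \<open>auto split: split_indicator simp: not_le\<close>)
qed

text \<open>When \<open>Re k = 0\<close> the weight exp(k x) does not decay and exp(k x) f(x) need
  not be integrable. Removing a tail of small norm, found by dominated convergence, leaves an
  integral over a bounded interval.\<close>

lemma hsq_truncation:
  assumes "hsq f" "\<epsilon> > 0"
  obtains X where "X \<ge> 0" "hsq (\<lambda>x. if x \<le> X then f x else 0)" "hsq (\<lambda>x. if x \<le> X then 0 else f x)"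
    "hnorm (\<lambda>x. if x \<le> X then 0 else f x) \<le> \<epsilon>"
proof -
  have h1: "hsq (\<lambda>x. if x \<le> X then f x else 0)" for X
  proof -
    have "hsq (\<lambda>x. (if x \<le> X then 1 else 0) * f x)"
      by (rule hsq_mult_bounded[OF assms(1), where K = 1]) auto
    then show ?thesis by (simp add: if_distrib[of "\<lambda>c. c * _"] cong: if_cong)
  qed
  have h2: "hsq (\<lambda>x. if x \<le> X then 0 else f x)" for X
  proof -
    have "hsq (\<lambda>x. (if x \<le> X then 0 else 1) * f x)"
      by (rule hsq_mult_bounded[OF assms(1), where K = 1]) auto
    then show ?thesis by (simp add: if_distrib[of "\<lambda>c. c * _"] cong: if_cong)
  qed
  define r where "r n x = (if x \<le> real n then 0 else f x)" for n x
  have h3: "hsq (r n)" for n using h2[of "real n"] by (simp add: r_def[abs_def])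
  have sq: "square_integrable (half_cut f)" using assms(1) by (simp add: hsq_def)
  have "(\<lambda>n. \<integral>x. (cmod (half_cut (r n) x))\<^sup>2 \<partial>lborel) \<longlonglongrightarrow> (\<integral>x. 0 \<partial>(lborel :: real measure))"
  proof (rule integral_dominated_convergence)
    show "integrable lborel (\<lambda>x. (cmod (half_cut f x))\<^sup>2)" using sq by (simp add: square_integrable_def)
    show "AE x in lborel. (\<lambda>n. (cmod (half_cut (r n) x))\<^sup>2) \<longlonglongrightarrow> 0"
    proof (intro AE_I2 tendsto_eventually)
      fix x :: real
      obtain N where "x \<le> real N" using real_arch_simple by blast
      then show "\<forall>\<^sub>F n in sequentially. (cmod (half_cut (r n) x))\<^sup>2 = 0"
        by (intro eventually_sequentiallyI[of N]) (auto simp: half_cut_def r_def)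
    qed
    show "AE x in lborel. norm ((cmod (half_cut (r n) x))\<^sup>2) \<le> (cmod (half_cut f x))\<^sup>2" for n
      by (auto simp: half_cut_def r_def)
    show "(\<lambda>x. (cmod (half_cut (r n) x))\<^sup>2) \<in> borel_measurable lborel" for n
      using h3[of n] by (auto simp: hsq_def square_integrable_def)
  qed simp
  then have "(\<lambda>n. (hnorm (r n))\<^sup>2) \<longlonglongrightarrow> 0"
    by (simp add: hnorm_square[OF h3])
  then have "\<forall>\<^sub>F n in sequentially. (hnorm (r n))\<^sup>2 < \<epsilon>\<^sup>2"
    by (rule order_tendstoD) (use assms in simp)
  then obtain n where "(hnorm (r n))\<^sup>2 < \<epsilon>\<^sup>2"
    by (auto simp: eventually_sequentially)
  then have "hnorm (r n) \<le> \<epsilon>"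
    by (rule power2_le_imp_le[OF less_imp_le]) (rule less_imp_le[OF assms(2)])
  then show ?thesis
    by (intro that[of "real n"] h1 h2) (simp_all add: r_def[abs_def])
qed

lemma primitive_poly:
  assumes "\<And>x. (P has_field_derivative p x) (at x)" "continuous_on UNIV p"
  shows "primitive (\<lambda>x. P (of_real x)) (\<lambda>x. p (of_real x))"
proof (rule primitive_FTC)
  show "((\<lambda>x. P (of_real x)) has_vector_derivative p (of_real x)) (at x within {0..})" for x :: real
    using assms(1) by (rule has_vector_derivative_real_field)
  show "continuous_on {0..} (\<lambda>x::real. p (of_real x))"
    by (rule continuous_on_compose2[OF assms(2)]) (auto intro: continuous_intros)
qed

text \<open>A forcing term that is spread thinly over a long interval is small in \<open>L\<^sup>2\<close> but can still
  prescribe the value at 0 of the compactly supported solution: this is where \<open>Re k = 0\<close> enters.\<close>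

lemma compact_first_order_solution:
  assumes k: "Re k = 0" and f: "hsq f" and X: "X \<ge> 0" "\<And>x. x > X \<Longrightarrow> f x = 0" and \<epsilon>: "\<epsilon> > 0"
  obtains \<delta> \<delta>' y N where "primitive \<delta> \<delta>'" "\<delta> 0 = 0" "hsq \<delta>" "hsq \<delta>'" "hnorm \<delta> \<le> \<epsilon>" "hnorm \<delta>' \<le> \<epsilon>"
    "primitive y (\<lambda>x. - k * y x + (f x + \<delta> x))" "y 0 = c" "hsq y"
    "N \<ge> 0" "\<And>x. x > N \<Longrightarrow> y x = 0" "\<And>x. x > N \<Longrightarrow> \<delta> x = 0"
proof -
  define I where "I = (LBINT t:{0..X}. exp (k * of_real t) * f t)"
  \<comment> \<open>The correction is a multiple \<open>a\<close> of a profile of total mass 1, up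
    to an oscillating factor. Beyond its support exp(k x) y(x) equals c + I + a, so this amplitude
    makes \<open>y\<close> vanish there.\<close>
  define a where "a = - (c + I)"
  \<comment> \<open>Bounds both N |\<delta>| and N |\<delta>'|: the profile is at most 2/N in
    modulus, its derivative at most 6/N, and differentiating the oscillating factor costs
    \<open>cmod k\<close>.\<close>
  define M where "M = cmod a * (2 * cmod k + 6)"
  \<comment> \<open>A function bounded by M/N on an interval of length N has norm at most M / sqrt
    N. This N makes that at most \<open>\<epsilon>\<close> and also exceeds \<open>X\<close>, so
    that \<open>f\<close> has ended before N.\<close>
  obtain N0 :: nat where N0: "(M / \<epsilon>)\<^sup>2 + X + 1 \<le> real N0" using real_arch_simple by blast
  define N where "N = real N0"
  have N: "N \<ge> 1" "N \<ge> X" "(M / \<epsilon>)\<^sup>2 \<le> N"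
    using N0 X(1) zero_le_power2[of "M / \<epsilon>"] unfolding N_def by linarith+
  have M0: "M \<ge> 0" by (simp add: M_def)
  have MN: "M / N * sqrt N \<le> \<epsilon>"
  proof -
    have "M / \<epsilon> \<le> sqrt N"
      using real_sqrt_le_mono[OF N(3)] M0 \<epsilon> by simp
    then have "M \<le> \<epsilon> * sqrt N" using \<epsilon> by (simp add: field_simps)
    then have "M * sqrt N \<le> \<epsilon> * (sqrt N * sqrt N)"
      using N(1) mult_right_mono[of M "\<epsilon> * sqrt N" "sqrt N"] by (simp add: mult.assoc)
    then show ?thesis using N(1) by (simp add: field_simps)
  qed
  let ?N = "complex_of_real N"
  have N_ne [simp]: "N \<noteq> 0" using N by auto
  \<comment> \<open>A parabola of mass 1 on the interval from 0 to N, with derivative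
    \<open>p\<close> and antiderivative \<open>Q\<close>. It vanishes at both ends, so stopping it
    at N keeps it absolutely continuous, and the correction vanishes at 0.\<close>
  define P where "P z = 6 * z * (?N - z) / ?N ^ 3" for z
  define p where "p z = 6 * (?N - 2 * z) / ?N ^ 3" for z
  define Q where "Q z = (3 * ?N * z\<^sup>2 - 2 * z ^ 3) / ?N ^ 3" for z
  define \<tau> where "\<tau> x = P (of_real (min x N))" for x
  define \<tau>' where "\<tau>' x = (if x \<le> N then p (of_real x) else 0)" for x
  define T where "T x = Q (of_real (min x N))" for x
  have PN: "P ?N = 0" "P 0 = 0" "Q 0 = 0" "Q ?N = 1"
    by (simp_all add: P_def Q_def power2_eq_square power3_eq_cube)
  have \<tau>: "primitive \<tau> \<tau>'"
  proof -
    have "primitive (\<lambda>x. P (of_real x)) (\<lambda>x. p (of_real x))"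
      by (rule primitive_poly)
        (auto simp: P_def[abs_def] p_def[abs_def] field_simps intro!: derivative_eq_intros continuous_intros)
    from primitive_stop[OF this, of N] N show ?thesis
      by (simp add: \<tau>_def[abs_def] \<tau>'_def[abs_def])
  qed
  have T: "primitive T \<tau>"
  proof -
    have "primitive (\<lambda>x. Q (of_real x)) (\<lambda>x. P (of_real x))"
      by (rule primitive_poly)
        (auto simp: P_def[abs_def] Q_def[abs_def] field_simps power2_eq_square intro!: derivative_eq_intros continuous_intros)
    from primitive_stop[OF this, of N] have "primitive (\<lambda>x. Q (of_real (min x N))) (\<lambda>x. if x \<le> N then P (of_real x) else 0)"
      using N by simp
    then show ?thesis
      by (rule primitive_cong') (auto simp: T_def \<tau>_def PN min_def)
  qed
  have \<tau>N: "\<tau> x = 0" if "x \<ge> N" for x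
    using that by (simp add: \<tau>_def PN)
  have \<tau>'N: "\<tau>' x = 0" if "x > N" for x
    using that by (simp add: \<tau>'_def)
  have \<tau>_bound: "cmod (\<tau> x) \<le> 2 / N" if "0 < x" "x \<le> N" for x
  proof -
    have "cmod (\<tau> x) = 6 * x * (N - x) / N ^ 3"
      using that N by (simp add: \<tau>_def P_def norm_mult norm_divide norm_power flip: of_real_diff)
    also have "6 * x * (N - x) = 2 * N\<^sup>2 - (N\<^sup>2 / 2 + 3 / 2 * (N - 2 * x)\<^sup>2)"
      by (simp add: power2_eq_square field_simps)
    also have "\<dots> / N ^ 3 \<le> 2 * N\<^sup>2 / N ^ 3"
    proof (rule divide_right_mono)
      have "0 \<le> N\<^sup>2 / 2 + 3 / 2 * (N - 2 * x)\<^sup>2" by simp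
      then show "2 * N\<^sup>2 - (N\<^sup>2 / 2 + 3 / 2 * (N - 2 * x)\<^sup>2) \<le> 2 * N\<^sup>2" by linarith
    qed (use N in simp)
    finally show ?thesis using N by (simp add: power2_eq_square power3_eq_cube)
  qed
  have \<tau>'_bound: "cmod (\<tau>' x) \<le> 6 / N" if "0 < x" "x \<le> N" for x
  proof -
    have "cmod (\<tau>' x) = 6 * \<bar>N - 2 * x\<bar> / N ^ 3"
    proof -
      have "?N - 2 * of_real x = of_real (N - 2 * x)" by simp
      then show ?thesis
        using that N by (simp add: \<tau>'_def p_def norm_mult norm_divide norm_power del: of_real_diff of_real_mult)
    qed
    also have "\<dots> \<le> 6 * N\<^sup>2 / N ^ 3"
      using that N self_le_power[of N 2] by (intro divide_right_mono mult_left_mono) auto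
    finally show ?thesis using N by (simp add: power2_eq_square power3_eq_cube)
  qed
  define \<delta> where "\<delta> x = a * (exp (- k * of_real x) * \<tau> x)" for x
  define \<delta>' where "\<delta>' x = a * (- k * exp (- k * of_real x) * \<tau> x + exp (- k * of_real x) * \<tau>' x)" for x
  have p\<delta>: "primitive \<delta> \<delta>'"
    unfolding \<delta>_def[abs_def] \<delta>'_def[abs_def]
    by (intro primitive_scale primitive_mult primitive_exp \<tau>)
  have \<tau>m: "\<tau> \<in> borel_measurable borel"
    unfolding \<tau>_def[abs_def] P_def by (intro borel_measurable_continuous_onI continuous_intros) auto
  have \<tau>'m: "\<tau>' \<in> borel_measurable borel"
    unfolding \<tau>'_def[abs_def] p_def by measurable
  have em: "(\<lambda>x::real. exp (- k * of_real x)) \<in> borel_measurable borel"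
    by (intro borel_measurable_continuous_onI continuous_intros)
  have \<delta>m: "\<delta> \<in> borel_measurable borel" "\<delta>' \<in> borel_measurable borel"
    unfolding \<delta>_def[abs_def] \<delta>'_def[abs_def] using \<tau>m \<tau>'m em by measurable
  have ne: "cmod (exp (- k * of_real x)) = 1" for x using k by simp
  have b\<delta>: "cmod (\<delta> x) \<le> M / N" if x: "0 < x" "x \<le> N" for x
  proof -
    have "cmod (\<delta> x) \<le> cmod a * (2 / N)"
      unfolding \<delta>_def norm_mult ne mult_1_left by (intro mult_left_mono \<tau>_bound x) simp
    also have "\<dots> \<le> cmod a * ((2 * cmod k + 6) / N)"
      using N by (intro mult_left_mono divide_right_mono) auto
    finally show ?thesis by (simp add: M_def)
  qed
  have b\<delta>': "cmod (\<delta>' x) \<le> M / N" if x: "0 < x" "x \<le> N" for x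
  proof -
    have "cmod (- k * exp (- k * of_real x) * \<tau> x + exp (- k * of_real x) * \<tau>' x)
        \<le> cmod k * cmod (\<tau> x) + cmod (\<tau>' x)"
      by (rule norm_triangle_le) (simp add: norm_mult k)
    also have "\<dots> \<le> cmod k * (2 / N) + 6 / N"
      by (intro add_mono mult_left_mono \<tau>_bound \<tau>'_bound x) auto
    also have "\<dots> = (2 * cmod k + 6) / N"
      by (simp add: add_divide_distrib mult.commute)
    finally show ?thesis
      unfolding \<delta>'_def norm_mult[of a] M_def times_divide_eq_right[symmetric] by (intro mult_left_mono) simp_all
  qed
  have z\<delta>: "\<delta> x = 0" "\<delta>' x = 0" if "x > N" for x
    using that \<tau>N \<tau>'N by (simp_all add: \<delta>_def \<delta>'_def)
  have N0': "0 \<le> N" "0 \<le> M / N" using N M0 by auto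
  have h: "hsq \<delta>" "hsq \<delta>'"
    by (rule hsq_compact_support[OF _ N0'(2,1)]; use \<delta>m b\<delta> b\<delta>' z\<delta> in blast)+
  have "hnorm \<delta> \<le> M / N * sqrt N" "hnorm \<delta>' \<le> M / N * sqrt N"
    by (rule hnorm_compact_support[OF _ N0'(2,1)]; use \<delta>m b\<delta> b\<delta>' z\<delta> in blast)+
  then have hn: "hnorm \<delta> \<le> \<epsilon>" "hnorm \<delta>' \<le> \<epsilon>" using MN by auto
  define g where "g x = f x + \<delta> x" for x
  have g: "hsq g" unfolding g_def[abs_def] by (intro hsq_add f h)
  define y where "y x = exp (- k * of_real x) * (c + (LBINT t:{0..x}. exp (- (- k) * of_real t) * g t))" for x
  have y: "primitive y (\<lambda>x. - k * y x + g x)"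
    using variation_of_constants[OF g, of "- k" c] by (rule primitive_cong') (auto simp: y_def)
  have yN: "y x = 0" if "x > N" for x
  proof -
    have e: "exp (k * of_real t) * \<delta> t = a * \<tau> t" for t
      by (simp add: \<delta>_def mult.left_commute[of _ a] mult.assoc[symmetric] exp_add[symmetric])
    have "(LBINT t:{0..x}. exp (k * of_real t) * g t)
        = (LBINT t:{0..x}. exp (k * of_real t) * f t) + (LBINT t:{0..x}. a * \<tau> t)"
      unfolding g_def distrib_left e
      by (rule set_integral_add(2)) (auto intro!: locally_integrable_exp_mult f primitive_integrable[OF T])
    also have "(LBINT t:{0..x}. exp (k * of_real t) * f t) = I"
      unfolding I_def set_lebesgue_integral_def
      by (intro Bochner_Integration.integral_cong) (use X(2) that N in \<open>auto split: split_indicator\<close>)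
    also have "(LBINT t:{0..x}. a * \<tau> t) = a * (T x - T 0)"
      using primitive_eq[OF T, of x] that N by simp
    also have "T x - T 0 = 1"
      using that N by (simp add: T_def PN)
    finally show ?thesis by (simp add: y_def a_def)
  qed
  have "hsq y"
    by (rule hsq_continuous_compact_support[OF primitive_continuous[OF y] yN])
  moreover have "\<delta> 0 = 0" "y 0 = c"
    using N by (simp_all add: \<delta>_def \<tau>_def PN y_def LBINT_singleton)
  moreover have "primitive y (\<lambda>x. - k * y x + (f x + \<delta> x))"
    using y by (simp only: g_def)
  ultimately show ?thesis
    using that[of \<delta> \<delta>' y N] p\<delta> h hn N0'(1) yN z\<delta>(1) by blast
qed

text \<open>The two factors are solved in turn, for w with \<open>- k\<close> in place of
  \<open>k\<close> and for u with \<open>k\<close>, each up to a small correction. The correction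
  \<open>d\<close> of the second enters v = u' and is differentiated once more, which is why
  \<open>compact_first_order_solution\<close> also controls the derivative. Since \<open>d\<close>
  vanishes at 0, the choice w(0) = p + k c gives v(0) = p.\<close>

lemma half_sol_dense:
  assumes k: "Re k = 0" and f: "hsq f" and \<epsilon>: "\<epsilon> > 0"
  obtains f' u v where "hsq f'" "hnorm (\<lambda>x. f x - f' x) \<le> \<epsilon>" "half_sol (k\<^sup>2) f' u v" "u 0 = c" "v 0 = p"
proof -
  \<comment> \<open>The error f - f' is made of the tail of \<open>f\<close>, the first correction,
    d' and - k d. Three terms cost \<open>\<eta>\<close> each and the last one costs
    \<open>cmod k\<close> times \<open>\<eta>\<close>.\<close>
  define \<eta> where "\<eta> = \<epsilon> / (3 + cmod k)"
  have \<eta>: "\<eta> > 0" using \<epsilon> by (simp add: \<eta>_def add_pos_nonneg)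
  obtain X where X: "X \<ge> 0" "hsq (\<lambda>x. if x \<le> X then f x else 0)" "hsq (\<lambda>x. if x \<le> X then 0 else f x)"
    "hnorm (\<lambda>x. if x \<le> X then 0 else f x) \<le> \<eta>"
    using hsq_truncation[OF f \<eta>] .
  define f0 where "f0 x = (if x \<le> X then f x else 0)" for x
  have f0: "hsq (\<lambda>x. - f0 x)" "\<And>x. x > X \<Longrightarrow> - f0 x = 0"
    using hsq_scale[OF X(2), of "-1"] by (auto simp: f0_def[abs_def])
  obtain \<delta> \<delta>' w N where \<delta>: "hsq \<delta>" "hnorm \<delta> \<le> \<eta>" and
    w: "primitive w (\<lambda>x. - (- k) * w x + (- f0 x + \<delta> x))" "w 0 = p + k * c" "hsq w" and
    N: "N \<ge> 0" "\<And>x. x > N \<Longrightarrow> w x = 0"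
    by (rule compact_first_order_solution[of "- k", OF _ f0(1) X(1) f0(2) \<eta>, where c = "p + k * c"]) (use k in auto)
  obtain d d' u where d: "primitive d d'" "d 0 = 0" "hsq d" "hsq d'" "hnorm d \<le> \<eta>" "hnorm d' \<le> \<eta>" and
    u: "primitive u (\<lambda>x. - k * u x + (w x + d x))" "u 0 = c" "hsq u"
    by (rule compact_first_order_solution[OF k w(3) N \<eta>, where c = c]) auto
  define v where "v x = - k * u x + (w x + d x)" for x
  define f' where "f' x = f0 x - \<delta> x - d' x + k * d x" for x
  have eq: "f x - f' x = (if x \<le> X then 0 else f x) + (\<delta> x + (d' x + (- k) * d x))" for x
    by (auto simp: f'_def f0_def)
  have h1: "hsq (\<lambda>x. d' x + (- k) * d x)"
    by (intro hsq_add hsq_scale d)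
  have h2: "hsq (\<lambda>x. \<delta> x + (d' x + (- k) * d x))"
    by (intro hsq_add \<delta> h1)
  have "hnorm (\<lambda>x. f x - f' x) \<le> \<eta> + (\<eta> + (\<eta> + cmod k * \<eta>))"
  proof -
    have "hnorm (\<lambda>x. f x - f' x) \<le> hnorm (\<lambda>x. if x \<le> X then 0 else f x) + hnorm (\<lambda>x. \<delta> x + (d' x + (- k) * d x))"
      unfolding eq by (rule hnorm_add[OF X(3) h2])
    moreover have "hnorm (\<lambda>x. \<delta> x + (d' x + (- k) * d x)) \<le> hnorm \<delta> + hnorm (\<lambda>x. d' x + (- k) * d x)"
      by (rule hnorm_add[OF \<delta>(1) h1])
    moreover have "hnorm (\<lambda>x. d' x + (- k) * d x) \<le> hnorm d' + hnorm (\<lambda>x. (- k) * d x)"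
      by (rule hnorm_add[OF d(4) hsq_scale[OF d(3)]])
    moreover have "hnorm (\<lambda>x. (- k) * d x) \<le> cmod k * \<eta>"
      unfolding hnorm_scale[OF d(3)] norm_minus_cancel by (intro mult_left_mono d) simp
    ultimately show ?thesis using X(4) \<delta>(2) d(6) by linarith
  qed
  also have "\<dots> = (3 + cmod k) * \<eta>" by (simp add: algebra_simps)
  also have "\<dots> = \<epsilon>"
    using norm_ge_zero[of k] by (simp add: \<eta>_def) (smt (verit) norm_ge_zero)
  finally have close: "hnorm (\<lambda>x. f x - f' x) \<le> \<epsilon>" .
  have hf': "hsq f'"
  proof -
    have "hsq (\<lambda>x. f0 x + (-1) * (\<delta> x + (d' x + (- k) * d x)))"
      by (intro hsq_add[OF _ hsq_scale[OF h2]]) (use X(2) in \<open>simp add: f0_def[abs_def]\<close>)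
    then show ?thesis
      by (rule hsq_cong[THEN iffD1, rotated]) (simp add: f'_def)
  qed
  have pv: "primitive v (\<lambda>x. k\<^sup>2 * u x - f' x)"
    using primitive_add[OF primitive_scale[OF u(1), of "- k"] primitive_add[OF w(1) d(1)]]
    by (rule primitive_cong') (auto simp: v_def f'_def algebra_simps power2_eq_square)
  have "hsq v"
    unfolding v_def[abs_def] by (intro hsq_add hsq_scale u w d)
  then have "half_sol (k\<^sup>2) f' u v"
    using u pv by (simp add: half_sol_def v_def[abs_def])
  moreover have "v 0 = p"
    by (simp add: v_def u w d)
  ultimately show ?thesis
    using that hf' close u(2) by blast
qed

section \<open>Weak derivatives on the half-line\<close>

text \<open>The sets over which \<open>g\<close> integrates to 0 contain the intervals and are
  stable under countable disjoint unions and, because of \<open>tot\<close>, under complements.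
  Hence all Borel sets are among them.\<close>

lemma AE_zero_if_interval_integrals_zero:
  fixes g :: "real \<Rightarrow> complex"
  assumes g: "integrable lborel g" and z: "\<And>a b. (LBINT x:{a<..<b}. g x) = 0" and tot: "(\<integral>x. g x \<partial>lborel) = 0"
  shows "AE x in lborel. g x = 0"
proof (rule sigma_finite_measure.density_zero[OF sigma_finite_lborel g])
  have si: "set_integrable lborel A g" if "A \<in> sets borel" for A
    unfolding set_integrable_def using integrable_mult_indicator[of A lborel, OF _ g] that by simp
  fix A :: "real set" assume "A \<in> sets lborel"
  then have "A \<in> sets borel" by simp
  then show "(LBINT x:A. g x) = 0"
  proof (induction rule: borel_set_induct)
    case empty
    show ?case by (simp add: set_lebesgue_integral_def)
  next
    case (interval a b)
    have "(LBINT x:{a..b}. g x) = (LBINT x:{a<..<b}. g x)"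
      by (rule set_integral_discrete_difference[where X = "{a, b}"]) auto
    then show ?case using z by simp
  next
    case (compl A)
    have "(\<integral>x. g x \<partial>lborel) = (LBINT x:A \<union> - A. g x)"
      by (simp add: set_lebesgue_integral_def)
    also have "\<dots> = (LBINT x:A. g x) + (LBINT x:- A. g x)"
      by (intro set_integral_Un si) (use compl in auto)
    finally show ?case using tot compl by simp
  next
    case (union A)
    then show ?case
      by (subst lebesgue_integral_countable_add) (auto simp: disjoint_family_on_def intro!: si sets.countable_UN)
  qed
qed

lemma set_integrable_mult_compact:
  fixes g w :: "real \<Rightarrow> complex"
  assumes g: "set_integrable lborel {0..B} g" and c: "continuous_on {0..} w" and z: "\<And>x. x > B \<Longrightarrow> w x = 0"
  shows "set_integrable lborel {0<..} (\<lambda>x. g x * w x)"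
    and "(LBINT x:{0<..}. g x * w x) = (LBINT x:{0..B}. g x * w x)"
proof -
  have i: "set_integrable lborel {0..B} (\<lambda>x. g x * w x)"
    by (rule set_integrable_mult_continuous[OF g c])
  have "set_integrable lborel {0<..B} (\<lambda>x. g x * w x)"
    by (rule set_integrable_subset[OF i]) auto
  moreover have eq: "(\<lambda>x. indicator {0<..B} x *\<^sub>R (g x * w x)) = (\<lambda>x. indicator {0<..} x *\<^sub>R (g x * w x))"
    using z by (auto simp: fun_eq_iff not_le split: split_indicator)
  ultimately show "set_integrable lborel {0<..} (\<lambda>x. g x * w x)"
    by (simp add: set_integrable_def)
  have "(LBINT x:{0..B}. g x * w x) = (LBINT x:{0<..B}. g x * w x)"
    by (rule set_integral_discrete_difference[where X = "{0}"]) auto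
  then show "(LBINT x:{0<..}. g x * w x) = (LBINT x:{0..B}. g x * w x)"
    by (simp add: set_lebesgue_integral_def eq)
qed

lemma primitive_smooth:
  assumes "smooth \<phi>"
  shows "primitive (\<lambda>x. of_real (\<phi> x)) (\<lambda>x. of_real (deriv \<phi> x))"
proof (rule primitive_FTC)
  show "((\<lambda>x. complex_of_real (\<phi> x)) has_vector_derivative complex_of_real (deriv \<phi> x)) (at x within {0..})" for x
    using smooth_has_derivative[OF assms, of x] has_vector_derivative_of_real
    by (metis has_field_derivative_at_within)
  show "continuous_on {0..} (\<lambda>x. complex_of_real (deriv \<phi> x))"
    by (intro continuous_intros smooth_continuous smooth_deriv assms)
qed

lemma deriv_eq_0_beyond:
  assumes "smooth \<phi>" "open S" "x \<in> S" "\<And>y. y \<in> S \<Longrightarrow> \<phi> y = 0"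
  shows "deriv \<phi> x = 0"
proof (rule DERIV_imp_deriv)
  have "((\<lambda>_. 0) has_real_derivative 0) (at x)" by simp
  then show "(\<phi> has_real_derivative 0) (at x)"
    by (rule has_field_derivative_transform_within_open[OF _ assms(2,3)]) (use assms(4) in simp)
qed

lemma primitive_by_parts:
  assumes G: "primitive G v" and \<phi>: "smooth \<phi>" and B: "B > 0" "\<And>x. x > B \<Longrightarrow> \<phi> x = 0"
  shows "(LBINT x:{0<..}. G x * of_real (deriv \<phi> x)) = - G 0 * of_real (\<phi> 0) - (LBINT x:{0<..}. v x * of_real (\<phi> x))"
proof -
  have c: "continuous_on {0..} (\<lambda>x. complex_of_real (\<phi> x))" "continuous_on {0..} (\<lambda>x. complex_of_real (deriv \<phi> x))"
    by (intro continuous_intros smooth_continuous smooth_deriv \<phi>)+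
  have dz: "deriv \<phi> x = 0" if "x > B" for x
    by (rule deriv_eq_0_beyond[OF \<phi>, of "{B<..}"]) (use that B in auto)
  have gi: "set_integrable lborel {0..B + 1} G"
    by (rule continuous_set_integrable[OF primitive_continuous[OF G]])
  note 1 = set_integrable_mult_compact[OF gi c(2)] and 2 = set_integrable_mult_compact[OF primitive_integrable[OF G, of "B + 1"] c(1)]
  have p: "primitive (\<lambda>x. G x * of_real (\<phi> x)) (\<lambda>x. v x * of_real (\<phi> x) + G x * of_real (deriv \<phi> x))"
    by (rule primitive_mult[OF G primitive_smooth[OF \<phi>]])
  have i1: "set_integrable lborel {0..B+1} (\<lambda>x. G x * of_real (deriv \<phi> x))"
    by (intro continuous_set_integrable continuous_intros primitive_continuous[OF G] smooth_continuous smooth_deriv \<phi>)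
  have i2: "set_integrable lborel {0..B+1} (\<lambda>x. v x * of_real (\<phi> x))"
    using set_integral_diff(1)[OF primitive_integrable[OF p, of "B + 1"] i1] by simp
  have "0 = G (B + 1) * of_real (\<phi> (B + 1))" using B by simp
  also have "\<dots> = G 0 * of_real (\<phi> 0) + (LBINT x:{0..B+1}. v x * of_real (\<phi> x) + G x * of_real (deriv \<phi> x))"
    by (rule primitive_eq[OF p]) (use B in simp)
  also have "(LBINT x:{0..B+1}. v x * of_real (\<phi> x) + G x * of_real (deriv \<phi> x))
      = (LBINT x:{0<..}. v x * of_real (\<phi> x)) + (LBINT x:{0<..}. G x * of_real (deriv \<phi> x))"
    using 1 2 B dz i1 i2 by simp
  finally show ?thesis by (simp add: algebra_simps eq_neg_iff_add_eq_0)
qed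

text \<open>As \<open>h\<close> is only locally integrable, the open half-line is exhausted by the
  intervals from 1/n to n, on each of which the global criterion applies.\<close>

lemma AE_zero_if_interval_integrals_zero_pos:
  fixes h :: "real \<Rightarrow> complex"
  assumes h: "\<And>X. set_integrable lborel {0..X} h"
    and I: "\<And>a b. 0 < a \<Longrightarrow> a < b \<Longrightarrow> (LBINT x:{a<..<b}. h x) = 0"
  shows "AEpos x. h x = 0"
proof -
  have "AE x in lborel. indicator {1 / real (Suc n)<..<real (Suc n)} x *\<^sub>R h x = 0" for n
  proof (rule AE_zero_if_interval_integrals_zero)
    let ?J = "{1 / real (Suc n)<..<real (Suc n)}"
    have J: "set_integrable lborel ?J h"
    proof (rule set_integrable_subset[OF h[of "real (Suc n)"]])
      have "0 < 1 / real (Suc n)" by simp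
      then show "?J \<subseteq> {0..real (Suc n)}"
        unfolding subset_iff greaterThanLessThan_iff atLeastAtMost_iff by linarith
    qed simp
    then show "integrable lborel (\<lambda>x. indicator ?J x *\<^sub>R h x)" by (simp add: set_integrable_def)
    have I': "(LBINT x:{a<..<b}. h x) = 0" if "a \<ge> 1 / real (Suc n)" for a b
    proof (cases "a < b")
      case True
      have "0 < 1 / real (Suc n)" by simp
      then have "0 < a" using that by linarith
      then show ?thesis using I True by blast
    qed (simp add: set_lebesgue_integral_def)
    show "(LBINT x:{a<..<b}. indicator ?J x *\<^sub>R h x) = 0" for a b
    proof -
      have "(LBINT x:{a<..<b}. indicator ?J x *\<^sub>R h x) = (LBINT x:{max a (1 / real (Suc n))<..<min b (real (Suc n))}. h x)"
        unfolding set_lebesgue_integral_def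
        by (intro Bochner_Integration.integral_cong) (auto split: split_indicator)
      then show ?thesis using I' by simp
    qed
    show "(\<integral>x. indicator ?J x *\<^sub>R h x \<partial>lborel) = 0"
      using I'[of "1 / real (Suc n)" "real (Suc n)"] by (simp add: set_lebesgue_integral_def)
  qed
  then have "AE x in lborel. \<forall>n. indicator {1 / real (Suc n)<..<real (Suc n)} x *\<^sub>R h x = 0"
    unfolding AE_all_countable by blast
  then show ?thesis
  proof eventually_elim
    case (elim x)
    show ?case
    proof
      assume "x > 0"
      obtain n where n: "max x (1 / x) < real (Suc n)"
        by (metis less_add_same_cancel1 of_nat_Suc order_less_trans reals_Archimedean2 zero_less_one add.commute)
      then have "x \<in> {1 / real (Suc n)<..<real (Suc n)}"
        using \<open>x > 0\<close> by (auto simp: field_simps)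
      then show "h x = 0" using spec[OF elim, of n] by simp
    qed
  qed
qed

text \<open>The bump functions converge boundedly to the indicator of the interval, so dominated
  convergence turns the hypothesis into vanishing interval integrals.\<close>

lemma AE_zero_if_bump_integrals_zero:
  fixes h :: "real \<Rightarrow> complex"
  assumes h: "\<And>X. set_integrable lborel {0..X} h"
    and z: "\<And>a b n. 0 < a \<Longrightarrow> a < b \<Longrightarrow> (LBINT x:{0<..}. h x * of_real (bump a b n x)) = 0"
  shows "AEpos x. h x = 0"
proof -
  have I: "(LBINT x:{a<..<b}. h x) = 0" if ab: "0 < a" "a < b" for a b
  proof -
    have lim: "(\<lambda>n. \<integral>x. indicator {0<..} x *\<^sub>R (h x * of_real (bump a b n x)) \<partial>lborel)
        \<longlonglongrightarrow> (\<integral>x. indicator {a<..<b} x *\<^sub>R h x \<partial>lborel)"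
    proof (rule integral_dominated_convergence)
      show "integrable lborel (\<lambda>x. cmod (indicator {0..b} x *\<^sub>R h x))"
        using h[of b] by (intro integrable_norm) (simp add: set_integrable_def)
      show "AE x in lborel. (\<lambda>n. indicator {0<..} x *\<^sub>R (h x * of_real (bump a b n x))) \<longlonglongrightarrow> indicator {a<..<b} x *\<^sub>R h x"
      proof (intro AE_I2)
        fix x
        have "(\<lambda>n. indicator {0<..} x *\<^sub>R (h x * of_real (bump a b n x))) \<longlonglongrightarrow>
            indicator {0<..} x *\<^sub>R (h x * of_real (indicator {a<..<b} x))"
          by (intro tendsto_intros bump_tendsto)
        then show "(\<lambda>n. indicator {0<..} x *\<^sub>R (h x * of_real (bump a b n x))) \<longlonglongrightarrow> indicator {a<..<b} x *\<^sub>R h x"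
          using ab by (auto split: split_indicator_asm split_indicator)
      qed
      show "AE x in lborel. cmod (indicator {0<..} x *\<^sub>R (h x * of_real (bump a b n x))) \<le> cmod (indicator {0..b} x *\<^sub>R h x)" for n
        using ab bump_eq_0[of _ a b n] bump_bounds[of a b n]
        by (intro AE_I2) (auto simp: norm_mult mult_left_le split: split_indicator)
      show "(\<lambda>x. indicator {a<..<b} x *\<^sub>R h x) \<in> borel_measurable lborel"
        by (rule borel_measurable_integrable[OF set_integrable_subset[OF h[of b], unfolded set_integrable_def]])
          (use ab in auto)
      have "set_integrable lborel {0<..} (\<lambda>x. h x * of_real (bump a b n x))" for n
        by (rule set_integrable_mult_compact(1)[OF h[of b]])
          (auto intro!: continuous_intros smooth_continuous smooth_bump bump_eq_0)
      then show "(\<lambda>x. indicator {0<..} x *\<^sub>R (h x * of_real (bump a b n x))) \<in> borel_measurable lborel" for n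
        unfolding set_integrable_def by (rule borel_measurable_integrable)
    qed
    have "(\<lambda>n. \<integral>x. indicator {0<..} x *\<^sub>R (h x * of_real (bump a b n x)) \<partial>lborel) = (\<lambda>n. 0)"
      using z[OF ab] by (simp add: set_lebesgue_integral_def)
    with lim have "(\<lambda>n::nat. 0) \<longlonglongrightarrow> (\<integral>x. indicator {a<..<b} x *\<^sub>R h x \<partial>lborel)" by simp
    then show ?thesis
      unfolding set_lebesgue_integral_def by (metis LIMSEQ_unique tendsto_const)
  qed
  then show ?thesis by (rule AE_zero_if_interval_integrals_zero_pos[OF h])
qed

text \<open>Du Bois-Reymond: after subtraction of the primitive \<open>G\<close> of \<open>v\<close>, the function \<open>f - G\<close> annihilates
  all derivatives of test functions, that is, all test functions with integral 0.\<close>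

lemma weak_derivative_half_line:
  assumes f: "hsq f" and v: "hsq v"
    and weak: "\<And>\<phi>. test_function {0<..} \<phi> \<Longrightarrow>
      (LBINT x:{0<..}. f x * of_real (deriv \<phi> x)) = - (LBINT x:{0<..}. v x * of_real (\<phi> x))"
  obtains F where "primitive F v" "AEpos x. f x = F x"
proof -
  define G where "G x = 0 + (LBINT t:{0..x}. v t)" for x
  have G: "primitive G v"
    unfolding G_def[abs_def] by (rule primitive_indefinite[OF hsq_set_integrable[OF v]])
  define w where "w x = f x - G x" for x
  have wi: "set_integrable lborel {0..X} w" for X
    unfolding w_def[abs_def]
    by (intro set_integral_diff(1) hsq_set_integrable f continuous_set_integrable primitive_continuous[OF G])
  have cont: "continuous_on {0..} (\<lambda>x. complex_of_real (g x))" if "smooth g" for g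
    by (intro continuous_intros smooth_continuous that)
  have W: "(LBINT x:{0<..}. w x * of_real (deriv \<phi> x)) = 0"
    if s: "smooth \<phi>" and ab: "0 < a" "a < b" "\<And>x. x \<notin> {a..b} \<Longrightarrow> \<phi> x = 0" for \<phi> a b
  proof -
    have t: "test_function {0<..} \<phi>"
      by (rule test_functionI[OF s ab(3)]) (use ab in auto)
    have dz: "deriv \<phi> x = 0" if "x > b" for x
      by (rule deriv_eq_0_beyond[OF s, of "{b<..}"]) (use that ab in auto)
    have i: "set_integrable lborel {0<..} (\<lambda>x. f x * of_real (deriv \<phi> x))"
      "set_integrable lborel {0<..} (\<lambda>x. G x * of_real (deriv \<phi> x))"
      by (rule set_integrable_mult_compact(1)[where B = b, OF _ cont[OF smooth_deriv[OF s]]];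
          use dz hsq_set_integrable[OF f] continuous_set_integrable[OF primitive_continuous[OF G]] in simp)+
    have "(LBINT x:{0<..}. G x * of_real (deriv \<phi> x)) = - G 0 * of_real (\<phi> 0) - (LBINT x:{0<..}. v x * of_real (\<phi> x))"
      by (rule primitive_by_parts[OF G s, of b]) (use ab in auto)
    then have "(LBINT x:{0<..}. f x * of_real (deriv \<phi> x)) - (LBINT x:{0<..}. G x * of_real (deriv \<phi> x)) = 0"
      using weak[OF t] ab by simp
    then show ?thesis
      using i by (simp add: w_def left_diff_distrib)
  qed
  \<comment> \<open>A fixed test function of nonzero integral. Subtracting a multiple of it brings
    the integral of any other test function to 0, and pairing it with \<open>w\<close> determines
    the expected constant \<open>C\<close>.\<close>
  define \<eta> where "\<eta> = bump 1 2 1"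
  have \<eta>: "smooth \<eta>" "\<And>x. x \<notin> {1..2} \<Longrightarrow> \<eta> x = 0"
    unfolding \<eta>_def by (auto intro: smooth_bump bump_eq_0)
  define J where "J \<psi> = (LBINT x:{0<..}. complex_of_real (\<psi> x))" for \<psi> :: "real \<Rightarrow> real"
  define C where "C = (LBINT x:{0<..}. w x * of_real (\<eta> x)) / J \<eta>"
  have J: "set_integrable lborel {0<..} (\<lambda>x. complex_of_real (\<psi> x))" "J \<psi> = of_real (integral {0..B} \<psi>)"
    if "smooth \<psi>" "\<And>x. x > B \<Longrightarrow> \<psi> x = 0" for \<psi> B
  proof -
    have c1: "continuous_on {0..} (\<lambda>x. 1 :: complex)" by simp
    note * = set_integrable_mult_compact[OF continuous_set_integrable[OF c1, of B] cont[OF that(1)], simplified]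
    show "set_integrable lborel {0<..} (\<lambda>x. complex_of_real (\<psi> x))" by (rule *) (use that in simp)
    have "J \<psi> = (LBINT x:{0..B}. complex_of_real (\<psi> x))"
      unfolding J_def by (rule *) (use that in simp)
    also have "\<dots> = of_real (LBINT x:{0..B}. \<psi> x)" by (rule set_integral_complex_of_real)
    also have "(LBINT x:{0..B}. \<psi> x) = integral {0..B} \<psi>"
      by (intro set_borel_integral_eq_integral borel_integrable_atLeastAtMost' smooth_continuous that)
    finally show "J \<psi> = of_real (integral {0..B} \<psi>)" .
  qed
  have J\<eta>: "J \<eta> \<noteq> 0"
  proof
    assume "J \<eta> = 0"
    then have "integral {0..3} \<eta> = 0"
      using J(2)[OF \<eta>(1), of 3] \<eta>(2) by simp
    then have "\<eta> (3/2) = 0"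
      using integral_eq_0_iff[of 0 3 \<eta>] smooth_continuous[OF \<eta>(1)] bump_bounds(1) by (simp add: \<eta>_def)
    then show False using bump_pos[of 1 "3/2" 2 1] by (simp add: \<eta>_def)
  qed
  have "AEpos x. w x - C = 0"
  proof (rule AE_zero_if_bump_integrals_zero)
    show "set_integrable lborel {0..X} (\<lambda>x. w x - C)" for X
      by (intro set_integral_diff(1) wi continuous_set_integrable continuous_intros)
    fix a b n assume ab: "(0::real) < a" "a < b"
    define \<psi> where "\<psi> = bump a b n"
    have \<psi>: "smooth \<psi>" "\<And>x. x \<notin> {a..b} \<Longrightarrow> \<psi> x = 0"
      unfolding \<psi>_def by (auto intro: smooth_bump bump_eq_0)
    define A where "A = min a 1"
    define B where "B = max b 2"
    have AB: "0 < A" "A < B" using ab by (auto simp: A_def B_def)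
    \<comment> \<open>This choice gives \<open>\<theta>\<close> integral 0, so its antiderivative
      \<open>\<phi>\<close> again has compact support in the open half-line and is admissible in
      \<open>W\<close>.\<close>
    define c where "c = integral {0..B} \<psi> / integral {0..B} \<eta>"
    define \<theta> where "\<theta> x = \<psi> x + (- c) * \<eta> x" for x
    have \<theta>: "smooth \<theta>" unfolding \<theta>_def[abs_def] by (intro smooth_add smooth_mult smooth_const \<psi> \<eta>)
    have \<theta>z: "\<theta> x = 0" if "x \<notin> {A..B}" for x
      using that \<psi>(2)[of x] \<eta>(2)[of x] by (auto simp: \<theta>_def A_def B_def min_def max_def split: if_splits)
    have io: "g integrable_on {l..u}" if "smooth g" for g l u
      by (intro integrable_continuous_real smooth_continuous that)
    have J\<psi>: "J \<psi> = of_real (integral {0..B} \<psi>)" and J\<eta>': "J \<eta> = of_real (integral {0..B} \<eta>)"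
      by (rule J; use \<psi> \<eta> in \<open>simp add: B_def\<close>)+
    have I\<theta>: "integral {0..B} \<theta> = 0"
    proof -
      have "integral {0..B} \<theta> = integral {0..B} \<psi> + integral {0..B} (\<lambda>x. (- c) * \<eta> x)"
        unfolding \<theta>_def[abs_def]
        by (intro Henstock_Kurzweil_Integration.integral_add io \<psi> smooth_mult smooth_const \<eta>)
      then show ?thesis using J\<eta> J\<eta>' by (simp add: c_def)
    qed
    define \<phi> where "\<phi> x = integral {0..x} \<theta>" for x
    have \<phi>z: "\<phi> x = 0" if "x < A" for x
    proof -
      have "\<phi> x = integral {0..x} (\<lambda>x. 0)"
        unfolding \<phi>_def by (rule Henstock_Kurzweil_Integration.integral_cong) (use that \<theta>z in auto)
      then show ?thesis by simp
    qed
    have \<phi>z': "\<phi> x = 0" if "x > B" for x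
    proof -
      have "\<phi> x = integral {0..B} \<theta> + integral {B..x} \<theta>"
        unfolding \<phi>_def by (rule Henstock_Kurzweil_Integration.integral_combine[symmetric]) (use AB that io[OF \<theta>] in auto)
      also have "integral {B..x} \<theta> = integral {B..x} (\<lambda>x. 0)"
        by (rule Henstock_Kurzweil_Integration.integral_spike[of "{B}"]) (use \<theta>z in auto)
      finally show ?thesis by (simp add: I\<theta>)
    qed
    have d: "(\<phi> has_real_derivative \<theta> x) (at x)" for x
    proof (cases "x < A")
      case True
      have "((\<lambda>_. 0) has_real_derivative \<theta> x) (at x)" using \<theta>z True by simp
      then show ?thesis
        by (rule has_field_derivative_transform_within_open[of _ _ _ "{..<A}"]) (use \<phi>z True in auto)
    next
      case False
      then have "(\<phi> has_real_derivative \<theta> x) (at x within {0..x + 1})"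
        unfolding \<phi>_def using AB by (intro integral_has_real_derivative smooth_continuous \<theta>) auto
      moreover have "at x within {0..x + 1} = at x"
        by (rule at_within_interior) (use False AB in auto)
      ultimately show ?thesis by simp
    qed
    then have "deriv \<phi> = \<theta>" by (intro ext DERIV_imp_deriv)
    moreover have "(LBINT x:{0<..}. w x * of_real (deriv \<phi> x)) = 0"
      by (rule W[OF smooth_antiderivative[OF d \<theta>] AB]) (use \<phi>z \<phi>z' in force)
    ultimately have 0: "(LBINT x:{0<..}. w x * of_real (\<theta> x)) = 0" by simp
    have i: "set_integrable lborel {0<..} (\<lambda>x. w x * of_real (\<psi> x))" "set_integrable lborel {0<..} (\<lambda>x. w x * of_real (\<eta> x))"
      by (rule set_integrable_mult_compact(1)[where B = B, OF wi cont]; use \<psi> \<eta> in \<open>simp add: B_def\<close>)+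
    have "w x * of_real (\<theta> x) = w x * of_real (\<psi> x) - of_real c * (w x * of_real (\<eta> x))" for x
      by (simp add: \<theta>_def algebra_simps)
    then have "(LBINT x:{0<..}. w x * of_real (\<psi> x)) = of_real c * (LBINT x:{0<..}. w x * of_real (\<eta> x))"
      using 0 i by simp
    also have "\<dots> = C * J \<psi>"
      using J\<eta> J\<eta>' by (simp add: C_def J\<psi> c_def)
    finally show "(LBINT x:{0<..}. (w x - C) * of_real (bump a b n x)) = 0"
      using i(1) J(1)[OF \<psi>(1), of B] \<psi>(2) by (simp add: left_diff_distrib J_def B_def \<psi>_def)
  qed
  then have "AEpos x. f x = C + (LBINT t:{0..x}. v t)"
    by eventually_elim (simp add: w_def G_def algebra_simps)
  then show ?thesis
    using that[of "\<lambda>x. C + (LBINT t:{0..x}. v t)"] primitive_indefinite[OF hsq_set_integrable[OF v]] by blast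
qed

section \<open>Weak derivatives on the line\<close>

lemma integral_split_line:
  fixes h :: "real \<Rightarrow> 'a::{banach, second_countable_topology}"
  assumes h: "integrable lborel h"
  shows "(\<integral>x. h x \<partial>lborel) = (LBINT x:{0<..}. h x) + (LBINT x:{0<..}. h (- x))"
proof -
  have si: "set_integrable lborel A h" if "A \<in> sets lborel" for A
    unfolding set_integrable_def by (rule integrable_mult_indicator[OF that h])
  have "AE x in lborel. h x = indicator ({0<..} \<union> {..<0}) x *\<^sub>R h x"
    by (rule eventually_mono[OF AE_lborel_singleton[of 0]]) (auto split: split_indicator)
  then have "(\<integral>x. h x \<partial>lborel) = (LBINT x:{0<..} \<union> {..<0}. h x)"
    unfolding set_lebesgue_integral_def
    using borel_measurable_integrable[OF h] by (intro integral_cong_AE) auto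
  also have "\<dots> = (LBINT x:{0<..}. h x) + (LBINT x:{..<0}. h x)"
    by (intro set_integral_Un si) auto
  also have "(LBINT x:{..<0}. h x) = (LBINT x:{0<..}. h (- x))"
    unfolding set_lebesgue_integral_def
    by (subst lborel_integral_real_affine[where c = "-1" and t = 0])
      (auto intro!: Bochner_Integration.integral_cong split: split_indicator)
  finally show ?thesis .
qed

lemma integral_reflect:
  fixes g :: "real \<Rightarrow> complex"
  shows "(\<integral>x. g x \<partial>lborel) = (\<integral>x. g (- x) \<partial>lborel)"
  by (subst lborel_integral_real_affine[where c = "-1" and t = 0]) auto

lemma square_integrable_reflect: "square_integrable f \<Longrightarrow> square_integrable (\<lambda>x. f (- x))"
  unfolding square_integrable_def
  using lborel_integrable_real_affine[of "\<lambda>x. (cmod (f x))\<^sup>2" "-1" 0] by auto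

lemma AE_reflect:
  assumes "AE x in lborel. P (x::real)"
  shows "AE x in lborel. P (- x)"
proof -
  obtain N where N: "N \<in> null_sets lborel" "{x. \<not> P x} \<subseteq> N"
    using assms by (auto simp: eventually_ae_filter)
  then have "AE x in lborel. x \<notin> N" by (intro AE_not_in)
  moreover have [measurable]: "N \<in> sets borel" using N by auto
  ultimately have "AE x in lborel. 0 + (- 1) * x \<notin> N"
    by (intro AE_borel_affine) auto
  then show ?thesis
    by eventually_elim (use N in auto)
qed

text \<open>\<open>Fl\<close> is the representative on the left half-line, reflected: hence the sign of its derivative.\<close>

definition weak_reps :: "L2R \<Rightarrow> L2R \<Rightarrow> (real \<Rightarrow> complex) \<Rightarrow> (real \<Rightarrow> complex) \<Rightarrow> bool" where
  "weak_reps U V Fr Fl \<longleftrightarrow> primitive Fr (rep_L2R V) \<and> primitive Fl (\<lambda>x. - rep_L2R V (- x)) \<and>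
     (AEpos x. rep_L2R U x = Fr x) \<and> (AEpos x. rep_L2R U (- x) = Fl x)"

lemma deriv_reflect:
  assumes "smooth \<phi>"
  shows "deriv (\<lambda>x. \<phi> (- x)) x = - deriv \<phi> (- x)"
proof (rule DERIV_imp_deriv)
  have "((\<lambda>x. \<phi> (- x)) has_real_derivative deriv \<phi> (- x) * (- 1)) (at x)"
    by (rule DERIV_chain2[OF smooth_has_derivative[OF assms]]) (auto intro!: derivative_eq_intros)
  then show "((\<lambda>x. \<phi> (- x)) has_real_derivative - deriv \<phi> (- x)) (at x)" by simp
qed

lemma smooth_reflect: "smooth \<phi> \<Longrightarrow> smooth (\<lambda>x. \<phi> (- x))"
  using smooth_affine[of \<phi> 0 "-1"] by simp

lemma rep_measurable: "rep_L2R U \<in> borel_measurable borel"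
  using square_integrable_rep[of U] by (simp add: square_integrable_def)

lemma hsq_rep: "hsq (rep_L2R U)" "hsq (\<lambda>x. rep_L2R U (- x))"
  by (intro hsq_square_integrable square_integrable_reflect square_integrable_rep)+

lemma test_function_square_integrable:
  assumes s: "smooth \<phi>" and B: "B \<ge> 0" "\<And>x. \<bar>x\<bar> > B \<Longrightarrow> \<phi> x = 0"
  shows "square_integrable (\<lambda>x. of_real (\<phi> x))"
  unfolding square_integrable_def
proof
  show "(\<lambda>x. complex_of_real (\<phi> x)) \<in> borel_measurable lborel"
    using borel_measurable_continuous_onI[OF smooth_continuous[OF s]] by simp
  have "set_integrable lborel {- B..B} (\<lambda>x. (cmod (complex_of_real (\<phi> x)))\<^sup>2)"
    by (intro borel_integrable_atLeastAtMost' continuous_intros smooth_continuous s)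
  moreover have "(\<lambda>x. indicator {- B..B} x *\<^sub>R (cmod (complex_of_real (\<phi> x)))\<^sup>2) = (\<lambda>x. (cmod (complex_of_real (\<phi> x)))\<^sup>2)"
    using B(2) by (auto simp: fun_eq_iff split: split_indicator)
  ultimately show "integrable lborel (\<lambda>x. (cmod (complex_of_real (\<phi> x)))\<^sup>2)"
    by (simp add: set_integrable_def)
qed

lemma square_integrable_times: "square_integrable f \<Longrightarrow> square_integrable g \<Longrightarrow> integrable lborel (\<lambda>x. f x * g x)"
  using square_integrable_prod[OF _ square_integrable_cnj, of f g] by simp

text \<open>Integration by parts on each half-line leaves boundary terms at 0; together they are the
  delta contribution of the jump in the distributional derivative. The identity serves both the
  punctured line, where \<phi>(0) = 0, and the whole line, where the jump has to vanish.\<close>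

lemma weak_reps_identity:
  assumes W: "weak_reps U V Fr Fl" and t: "test_function \<Omega> \<phi>"
  shows "(\<integral>x. rep_L2R U x * of_real (deriv \<phi> x) \<partial>lborel) =
    (Fl 0 - Fr 0) * of_real (\<phi> 0) - (\<integral>x. rep_L2R V x * of_real (\<phi> x) \<partial>lborel)"
proof -
  have s: "smooth \<phi>" using t by (simp add: test_function_iff)
  obtain a B where B: "B > 0" "\<And>x. \<bar>x\<bar> > B \<Longrightarrow> \<phi> x = 0"
    using test_function_support[OF t] by (metis less_trans)
  have dz: "deriv \<phi> x = 0" if "\<bar>x\<bar> > B" for x
  proof (rule deriv_eq_0_beyond[OF s, of "{x. \<bar>x\<bar> > B}"])
    show "open {x. B < \<bar>x\<bar>}" by (intro open_Collect_less continuous_intros)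
  qed (use that B in auto)
  have W': "primitive Fr (rep_L2R V)" "primitive Fl (\<lambda>x. - rep_L2R V (- x))"
    "AEpos x. rep_L2R U x = Fr x" "AEpos x. rep_L2R U (- x) = Fl x"
    using W by (auto simp: weak_reps_def)
  have sq: "square_integrable (\<lambda>x. of_real (\<phi> x))" "square_integrable (\<lambda>x. of_real (deriv \<phi> x))"
    by (rule test_function_square_integrable[of _ B]; use s smooth_deriv B dz in force)+
  have i: "integrable lborel (\<lambda>x. rep_L2R U x * of_real (deriv \<phi> x))" "integrable lborel (\<lambda>x. rep_L2R V x * of_real (\<phi> x))"
    by (intro square_integrable_times square_integrable_rep sq)+
  have half_cut_m: "(\<lambda>x. indicator {0<..} x *\<^sub>R F x) \<in> borel_measurable borel" if "primitive F f" for F f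
    using half_cut_measurable_continuous[OF primitive_continuous[OF that]] by (simp add: half_cut_indicator[abs_def])
  have m1: "(\<lambda>x. complex_of_real (deriv \<phi> x)) \<in> borel_measurable borel"
    by (intro borel_measurable_continuous_onI continuous_intros smooth_continuous smooth_deriv s)
  have m2: "(\<lambda>x. complex_of_real (deriv \<phi> (- x))) \<in> borel_measurable borel"
    by (rule measurable_compose[OF _ m1]) simp
  have m3: "(\<lambda>x. rep_L2R U (- x)) \<in> borel_measurable borel"
    by (rule measurable_compose[OF _ rep_measurable]) simp
  have R: "(LBINT x:{0<..}. rep_L2R U x * of_real (deriv \<phi> x)) = (LBINT x:{0<..}. Fr x * of_real (deriv \<phi> x))"
  proof -
    have "(\<lambda>x. (indicator {0<..} x *\<^sub>R Fr x) * of_real (deriv \<phi> x)) \<in> borel_measurable borel"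
      using half_cut_m[OF W'(1)] m1 by (intro borel_measurable_times)
    then show ?thesis
      unfolding set_lebesgue_integral_def using rep_measurable[of U] m1 W'(3)
      by (intro integral_cong_AE) (auto elim: eventually_mono split: split_indicator)
  qed
  have L: "(LBINT x:{0<..}. rep_L2R U (- x) * of_real (deriv \<phi> (- x))) = - (LBINT x:{0<..}. Fl x * of_real (deriv (\<lambda>x. \<phi> (- x)) x))"
  proof -
    have "(\<lambda>x. (indicator {0<..} x *\<^sub>R Fl x) * of_real (deriv \<phi> (- x))) \<in> borel_measurable borel"
      using half_cut_m[OF W'(2)] m2 by (intro borel_measurable_times)
    then have "(LBINT x:{0<..}. rep_L2R U (- x) * of_real (deriv \<phi> (- x))) = (LBINT x:{0<..}. Fl x * of_real (deriv \<phi> (- x)))"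
      unfolding set_lebesgue_integral_def using m3 m2 W'(4)
      by (intro integral_cong_AE) (auto elim: eventually_mono split: split_indicator)
    then show ?thesis
      unfolding deriv_reflect[OF s] by (simp add: set_lebesgue_integral_def)
  qed
  have "(\<integral>x. rep_L2R U x * of_real (deriv \<phi> x) \<partial>lborel) =
    (LBINT x:{0<..}. Fr x * of_real (deriv \<phi> x)) - (LBINT x:{0<..}. Fl x * of_real (deriv (\<lambda>x. \<phi> (- x)) x))"
    unfolding integral_split_line[OF i(1)] R L by simp
  also have "(LBINT x:{0<..}. Fr x * of_real (deriv \<phi> x)) = - Fr 0 * of_real (\<phi> 0) - (LBINT x:{0<..}. rep_L2R V x * of_real (\<phi> x))"
    by (rule primitive_by_parts[OF W'(1) s B(1)]) (use B in auto)
  also have "(LBINT x:{0<..}. Fl x * of_real (deriv (\<lambda>x. \<phi> (- x)) x)) =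
      - Fl 0 * of_real (\<phi> (- 0)) - (LBINT x:{0<..}. - rep_L2R V (- x) * of_real (\<phi> (- x)))"
    by (rule primitive_by_parts[OF W'(2) smooth_reflect[OF s] B(1)]) (use B in auto)
  also have "(LBINT x:{0<..}. - rep_L2R V (- x) * of_real (\<phi> (- x))) = - (LBINT x:{0<..}. rep_L2R V (- x) * of_real (\<phi> (- x)))"
    by (simp add: set_lebesgue_integral_def)
  finally show ?thesis
    unfolding integral_split_line[OF i(2)] by (simp add: algebra_simps)
qed

lemma weak_deriv_mono: "weak_deriv \<Omega> U V \<Longrightarrow> \<Omega>' \<subseteq> \<Omega> \<Longrightarrow> weak_deriv \<Omega>' U V"
  by (auto simp: weak_deriv_def test_function_def)

lemma test_function_vanishes:
  assumes "test_function {0<..} \<phi>"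
  shows "x \<le> 0 \<Longrightarrow> \<phi> x = 0" "x \<le> 0 \<Longrightarrow> deriv \<phi> x = 0"
proof -
  have s: "smooth \<phi>" and c: "{x. \<phi> x \<noteq> 0} \<subseteq> {0<..}"
    using assms closure_subset[of "{x. \<phi> x \<noteq> 0}"] unfolding test_function_iff by blast+
  obtain a where a: "a > 0" "\<And>x. \<bar>x\<bar> < a \<Longrightarrow> \<phi> x = 0"
    using test_function_support[OF assms] by (metis (no_types, lifting) Compl_iff greaterThan_iff less_irrefl singletonD subsetI)
  show "x \<le> 0 \<Longrightarrow> \<phi> x = 0" using c by force
  show "x \<le> 0 \<Longrightarrow> deriv \<phi> x = 0"
  proof (rule deriv_eq_0_beyond[OF s, of "{..<a}"])
    fix y assume "y \<in> {..<a}"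
    then show "\<phi> y = 0" using a(2)[of y] c by (cases "y > 0") auto
  qed (use a in auto)
qed

text \<open>Test functions on the open half-line and their reflections are test functions on the
  punctured line, so the half-line result applies to \<open>U\<close> and to its reflection.\<close>

lemma weak_deriv_imp_reps:
  assumes "weak_deriv punctured_line U V"
  obtains Fr Fl where "weak_reps U V Fr Fl"
proof -
  have si: "(\<integral>x. g x * of_real (\<phi> x) \<partial>lborel) = (LBINT x:{0<..}. g x * of_real (\<phi> x))"
    if "\<And>x. x \<le> 0 \<Longrightarrow> \<phi> x = 0" for g :: "real \<Rightarrow> complex" and \<phi>
    unfolding set_lebesgue_integral_def
    by (intro Bochner_Integration.integral_cong) (use that in \<open>auto split: split_indicator\<close>)
  obtain Fr where Fr: "primitive Fr (rep_L2R V)" "AEpos x. rep_L2R U x = Fr x"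
  proof (rule weak_derivative_half_line[OF hsq_rep(1)[of U] hsq_rep(1)[of V]])
    fix \<phi> assume t: "test_function {0<..} \<phi>"
    then have "test_function punctured_line \<phi>" by (auto simp: test_function_def)
    with assms have "(\<integral>x. rep_L2R U x * of_real (deriv \<phi> x) \<partial>lborel) = - (\<integral>x. rep_L2R V x * of_real (\<phi> x) \<partial>lborel)"
      unfolding weak_deriv_def by blast
    then show "(LBINT x:{0<..}. rep_L2R U x * of_real (deriv \<phi> x)) = - (LBINT x:{0<..}. rep_L2R V x * of_real (\<phi> x))"
      by (simp only: si[of "deriv \<phi>", OF test_function_vanishes(2)[OF t]] si[of \<phi>, OF test_function_vanishes(1)[OF t]])
  qed
  obtain Fl where Fl: "primitive Fl (\<lambda>x. - rep_L2R V (- x))" "AEpos x. rep_L2R U (- x) = Fl x"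
  proof (rule weak_derivative_half_line[OF hsq_rep(2)[of U] hsq_scale[OF hsq_rep(2)[of V], of "-1", simplified]])
    fix \<phi> assume t: "test_function {0<..} \<phi>"
    then have s: "smooth \<phi>" by (simp add: test_function_iff)
    obtain a b where ab: "a > 0" "b > a" "\<And>x. \<bar>x\<bar> > b \<Longrightarrow> \<phi> x = 0" "\<And>x. \<bar>x\<bar> < a \<Longrightarrow> \<phi> x = 0"
      using test_function_support[OF t] by (metis (no_types, lifting) Compl_iff greaterThan_iff less_irrefl singletonD subsetI)
    have "test_function punctured_line (\<lambda>x. \<phi> (- x))"
    proof (rule test_functionI[OF smooth_reflect[OF s], of "- b" "- a"])
      fix x assume "x \<notin> {- b..- a}"
      then show "\<phi> (- x) = 0"
        using ab(3)[of "- x"] ab(4)[of "- x"] test_function_vanishes(1)[OF t, of "- x"] by force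
    qed (use ab in auto)
    with assms have "(\<integral>x. rep_L2R U x * of_real (deriv (\<lambda>x. \<phi> (- x)) x) \<partial>lborel) = - (\<integral>x. rep_L2R V x * of_real (\<phi> (- x)) \<partial>lborel)"
      unfolding weak_deriv_def by blast
    then have "(\<integral>x. rep_L2R U (- x) * of_real (deriv \<phi> x) \<partial>lborel) = (\<integral>x. rep_L2R V (- x) * of_real (\<phi> x) \<partial>lborel)"
      unfolding deriv_reflect[OF s]
      by (subst (asm) (1 2) integral_reflect) simp
    then show "(LBINT x:{0<..}. rep_L2R U (- x) * of_real (deriv \<phi> x)) = - (LBINT x:{0<..}. - rep_L2R V (- x) * of_real (\<phi> x))"
      by (simp only: si[of "deriv \<phi>", OF test_function_vanishes(2)[OF t]] si[of \<phi>, OF test_function_vanishes(1)[OF t]])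
        (simp add: set_lebesgue_integral_def)
  qed
  show ?thesis
    by (rule that[of Fr Fl]) (use Fr Fl in \<open>auto simp: weak_reps_def\<close>)
qed

lemma weak_reps_imp_weak_deriv:
  assumes "weak_reps U V Fr Fl"
  shows "weak_deriv punctured_line U V"
  unfolding weak_deriv_def
proof (intro allI impI)
  fix \<phi> assume t: "test_function punctured_line \<phi>"
  then have "closure {x. \<phi> x \<noteq> 0} \<subseteq> - {0}" by (simp add: test_function_def)
  then have "\<phi> 0 = 0"
    using closure_subset[of "{x. \<phi> x \<noteq> 0}"] by blast
  then show "(\<integral>x. rep_L2R U x * of_real (deriv \<phi> x) \<partial>lborel) = - (\<integral>x. rep_L2R V x * of_real (\<phi> x) \<partial>lborel)"
    using weak_reps_identity[OF assms t] by simp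
qed

text \<open>Testing with a bump that is positive at 0 isolates the jump: membership in the Sobolev
  space of the whole line amounts to continuity across 0.\<close>

lemma weak_reps_UNIV_iff:
  assumes "weak_reps U V Fr Fl"
  shows "weak_deriv UNIV U V \<longleftrightarrow> Fr 0 = Fl 0"
proof
  have t: "test_function UNIV (bump (-1) 1 1)" by (rule test_function_bump) simp
  assume "weak_deriv UNIV U V"
  then have "(Fl 0 - Fr 0) * of_real (bump (-1) 1 1 0) = 0"
    using weak_reps_identity[OF assms t] t by (simp add: weak_deriv_def)
  then show "Fr 0 = Fl 0"
    using bump_pos[of "-1" 0 1 1] by simp
next
  assume "Fr 0 = Fl 0"
  then show "weak_deriv UNIV U V"
    unfolding weak_deriv_def using weak_reps_identity[OF assms] by simp
qed

lemma L2R_eqI: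
  assumes "AEpos x. rep_L2R U x = rep_L2R V x" "AEpos x. rep_L2R U (- x) = rep_L2R V (- x)"
  shows "U = V"
proof -
  have "AE x in lborel. rep_L2R U x = rep_L2R V x"
    using assms(1) AE_reflect[OF assms(2)] AE_lborel_singleton[of 0]
    by eventually_elim (metis linorder_neqE_linordered_idom minus_minus neg_0_less_iff_less)
  then have "abs_L2R (rep_L2R U) = abs_L2R (rep_L2R V)"
    using abs_L2R_eq_iff square_integrable_rep by blast
  then show ?thesis by (simp add: abs_rep_L2R)
qed

lemma continuous_AE_eq:
  fixes f g :: "real \<Rightarrow> complex"
  assumes "open S" "continuous_on S f" "continuous_on S g" "AE x in lborel. x \<in> S \<longrightarrow> f x = g x" "x \<in> S"
  shows "f x = g x"
proof -
  define T where "T = S \<inter> (\<lambda>x. f x - g x) -` (- {0})"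
  have T: "open T"
    unfolding T_def by (intro continuous_open_preimage continuous_intros assms)
  have "AE x in lborel. x \<notin> T"
    using assms(4) by eventually_elim (auto simp: T_def)
  then have "T \<in> null_sets lborel"
    using T by (simp add: AE_iff_null_sets)
  then have "negligible T"
    by (simp add: negligible_iff_null_sets null_sets_completionI)
  then have "T = {}"
    using T open_not_negligible by blast
  then show ?thesis using assms(5) by (auto simp: T_def)
qed

lemma primitive_AE_zero:
  assumes F: "primitive F f" and z: "AEpos x. F x = 0"
  shows "AEpos x. f x = 0"
proof (rule AE_zero_if_interval_integrals_zero_pos[OF primitive_integrable[OF F]])
  have c: "continuous_on {0<..} F"
    by (rule continuous_on_subset[OF primitive_continuous[OF F]]) auto
  have F0: "F x = 0" if "x > 0" for x
    by (rule continuous_AE_eq[of "{0<..}" F "\<lambda>x. 0"])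
      (use that z c in auto)
  fix a b :: real assume ab: "0 < a" "a < b"
  have "(LBINT x:{0..b}. f x) = (LBINT x:{0..a} \<union> {a<..b}. f x)"
    using ab by (simp add: ivl_disj_un)
  also have "\<dots> = (LBINT x:{0..a}. f x) + (LBINT x:{a<..b}. f x)"
    by (rule set_integral_Un) (use ab in \<open>auto intro: set_integrable_subset[OF primitive_integrable[OF F, of b]]\<close>)
  also have "(LBINT x:{a<..b}. f x) = (LBINT x:{a<..<b}. f x)"
    by (rule set_integral_discrete_difference[where X = "{b}"]) auto
  finally have "(LBINT x:{0..b}. f x) = (LBINT x:{0..a}. f x) + (LBINT x:{a<..<b}. f x)" .
  moreover have "(LBINT x:{0..a}. f x) = - F 0" "(LBINT x:{0..b}. f x) = - F 0"
    using primitive_eq[OF F, of a] primitive_eq[OF F, of b] F0[of a] F0[of b] ab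
    by (simp_all add: eq_neg_iff_add_eq_0 add.commute)
  ultimately show "(LBINT x:{a<..<b}. f x) = 0" by simp
qed

text \<open>The representatives belonging to both derivatives agree almost everywhere, so their
  difference is a primitive that vanishes. This justifies the definite description in
  \<open>weak_D\<close>.\<close>

lemma weak_deriv_unique:
  assumes "weak_deriv punctured_line U V" "weak_deriv punctured_line U V'"
  shows "V = V'"
proof -
  obtain Fr Fl where 1: "weak_reps U V Fr Fl" by (rule weak_deriv_imp_reps[OF assms(1)])
  obtain Gr Gl where 2: "weak_reps U V' Gr Gl" by (rule weak_deriv_imp_reps[OF assms(2)])
  note w = 1[unfolded weak_reps_def] 2[unfolded weak_reps_def]
  have z: "AEpos x. Fr x + (-1) * Gr x = 0" "AEpos x. Fl x + (-1) * Gl x = 0"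
    using w by (auto elim: eventually_elim2)
  have "AEpos x. rep_L2R V x + (-1) * rep_L2R V' x = 0"
    by (rule primitive_AE_zero[OF primitive_add[OF _ primitive_scale] z(1)]) (use w in auto)
  moreover have "AEpos x. - rep_L2R V (- x) + (-1) * - rep_L2R V' (- x) = 0"
    by (rule primitive_AE_zero[OF primitive_add[OF _ primitive_scale] z(2)]) (use w in auto)
  ultimately show ?thesis
    by (intro L2R_eqI) (auto elim: eventually_mono)
qed

lemma weak_D_eq: "weak_deriv punctured_line U V \<Longrightarrow> weak_D punctured_line U = V"
  unfolding weak_D_def using weak_deriv_unique by blast

section \<open>The graph of the operator\<close>

text \<open>\<open>cont_rep\<close> is an unspecified choice. Two continuous representatives can
  differ only on an open null set, which is empty, so any explicit one computes it.\<close>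

lemma cont_rep_eq:
  assumes "open \<Omega>" "continuous_on \<Omega> h" "AE x in lborel. x \<in> \<Omega> \<longrightarrow> h x = rep_L2R U x" "x \<in> \<Omega>"
  shows "cont_rep \<Omega> U x = h x"
proof -
  have "continuous_on \<Omega> (cont_rep \<Omega> U) \<and> (AE x in lborel. x \<in> \<Omega> \<longrightarrow> cont_rep \<Omega> U x = rep_L2R U x)"
    unfolding cont_rep_def by (rule someI[where x = h]) (use assms in blast)
  then have c: "continuous_on \<Omega> (cont_rep \<Omega> U)" and ae: "AE x in lborel. x \<in> \<Omega> \<longrightarrow> cont_rep \<Omega> U x = rep_L2R U x"
    by auto
  have "AE x in lborel. x \<in> \<Omega> \<longrightarrow> cont_rep \<Omega> U x = h x"
    using ae assms(3) by eventually_elim auto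
  from continuous_AE_eq[OF assms(1) c assms(2) this assms(4)] show ?thesis .
qed

lemma AE_from_halves:
  assumes "AEpos x. P x" "AEpos x. P (- x)"
  shows "AE x in lborel. P (x::real)"
  using assms(1) AE_reflect[OF assms(2)] AE_lborel_singleton[of 0]
  by eventually_elim (metis linorder_neqE_linordered_idom minus_minus neg_0_less_iff_less)

definition glue :: "(real \<Rightarrow> complex) \<Rightarrow> (real \<Rightarrow> complex) \<Rightarrow> real \<Rightarrow> complex" where
  "glue r l x = (if x \<ge> 0 then r x else l (- x))"

lemma AE_glue:
  assumes "AEpos x. rep_L2R U x = r x" "AEpos x. rep_L2R U (- x) = l x"
  shows "AE x in lborel. glue r l x = rep_L2R U x"
proof (rule AE_from_halves)
  show "AEpos x. glue r l x = rep_L2R U x"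
    using assms(1) by eventually_elim (simp add: glue_def)
  show "AEpos x. glue r l (- x) = rep_L2R U (- x)"
    using assms(2) by eventually_elim (simp add: glue_def)
qed

lemma continuous_reflect:
  fixes l :: "real \<Rightarrow> complex"
  assumes "continuous_on {0..} l"
  shows "continuous_on {..0} (\<lambda>x. l (- x))"
  by (rule continuous_on_compose2[OF assms]) (auto intro!: continuous_intros)

lemma continuous_glue:
  assumes "continuous_on {0..} r" "continuous_on {0..} l" "r 0 = l 0"
  shows "continuous_on UNIV (glue r l)"
proof -
  have "continuous_on ({0..} \<union> {..0}) (\<lambda>x. if x \<ge> 0 then r x else l (- x))"
    by (rule continuous_on_If) (use assms continuous_reflect[OF assms(2)] in auto)
  moreover have "{0..} \<union> {..0} = (UNIV :: real set)" by auto
  ultimately show ?thesis by (simp add: glue_def[abs_def])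
qed

lemma continuous_glue_punctured:
  assumes "continuous_on {0..} r" "continuous_on {0..} l"
  shows "continuous_on punctured_line (glue r l)"
proof -
  have "continuous_on {0<..} (glue r l)"
    by (rule continuous_on_eq[of _ r]) (auto intro: continuous_on_subset[OF assms(1)] simp: glue_def)
  moreover have "continuous_on {..<0} (glue r l)"
    by (rule continuous_on_eq[of _ "\<lambda>x. l (- x)"])
      (auto intro: continuous_on_subset[OF continuous_reflect[OF assms(2)]] simp: glue_def)
  ultimately have "continuous_on ({0<..} \<union> {..<0}) (glue r l)"
    by (intro continuous_on_open_Un) auto
  moreover have "{0<..} \<union> {..<0} = (- {0} :: real set)" by auto
  ultimately show ?thesis by simp
qed

lemma one_sided_limits:
  assumes c: "continuous_on {0..} r" "continuous_on {0..} l"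
    and ae: "AEpos x. rep_L2R V x = r x" "AEpos x. rep_L2R V (- x) = l x"
  shows "Lim (at_right 0) (cont_rep punctured_line V) = r 0"
    and "Lim (at_left 0) (cont_rep punctured_line V) = l 0"
proof -
  have eq: "cont_rep punctured_line V x = glue r l x" if "x \<noteq> 0" for x
  proof (rule cont_rep_eq)
    show "AE x in lborel. x \<in> punctured_line \<longrightarrow> glue r l x = rep_L2R V x"
      using AE_glue[OF ae] by eventually_elim auto
  qed (use that continuous_glue_punctured[OF c] in auto)
  have "(r \<longlongrightarrow> r 0) (at 0 within {0..})"
    using c(1) by (auto simp: continuous_on)
  then have "(r \<longlongrightarrow> r 0) (at_right 0)"
    by (rule tendsto_within_subset) auto
  then have "(cont_rep punctured_line V \<longlongrightarrow> r 0) (at_right 0)"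
    by (rule Lim_transform_eventually) (auto simp: eventually_at_filter eq glue_def)
  then show "Lim (at_right 0) (cont_rep punctured_line V) = r 0"
    by (intro tendsto_Lim) auto
  have "((\<lambda>x. l (- x)) \<longlongrightarrow> l (- 0)) (at 0 within {..0})"
    using continuous_reflect[OF c(2)] unfolding continuous_on by blast
  then have "((\<lambda>x. l (- x)) \<longlongrightarrow> l (- 0)) (at_left 0)"
    by (rule tendsto_within_subset) auto
  then have "(cont_rep punctured_line V \<longlongrightarrow> l (- 0)) (at_left 0)"
    by (rule Lim_transform_eventually) (auto simp: eventually_at_filter eq glue_def)
  then show "Lim (at_left 0) (cont_rep punctured_line V) = l 0"
    by (intro tendsto_Lim) auto
qed

lemma cont_rep_UNIV_0:
  assumes c: "continuous_on {0..} r" "continuous_on {0..} l" "r 0 = l 0"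
    and ae: "AEpos x. rep_L2R V x = r x" "AEpos x. rep_L2R V (- x) = l x"
  shows "cont_rep UNIV V 0 = r 0"
proof -
  have "cont_rep UNIV V 0 = glue r l 0"
    by (rule cont_rep_eq) (use continuous_glue[OF c] AE_glue[OF ae] in auto)
  then show ?thesis by (simp add: glue_def)
qed

section \<open>From the operator to half-line systems and back\<close>

lemma rep_add: "AE x in lborel. rep_L2R (U + V) x = rep_L2R U x + rep_L2R V x"
  using rep_abs_L2R[OF square_integrable_add[OF square_integrable_rep square_integrable_rep, of U V]]
  by (simp add: abs_L2R_add[symmetric] square_integrable_rep abs_rep_L2R)

lemma rep_scaleC: "AE x in lborel. rep_L2R (c *C U) x = c * rep_L2R U x"
  using rep_abs_L2R[OF square_integrable_scale[OF square_integrable_rep, of c U]]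
  by (simp add: abs_L2R_scaleC[symmetric] square_integrable_rep abs_rep_L2R)

lemma rep_uminus: "AE x in lborel. rep_L2R (- U) x = - rep_L2R U x"
  using rep_abs_L2R[OF square_integrable_scale[OF square_integrable_rep, of "-1" U]]
  by (simp add: abs_L2R_uminus[symmetric] square_integrable_rep abs_rep_L2R)

lemma rep_diff: "AE x in lborel. rep_L2R (U - V) x = rep_L2R U x - rep_L2R V x"
  using rep_add[of U "- V"] rep_uminus[of V] by eventually_elim simp

lemma rep_step_mult: "AE x in lborel. rep_L2R (step_mult Vp Vm U) x = step_potential Vp Vm x * rep_L2R U x"
proof -
  have "square_integrable (\<lambda>x. step_potential Vp Vm x * rep_L2R U x)"
    by (rule square_integrable_mult_bounded[OF square_integrable_rep, where K = "cmod Vp + cmod Vm"])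
      (auto simp: step_potential_def)
  moreover have "step_mult Vp Vm (abs_L2R (rep_L2R U)) = abs_L2R (\<lambda>x. step_potential Vp Vm x * rep_L2R U x)"
    by (rule step_mult.abs_eq) (simp add: square_integrable_rep)
  ultimately show ?thesis
    using rep_abs_L2R by (simp add: abs_rep_L2R)
qed

lemma hsq_cong_AE:
  assumes "hsq f" "AEpos x. f x = g x" "continuous_on {0..} g"
  shows "hsq g"
  unfolding hsq_def
proof (rule square_integrable_cong)
  show "square_integrable (half_cut f)" using assms(1) by (simp add: hsq_def)
  show "AE x in lborel. half_cut f x = half_cut g x"
    using assms(2) by eventually_elim (simp add: half_cut_def)
qed (use half_cut_measurable_continuous[OF assms(3)] in simp)

lemma primitive_cong_AE_integrable:
  assumes "primitive F f" "AEpos x. f x = g x" "\<And>x. set_integrable lborel {0..x} g"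
  shows "primitive F g"
  by (rule primitive_cong_AE[OF assms(1,2)])
    (use assms(3) in \<open>simp add: set_borel_measurable_def set_integrable_def borel_measurable_integrable\<close>)

lemma L_op_minus_iff:
  "(U, F) \<in> op_minus (L_op Vp Vm \<alpha>) z \<longleftrightarrow>
    U \<in> dom_L \<alpha> \<and> F = - weak_D punctured_line (weak_D punctured_line U) + step_mult Vp Vm U - z *C U"
  by (auto simp: op_minus_def L_op_def op_graph_def)

text \<open>The left half is reflected, so \<open>vl\<close> is minus the left derivative at the
  reflected point and the jump u'(0+) - u'(0-) becomes the sum \<open>vr 0 + vl 0\<close>. Both
  sides then satisfy equations of the same form on the same half-line.\<close>

lemma graph_imp_half_sols:
  assumes "(U, F) \<in> op_minus (L_op Vp Vm \<alpha>) z"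
  obtains ur vr ul vl where
    "half_sol (Vp - z) (rep_L2R F) ur vr" "half_sol (Vm - z) (\<lambda>x. rep_L2R F (- x)) ul vl"
    "ur 0 = ul 0" "vr 0 + vl 0 = \<alpha> * ur 0"
    "AEpos x. rep_L2R U x = ur x" "AEpos x. rep_L2R U (- x) = ul x"
proof -
  have dom: "U \<in> dom_L \<alpha>" and F: "F = - weak_D punctured_line (weak_D punctured_line U) + step_mult Vp Vm U - z *C U"
    using assms by (auto simp: L_op_minus_iff)
  obtain V0 where V0: "weak_deriv UNIV U V0"
    using dom by (auto simp: dom_L_def)
  obtain V W where V: "weak_deriv punctured_line U V" and W: "weak_deriv punctured_line V W"
    using dom by (auto simp: dom_L_def numeral_2_eq_2)
  \<comment> \<open>The derivative on the whole line restricts to the punctured line; by uniqueness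
    it carries no delta at 0, which yields \<open>ur 0 = ul 0\<close>.\<close>
  have "V0 = V"
    by (rule weak_deriv_unique[OF weak_deriv_mono[OF V0] V]) simp
  note D = weak_D_eq[OF V] weak_D_eq[OF W]
  obtain ur ul where u: "weak_reps U V ur ul" by (rule weak_deriv_imp_reps[OF V])
  obtain vr sl where v: "weak_reps V W vr sl" by (rule weak_deriv_imp_reps[OF W])
  define vl where "vl x = - sl x" for x
  have u0: "ur 0 = ul 0"
    using weak_reps_UNIV_iff[OF u] V0 \<open>V0 = V\<close> by simp
  have u': "primitive ur (rep_L2R V)" "primitive ul (\<lambda>x. - rep_L2R V (- x))"
    "AEpos x. rep_L2R U x = ur x" "AEpos x. rep_L2R U (- x) = ul x"
    using u by (auto simp: weak_reps_def)
  have v': "primitive vr (rep_L2R W)" "primitive sl (\<lambda>x. - rep_L2R W (- x))"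
    "AEpos x. rep_L2R V x = vr x" "AEpos x. rep_L2R V (- x) = sl x"
    using v by (auto simp: weak_reps_def)
  have vl: "primitive vl (\<lambda>x. rep_L2R W (- x))"
    using primitive_scale[OF v'(2), of "-1"] by (rule primitive_cong') (auto simp: vl_def)
  have cu: "continuous_on {0..} ur" "continuous_on {0..} ul" and cv: "continuous_on {0..} vr" "continuous_on {0..} sl" "continuous_on {0..} vl"
    using u' v' vl primitive_continuous by blast+
  have p1: "primitive ur vr"
    by (rule primitive_cong_AE_integrable[OF u'(1) v'(3) continuous_set_integrable[OF cv(1)]])
  have p2: "primitive ul vl"
    by (rule primitive_cong_AE_integrable[OF u'(2) _ continuous_set_integrable[OF cv(3)]])
      (use v'(4) in \<open>auto simp: vl_def elim!: eventually_mono\<close>)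
  have Fx: "AE x in lborel. rep_L2R F x = - rep_L2R W x + step_potential Vp Vm x * rep_L2R U x - z * rep_L2R U x"
    using rep_diff[of "- W + step_mult Vp Vm U" "z *C U"] rep_add[of "- W" "step_mult Vp Vm U"]
      rep_uminus[of W] rep_scaleC[of z U] rep_step_mult[of Vp Vm U]
    unfolding F D by eventually_elim simp
  have si: "set_integrable lborel {0..x} (\<lambda>x. K * u x - f x)" if "continuous_on {0..} u" "hsq f" for K u f x
    by (intro set_integral_diff(1) set_integrable_mult_right continuous_set_integrable that hsq_set_integrable)
  have p3: "primitive vr (\<lambda>x. (Vp - z) * ur x - rep_L2R F x)"
  proof (rule primitive_cong_AE_integrable[OF v'(1) _ si[OF cu(1) hsq_rep(1)]])
    show "AEpos x. rep_L2R W x = (Vp - z) * ur x - rep_L2R F x"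
      using Fx u'(3) by eventually_elim (auto simp: step_potential_def algebra_simps)
  qed
  have p4: "primitive vl (\<lambda>x. (Vm - z) * ul x - rep_L2R F (- x))"
  proof (rule primitive_cong_AE_integrable[OF vl _ si[OF cu(2) hsq_rep(2)]])
    show "AEpos x. rep_L2R W (- x) = (Vm - z) * ul x - rep_L2R F (- x)"
      using AE_reflect[OF Fx] u'(4) by eventually_elim (auto simp: step_potential_def algebra_simps)
  qed
  have h: "hsq ur" "hsq ul" "hsq vr" "hsq vl"
    using hsq_cong_AE[OF hsq_rep(1) u'(3) cu(1)] hsq_cong_AE[OF hsq_rep(2) u'(4) cu(2)]
      hsq_cong_AE[OF hsq_rep(1) v'(3) cv(1)] hsq_scale[OF hsq_cong_AE[OF hsq_rep(2) v'(4) cv(2)], of "-1"]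
    by (simp_all add: vl_def[abs_def])
  have "vr 0 - sl 0 = \<alpha> * ur 0"
    using dom one_sided_limits[OF cv(1,2) v'(3,4)] cont_rep_UNIV_0[OF cu u0 u'(3,4)]
    by (simp add: dom_L_def D)
  then show ?thesis
    using p1 p2 p3 p4 h u0 u'(3,4) by (intro that[of ur vr ul vl]) (auto simp: half_sol_def vl_def)
qed

lemma square_integrable_glue:
  assumes "hsq r" "hsq l"
  shows "square_integrable (\<lambda>x. half_cut r x + half_cut l (- x))"
  by (intro square_integrable_add square_integrable_reflect) (use assms in \<open>auto simp: hsq_def\<close>)

lemma L2R_glue:
  assumes "hsq r" "hsq l"
  obtains G where "AEpos x. rep_L2R G x = r x" "AEpos x. rep_L2R G (- x) = l x"
proof -
  note ae = rep_abs_L2R[OF square_integrable_glue[OF assms]]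
  show ?thesis
  proof (rule that)
    show "AEpos x. rep_L2R (abs_L2R (\<lambda>x. half_cut r x + half_cut l (- x))) x = r x"
      using ae by eventually_elim (auto simp: half_cut_def)
    show "AEpos x. rep_L2R (abs_L2R (\<lambda>x. half_cut r x + half_cut l (- x))) (- x) = l x"
      using AE_reflect[OF ae] by eventually_elim (auto simp: half_cut_def)
  qed
qed

lemma half_sols_imp_graph:
  assumes r: "half_sol (Vp - z) (rep_L2R F) ur vr" and l: "half_sol (Vm - z) (\<lambda>x. rep_L2R F (- x)) ul vl"
    and u0: "ur 0 = ul 0" and jump: "vr 0 + vl 0 = \<alpha> * ur 0"
    and ae: "AEpos x. rep_L2R U x = ur x" "AEpos x. rep_L2R U (- x) = ul x"
  shows "(U, F) \<in> op_minus (L_op Vp Vm \<alpha>) z"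
proof -
  have r': "primitive ur vr" "primitive vr (\<lambda>x. (Vp - z) * ur x - rep_L2R F x)" "hsq ur" "hsq vr"
    and l': "primitive ul vl" "primitive vl (\<lambda>x. (Vm - z) * ul x - rep_L2R F (- x))" "hsq ul" "hsq vl"
    using r l by (auto simp: half_sol_def)
  define sl where "sl x = - vl x" for x
  have sl: "hsq sl" using hsq_scale[OF l'(4), of "-1"] by (simp add: sl_def[abs_def])
  obtain V where V: "AEpos x. rep_L2R V x = vr x" "AEpos x. rep_L2R V (- x) = sl x"
    by (rule L2R_glue[OF r'(4) sl])
  \<comment> \<open>The candidate for u'', solved from the equation; as a combination of elements of
    \<open>L2R\<close> it is square integrable at once.\<close>
  define W where "W = step_mult Vp Vm U - z *C U - F"
  have Wx: "AE x in lborel. rep_L2R W x = step_potential Vp Vm x * rep_L2R U x - z * rep_L2R U x - rep_L2R F x"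
    using rep_diff[of "step_mult Vp Vm U - z *C U" F] rep_diff[of "step_mult Vp Vm U" "z *C U"]
      rep_scaleC[of z U] rep_step_mult[of Vp Vm U]
    unfolding W_def by eventually_elim simp
  have neg: "set_integrable lborel {0..x} (\<lambda>x. - rep_L2R X (- x))" for X x
    using hsq_set_integrable[OF hsq_scale[OF hsq_rep(2), of "-1"]] by simp
  have uV: "weak_reps U V ur ul"
    unfolding weak_reps_def
  proof (intro conjI ae)
    show "primitive ur (rep_L2R V)"
      by (rule primitive_cong_AE_integrable[OF r'(1) _ hsq_set_integrable[OF hsq_rep(1)]])
        (use V(1) in \<open>auto elim!: eventually_mono\<close>)
    show "primitive ul (\<lambda>x. - rep_L2R V (- x))"
      by (rule primitive_cong_AE_integrable[OF l'(1) _ neg])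
        (use V(2) in \<open>auto simp: sl_def elim!: eventually_mono\<close>)
  qed
  have vW: "weak_reps V W vr sl"
    unfolding weak_reps_def
  proof (intro conjI V)
    show "primitive vr (rep_L2R W)"
    proof (rule primitive_cong_AE_integrable[OF r'(2) _ hsq_set_integrable[OF hsq_rep(1)]])
      show "AEpos x. (Vp - z) * ur x - rep_L2R F x = rep_L2R W x"
        using Wx ae(1) by eventually_elim (auto simp: step_potential_def algebra_simps)
    qed
    have "primitive sl (\<lambda>x. - ((Vm - z) * ul x - rep_L2R F (- x)))"
      using primitive_scale[OF l'(2), of "-1"] by (rule primitive_cong') (auto simp: sl_def)
    then show "primitive sl (\<lambda>x. - rep_L2R W (- x))"
    proof (rule primitive_cong_AE_integrable[OF _ _ neg])
      show "AEpos x. - ((Vm - z) * ul x - rep_L2R F (- x)) = - rep_L2R W (- x)"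
        using AE_reflect[OF Wx] ae(2) by eventually_elim (auto simp: step_potential_def algebra_simps)
    qed
  qed
  have wUV: "weak_deriv punctured_line U V" and wVW: "weak_deriv punctured_line V W"
    by (rule weak_reps_imp_weak_deriv[OF uV], rule weak_reps_imp_weak_deriv[OF vW])
  have D: "weak_D punctured_line U = V" "weak_D punctured_line V = W"
    using weak_D_eq wUV wVW by auto
  have "weak_deriv UNIV U V"
    using weak_reps_UNIV_iff[OF uV] u0 by simp
  then have "U \<in> sobolev 1 UNIV" by auto
  moreover have "U \<in> sobolev 2 punctured_line"
    using wUV wVW by (auto simp: numeral_2_eq_2)
  moreover have c: "continuous_on {0..} ur" "continuous_on {0..} ul" "continuous_on {0..} vr" "continuous_on {0..} sl"
    using r' l' vW primitive_continuous by (auto simp: weak_reps_def)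
  have "Lim (at_right 0) (cont_rep punctured_line V) - Lim (at_left 0) (cont_rep punctured_line V) = \<alpha> * cont_rep UNIV U 0"
    using one_sided_limits[OF c(3,4) V] cont_rep_UNIV_0[OF c(1,2) u0 ae] jump by (simp add: sl_def)
  ultimately have "U \<in> dom_L \<alpha>"
    by (simp add: dom_L_def D)
  then show ?thesis
    by (simp add: L_op_minus_iff D W_def)
qed

lemma norm_L2R_halves:
  assumes h: "hsq r" "hsq l"
    and ae: "AEpos x. rep_L2R U x = r x" "AEpos x. rep_L2R U (- x) = l x"
  shows "(norm U)\<^sup>2 = (hnorm r)\<^sup>2 + (hnorm l)\<^sup>2"
proof -
  have i: "integrable lborel (\<lambda>x. (cmod (rep_L2R U x))\<^sup>2)"
    using square_integrable_rep[of U] by (simp add: square_integrable_def)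
  have m: "half_cut r \<in> borel_measurable borel" "half_cut l \<in> borel_measurable borel"
    using h by (auto simp: hsq_def square_integrable_def)
  have m': "(\<lambda>x. rep_L2R U (- x)) \<in> borel_measurable borel"
    by (rule measurable_compose[OF _ rep_measurable]) simp
  have "(norm U)\<^sup>2 = (norm (abs_L2R (rep_L2R U)))\<^sup>2" by (simp add: abs_rep_L2R)
  also have "\<dots> = (\<integral>x. (cmod (rep_L2R U x))\<^sup>2 \<partial>lborel)"
    by (simp add: norm_abs_L2R square_integrable_rep)
  also have "\<dots> = (LBINT x:{0<..}. (cmod (rep_L2R U x))\<^sup>2) + (LBINT x:{0<..}. (cmod (rep_L2R U (- x)))\<^sup>2)"
    by (rule integral_split_line[OF i])
  also have "(LBINT x:{0<..}. (cmod (rep_L2R U x))\<^sup>2) = (\<integral>x. (cmod (half_cut r x))\<^sup>2 \<partial>lborel)"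
    unfolding set_lebesgue_integral_def
  proof (rule integral_cong_AE)
    show "AE x in lborel. indicator {0<..} x *\<^sub>R (cmod (rep_L2R U x))\<^sup>2 = (cmod (half_cut r x))\<^sup>2"
      using ae(1) by eventually_elim (auto simp: half_cut_def split: split_indicator)
  qed (use m rep_measurable[of U] in simp_all)
  also have "(LBINT x:{0<..}. (cmod (rep_L2R U (- x)))\<^sup>2) = (\<integral>x. (cmod (half_cut l x))\<^sup>2 \<partial>lborel)"
    unfolding set_lebesgue_integral_def
  proof (rule integral_cong_AE)
    show "AE x in lborel. indicator {0<..} x *\<^sub>R (cmod (rep_L2R U (- x)))\<^sup>2 = (cmod (half_cut l x))\<^sup>2"
      using ae(2) by eventually_elim (auto simp: half_cut_def split: split_indicator)
  qed (use m m' in simp_all)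
  finally show ?thesis by (simp add: hnorm_square h)
qed

lemma norm_L2R_reps: "(norm F)\<^sup>2 = (hnorm (rep_L2R F))\<^sup>2 + (hnorm (\<lambda>x. rep_L2R F (- x)))\<^sup>2"
  by (rule norm_L2R_halves) (auto simp: hsq_rep)

section \<open>Linearity of the graph and injectivity\<close>

lemma half_sol_add:
  assumes "half_sol K f u v" "half_sol K g s t"
  shows "half_sol K (\<lambda>x. f x + g x) (\<lambda>x. u x + s x) (\<lambda>x. v x + t x)"
proof -
  have p: "primitive u v" "primitive v (\<lambda>x. K * u x - f x)" "hsq u" "hsq v"
    and q: "primitive s t" "primitive t (\<lambda>x. K * s x - g x)" "hsq s" "hsq t"
    using assms by (auto simp: half_sol_def)
  have "primitive (\<lambda>x. v x + t x) (\<lambda>x. K * (u x + s x) - (f x + g x))"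
    using primitive_add[OF p(2) q(2)] by (rule primitive_cong') (auto simp: algebra_simps)
  then show ?thesis
    using primitive_add[OF p(1) q(1)] hsq_add p q by (simp add: half_sol_def)
qed

lemma rep_zero: "AE x in lborel. rep_L2R 0 x = 0"
  using rep_abs_L2R[OF square_integrable_zero] by (simp add: zero_L2R_def)

lemma rep_comb: "AE x in lborel. rep_L2R (f + c *C g) x = rep_L2R f x + c * rep_L2R g x"
  using rep_add[of f "c *C g"] rep_scaleC[of c g] by eventually_elim simp

text \<open>\<open>dom_L\<close> is stated through choices and limits that are not visibly linear,
  so linearity is obtained by passing to the half-line systems, combining them, and going
  back.\<close>

lemma L_op_minus_comb:
  assumes "(u, f) \<in> op_minus (L_op Vp Vm \<alpha>) z" "(s, g) \<in> op_minus (L_op Vp Vm \<alpha>) z"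
  shows "(u + c *C s, f + c *C g) \<in> op_minus (L_op Vp Vm \<alpha>) z"
proof -
  obtain ur vr ul vl where 1: "half_sol (Vp - z) (rep_L2R f) ur vr" "half_sol (Vm - z) (\<lambda>x. rep_L2R f (- x)) ul vl"
    "ur 0 = ul 0" "vr 0 + vl 0 = \<alpha> * ur 0"
    "AEpos x. rep_L2R u x = ur x" "AEpos x. rep_L2R u (- x) = ul x"
    by (rule graph_imp_half_sols[OF assms(1)])
  obtain sr tr sl tl where 2: "half_sol (Vp - z) (rep_L2R g) sr tr" "half_sol (Vm - z) (\<lambda>x. rep_L2R g (- x)) sl tl"
    "sr 0 = sl 0" "tr 0 + tl 0 = \<alpha> * sr 0"
    "AEpos x. rep_L2R s x = sr x" "AEpos x. rep_L2R s (- x) = sl x"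
    by (rule graph_imp_half_sols[OF assms(2)])
  show ?thesis
  proof (rule half_sols_imp_graph)
    show "half_sol (Vp - z) (rep_L2R (f + c *C g)) (\<lambda>x. ur x + c * sr x) (\<lambda>x. vr x + c * tr x)"
      by (rule half_sol_cong_AE[OF half_sol_add[OF 1(1) half_sol_scale[OF 2(1)]] _ hsq_rep(1)])
        (rule eventually_mono[OF rep_comb[of f c g]], simp)
    show "half_sol (Vm - z) (\<lambda>x. rep_L2R (f + c *C g) (- x)) (\<lambda>x. ul x + c * sl x) (\<lambda>x. vl x + c * tl x)"
      by (rule half_sol_cong_AE[OF half_sol_add[OF 1(2) half_sol_scale[OF 2(2)]] _ hsq_rep(2)])
        (rule eventually_mono[OF AE_reflect[OF rep_comb[of f c g]]], simp)
    have "(vr 0 + vl 0) + c * (tr 0 + tl 0) = \<alpha> * ur 0 + c * (\<alpha> * sr 0)"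
      using 1(4) 2(4) by simp
    then show "vr 0 + c * tr 0 + (vl 0 + c * tl 0) = \<alpha> * (ur 0 + c * sr 0)"
      by (simp add: algebra_simps)
    show "AEpos x. rep_L2R (u + c *C s) x = ur x + c * sr x"
      using rep_comb[of u c s] 1(5) 2(5) by eventually_elim simp
    show "AEpos x. rep_L2R (u + c *C s) (- x) = ul x + c * sl x"
      using AE_reflect[OF rep_comb[of u c s]] 1(6) 2(6) by eventually_elim simp
  qed (use 1 2 in simp)
qed

lemma half_sol_trivial: "half_sol K (\<lambda>x. 0) (\<lambda>x. 0) (\<lambda>x. 0)"
proof -
  have "primitive (\<lambda>x. 0) (\<lambda>x. 0)" by (rule primitiveI) (auto simp: set_integrable_def)
  moreover have "hsq (\<lambda>x. 0)" by (simp add: hsq_def half_cut_def[abs_def] square_integrable_zero)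
  ultimately show ?thesis by (simp add: half_sol_def)
qed

lemma half_sol_rep_zero:
  shows "half_sol K (rep_L2R 0) u v \<longleftrightarrow> half_sol K (\<lambda>x. 0) u v"
    and "half_sol K (\<lambda>x. rep_L2R 0 (- x)) u v \<longleftrightarrow> half_sol K (\<lambda>x. 0) u v"
proof -
  have h0: "hsq (\<lambda>x. 0)" using half_sol_trivial by (simp add: half_sol_def)
  have r: "AEpos x. rep_L2R 0 x = 0" "AEpos x. 0 = rep_L2R 0 x"
    using rep_zero by (auto elim!: eventually_mono)
  have l: "AEpos x. rep_L2R 0 (- x) = 0" "AEpos x. 0 = rep_L2R 0 (- x)"
    using AE_reflect[OF rep_zero] by (auto elim!: eventually_mono)
  show "half_sol K (rep_L2R 0) u v \<longleftrightarrow> half_sol K (\<lambda>x. 0) u v"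
    using half_sol_cong_AE[OF _ r(1) h0] half_sol_cong_AE[OF _ r(2) hsq_rep(1)] by blast
  show "half_sol K (\<lambda>x. rep_L2R 0 (- x)) u v \<longleftrightarrow> half_sol K (\<lambda>x. 0) u v"
    using half_sol_cong_AE[OF _ l(1) h0] half_sol_cong_AE[OF _ l(2) hsq_rep(2)] by blast
qed

lemma L_op_minus_zero: "(0, 0) \<in> op_minus (L_op Vp Vm \<alpha>) z"
proof (rule half_sols_imp_graph)
  show "half_sol (Vp - z) (rep_L2R 0) (\<lambda>x. 0) (\<lambda>x. 0)" "half_sol (Vm - z) (\<lambda>x. rep_L2R 0 (- x)) (\<lambda>x. 0) (\<lambda>x. 0)"
    by (simp_all add: half_sol_rep_zero half_sol_trivial)
  show "AEpos x. rep_L2R 0 x = 0" by (rule eventually_mono[OF rep_zero]) simp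
  show "AEpos x. rep_L2R 0 (- x) = 0" by (rule eventually_mono[OF AE_reflect[OF rep_zero]]) simp
qed auto

lemma L_op_minus_inj_iff:
  "op_inj (op_minus (L_op Vp Vm \<alpha>) z) \<longleftrightarrow> op_ker (op_minus (L_op Vp Vm \<alpha>) z) = {0}"
proof
  assume "op_inj (op_minus (L_op Vp Vm \<alpha>) z)"
  then show "op_ker (op_minus (L_op Vp Vm \<alpha>) z) = {0}"
    using L_op_minus_zero unfolding op_inj_def op_ker_def by blast
next
  assume k: "op_ker (op_minus (L_op Vp Vm \<alpha>) z) = {0}"
  have m: "x + (-1) *C y = x - y" for x y :: L2R
    using scaleC_of_real[of "-1" y] by simp
  show "op_inj (op_minus (L_op Vp Vm \<alpha>) z)"
    unfolding op_inj_def
  proof (intro allI impI)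
    fix u v f assume "(u, f) \<in> op_minus (L_op Vp Vm \<alpha>) z \<and> (v, f) \<in> op_minus (L_op Vp Vm \<alpha>) z"
    then have "(u + (-1) *C v, f + (-1) *C f) \<in> op_minus (L_op Vp Vm \<alpha>) z"
      by (intro L_op_minus_comb) auto
    then have "u - v \<in> op_ker (op_minus (L_op Vp Vm \<alpha>) z)"
      unfolding m by (simp add: op_ker_def)
    with k show "u = v" by simp
  qed
qed

lemma L2R_zero_halves:
  assumes "AEpos x. rep_L2R U x = 0" "AEpos x. rep_L2R U (- x) = 0"
  shows "U = 0"
proof (rule L2R_eqI)
  show "AEpos x. rep_L2R U x = rep_L2R 0 x"
    using assms(1) rep_zero by eventually_elim simp
  show "AEpos x. rep_L2R U (- x) = rep_L2R 0 (- x)"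
    using assms(2) AE_reflect[OF rep_zero] by eventually_elim simp
qed

section \<open>Points on the half-lines\<close>

text \<open>On a side with imaginary root the solution vanishes identically. The matching conditions
  carry its zero Cauchy data across 0, and zero data force the other side to vanish as well,
  whatever its root.\<close>

lemma ker_on_half_lines:
  assumes sq: "kp\<^sup>2 = Vp - z" "km\<^sup>2 = Vm - z" and re: "Re kp = 0 \<or> Re km = 0"
  shows "op_ker (op_minus (L_op Vp Vm \<alpha>) z) = {0}"
proof -
  have "U = 0" if U0: "(U, 0) \<in> op_minus (L_op Vp Vm \<alpha>) z" for U
  proof -
    obtain ur vr ul vl where s: "half_sol (kp\<^sup>2) (\<lambda>x. 0) ur vr" "half_sol (km\<^sup>2) (\<lambda>x. 0) ul vl"
      "ur 0 = ul 0" "vr 0 + vl 0 = \<alpha> * ur 0"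
      "AEpos x. rep_L2R U x = ur x" "AEpos x. rep_L2R U (- x) = ul x"
      by (rule graph_imp_half_sols[OF U0, unfolded half_sol_rep_zero, folded sq])
    have d: "ur 0 = 0 \<and> vr 0 = 0 \<and> vl 0 = 0"
      using re homogeneous_half_sol_imaginary[OF s(1), of 0] homogeneous_half_sol_imaginary[OF s(2), of 0] s(3,4) by auto
    have "ur x = 0" "ul x = 0" if "x \<ge> 0" for x
      using homogeneous_half_sol_zero_data[OF s(1) _ _ that] homogeneous_half_sol_zero_data[OF s(2) _ _ that] d s(3) by auto
    then show "U = 0"
      using s(5,6) by (intro L2R_zero_halves) (auto elim!: eventually_mono)
  qed
  then show ?thesis
    using L_op_minus_zero by (auto simp: op_ker_def)
qed

lemma Range_on_half_lines_ne_UNIV: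
  assumes sq: "kp\<^sup>2 = Vp - z" "km\<^sup>2 = Vm - z" and re: "Re kp = 0 \<or> Re km = 0"
  shows "Range (op_minus (L_op Vp Vm \<alpha>) z) \<noteq> UNIV"
proof
  assume all: "Range (op_minus (L_op Vp Vm \<alpha>) z) = UNIV"
  have h0: "hsq (\<lambda>x. 0)" using half_sol_trivial by (simp add: half_sol_def)
  from re show False
  proof
    assume k: "Re kp = 0"
    obtain F where F: "AEpos x. rep_L2R F x = resonant kp x"
      by (rule L2R_glue[OF hsq_resonant[OF k] h0])
    obtain U where "(U, F) \<in> op_minus (L_op Vp Vm \<alpha>) z" using all by blast
    then obtain ur vr where "half_sol (Vp - z) (rep_L2R F) ur vr" by (rule graph_imp_half_sols)
    from half_sol_cong_AE[OF this F hsq_resonant[OF k]] show False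
      using no_half_sol_resonant[OF k] sq by simp
  next
    assume k: "Re km = 0"
    obtain F where F: "AEpos x. rep_L2R F (- x) = resonant km x"
      by (rule L2R_glue[OF h0 hsq_resonant[OF k]])
    obtain U where "(U, F) \<in> op_minus (L_op Vp Vm \<alpha>) z" using all by blast
    then obtain ul vl where "half_sol (Vm - z) (\<lambda>x. rep_L2R F (- x)) ul vl" by (rule graph_imp_half_sols)
    from half_sol_cong_AE[OF this F hsq_resonant[OF k]] show False
      using no_half_sol_resonant[OF k] sq by simp
  qed
qed

lemma half_sols_imp_Range:
  assumes h: "hsq fr" "hsq fl"
    and s: "half_sol (Vp - z) fr ur vr" "half_sol (Vm - z) fl ul vl" "ur 0 = ul 0" "vr 0 + vl 0 = \<alpha> * ur 0"
  obtains F where "F \<in> Range (op_minus (L_op Vp Vm \<alpha>) z)"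
    "AEpos x. rep_L2R F x = fr x" "AEpos x. rep_L2R F (- x) = fl x"
proof -
  obtain F where F: "AEpos x. rep_L2R F x = fr x" "AEpos x. rep_L2R F (- x) = fl x"
    by (rule L2R_glue[OF h])
  have hu: "hsq ur" "hsq ul" using s by (auto simp: half_sol_def)
  obtain U where U: "AEpos x. rep_L2R U x = ur x" "AEpos x. rep_L2R U (- x) = ul x"
    by (rule L2R_glue[OF hu])
  have "(U, F) \<in> op_minus (L_op Vp Vm \<alpha>) z"
  proof (rule half_sols_imp_graph)
    show "half_sol (Vp - z) (rep_L2R F) ur vr"
      by (rule half_sol_cong_AE[OF s(1) _ hsq_rep(1)]) (use F(1) in \<open>auto elim!: eventually_mono\<close>)
    show "half_sol (Vm - z) (\<lambda>x. rep_L2R F (- x)) ul vl"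
      by (rule half_sol_cong_AE[OF s(2) _ hsq_rep(2)]) (use F(2) in \<open>auto elim!: eventually_mono\<close>)
  qed (use s U in simp_all)
  then show ?thesis using that F by blast
qed

lemma half_sol_approx:
  assumes k: "Re k \<ge> 0" and f: "hsq f" and e: "\<epsilon> > 0"
  obtains f' u v where "hsq f'" "hnorm (\<lambda>x. f x - f' x) \<le> \<epsilon>" "half_sol (k\<^sup>2) f' u v" "u 0 = 0"
proof (cases "Re k = 0")
  case True
  show ?thesis by (rule half_sol_dense[OF True f e, of 0 0]) (rule that)
next
  case False
  then have "Re k > 0" using k by simp
  then obtain u v where "half_sol (k\<^sup>2) f u v" "u 0 = 0" by (rule half_sol_exists[OF _ f])
  moreover have "hnorm (\<lambda>x. f x - f x) = 0"
    using hnorm_scale[OF f, of 0] by simp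
  ultimately show ?thesis using that[OF f] e by simp
qed

text \<open>Both sides are solved with u(0) = 0, so the jump condition reduces to opposite
  derivatives. The side that may have \<open>Re k > 0\<close> is solved before the other and its
  derivative at 0 is accepted as it comes; the imaginary side, whose Cauchy data are free after a
  small change of the right-hand side, is then matched to it.\<close>

lemma closure_Range_on_half_lines:
  assumes sq: "kp\<^sup>2 = Vp - z" "km\<^sup>2 = Vm - z" and re: "Re kp \<ge> 0" "Re km \<ge> 0" "Re kp = 0 \<or> Re km = 0"
  shows "closure (Range (op_minus (L_op Vp Vm \<alpha>) z)) = UNIV"
proof -
  have "\<exists>G\<in>Range (op_minus (L_op Vp Vm \<alpha>) z). dist G F < e" if e: "e > 0" for F e
  proof -
    have e2: "e / 2 > 0" using e by simp
    obtain fr ur vr fl ul vl where h: "hsq fr" "hsq fl"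
      and n: "hnorm (\<lambda>x. rep_L2R F x - fr x) \<le> e / 2" "hnorm (\<lambda>x. rep_L2R F (- x) - fl x) \<le> e / 2"
      and s: "half_sol (kp\<^sup>2) fr ur vr" "half_sol (km\<^sup>2) fl ul vl" "ur 0 = 0" "ul 0 = 0" "vr 0 = - vl 0"
    proof (cases "Re kp = 0")
      case True
      obtain fl ul vl where l: "hsq fl" "hnorm (\<lambda>x. rep_L2R F (- x) - fl x) \<le> e / 2" "half_sol (km\<^sup>2) fl ul vl" "ul 0 = 0"
        by (rule half_sol_approx[OF re(2) hsq_rep(2) e2])
      show ?thesis
        by (rule half_sol_dense[OF True hsq_rep(1) e2, of F 0 "- vl 0"]) (rule that[OF _ l(1) _ l(2) _ l(3) _ l(4)])
    next
      case False
      then have k: "Re km = 0" using re by simp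
      obtain fr ur vr where r: "hsq fr" "hnorm (\<lambda>x. rep_L2R F x - fr x) \<le> e / 2" "half_sol (kp\<^sup>2) fr ur vr" "ur 0 = 0"
        by (rule half_sol_approx[OF re(1) hsq_rep(1) e2])
      obtain fl ul vl where l: "hsq fl" "hnorm (\<lambda>x. rep_L2R F (- x) - fl x) \<le> e / 2" "half_sol (km\<^sup>2) fl ul vl" "ul 0 = 0" "vl 0 = - vr 0"
        by (rule half_sol_dense[OF k hsq_rep(2) e2])
      show ?thesis
        by (rule that[OF r(1) l(1) r(2) l(2) r(3) l(3) r(4) l(4)]) (use l(5) in simp)
    qed
    obtain G where G: "G \<in> Range (op_minus (L_op Vp Vm \<alpha>) z)"
      "AEpos x. rep_L2R G x = fr x" "AEpos x. rep_L2R G (- x) = fl x"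
      by (rule half_sols_imp_Range[OF h s(1,2)[unfolded sq]]) (use s in auto)
    have "(norm (F - G))\<^sup>2 = (hnorm (\<lambda>x. rep_L2R F x - fr x))\<^sup>2 + (hnorm (\<lambda>x. rep_L2R F (- x) - fl x))\<^sup>2"
    proof (rule norm_L2R_halves)
      show "hsq (\<lambda>x. rep_L2R F x - fr x)" "hsq (\<lambda>x. rep_L2R F (- x) - fl x)"
        using hsq_add[OF hsq_rep(1) hsq_scale[OF h(1), of "-1"]] hsq_add[OF hsq_rep(2) hsq_scale[OF h(2), of "-1"]] by simp_all
      show "AEpos x. rep_L2R (F - G) x = rep_L2R F x - fr x"
        using rep_diff[of F G] G(2) by eventually_elim simp
      show "AEpos x. rep_L2R (F - G) (- x) = rep_L2R F (- x) - fl x"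
        using AE_reflect[OF rep_diff[of F G]] G(3) by eventually_elim simp
    qed
    also have "\<dots> \<le> (e / 2)\<^sup>2 + (e / 2)\<^sup>2"
      by (intro add_mono power_mono n) auto
    also have "\<dots> < e\<^sup>2" using e by (simp add: power2_eq_square)
    finally have "norm (F - G) < e"
      by (rule power2_less_imp_less) (use e in simp)
    then show ?thesis
      using G(1) by (auto simp: dist_norm norm_minus_commute)
  qed
  then show ?thesis
    by (auto simp: closure_approachable)
qed

section \<open>Points off the half-lines\<close>

lemma cinner_zero_left: "cinner_L2R 0 v = 0"
  using cinner_scaleC_left[of 0 0 v] complex_vector.scale_zero_left[of "0 :: L2R"] by simp

lemma subspace_orthogonal: "complex_vector.subspace {F. cinner_L2R F v = 0}"
  by (rule complex_vector.subspaceI) (auto simp: cinner_zero_left cinner_add_left cinner_scaleC_left)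

text \<open>Vanishing of the complex product amounts to vanishing of the real inner products with
  \<open>v\<close> and with \<open>\<i> *C v\<close>, which are continuous.\<close>

lemma closed_orthogonal: "closed {F. cinner_L2R F v = 0}"
proof -
  have i: "cinner_L2R F v = 0 \<longleftrightarrow> inner F v = 0 \<and> inner F (\<i> *C v) = 0" for F
  proof -
    have "cinner_L2R F (\<i> *C v) = cnj \<i> * cinner_L2R F v"
      by (subst (1 2) cinner_L2R_commute) (simp add: cinner_scaleC_left)
    then show ?thesis
      by (simp add: inner_L2R_def complex_eq_iff)
  qed
  have "closed {F. inner F v = 0 \<and> inner F (\<i> *C v) = 0}"
    by (intro closed_Collect_conj closed_Collect_eq continuous_intros)
  then show ?thesis by (simp add: i)
qed

definition decay :: "complex \<Rightarrow> complex \<Rightarrow> real \<Rightarrow> complex" where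
  "decay kp km = glue (\<lambda>x. exp (- kp * of_real x)) (\<lambda>x. exp (- km * of_real x))"

lemma
  assumes "Re kp > 0" "Re km > 0"
  shows square_integrable_decay: "square_integrable (decay kp km)"
    and rep_decay: "AEpos x. rep_L2R (abs_L2R (decay kp km)) x = exp (- kp * of_real x)"
      "AEpos x. rep_L2R (abs_L2R (decay kp km)) (- x) = exp (- km * of_real x)"
proof -
  have c: "continuous_on UNIV (decay kp km)"
    unfolding decay_def by (intro continuous_glue continuous_intros) simp
  show sq: "square_integrable (decay kp km)"
  proof (rule square_integrable_cong[OF square_integrable_glue[OF hsq_exp[OF assms(1)] hsq_exp[OF assms(2)]]])
    show "decay kp km \<in> borel_measurable lborel"
      using borel_measurable_continuous_onI[OF c] by simp
    show "AE x in lborel. half_cut (\<lambda>x. exp (- kp * of_real x)) x + half_cut (\<lambda>x. exp (- km * of_real x)) (- x) = decay kp km x"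
      by (rule eventually_mono[OF AE_lborel_singleton[of 0]]) (auto simp: half_cut_def decay_def glue_def)
  qed
  show "AEpos x. rep_L2R (abs_L2R (decay kp km)) x = exp (- kp * of_real x)"
    using rep_abs_L2R[OF sq] by eventually_elim (simp add: decay_def glue_def)
  show "AEpos x. rep_L2R (abs_L2R (decay kp km)) (- x) = exp (- km * of_real x)"
    using AE_reflect[OF rep_abs_L2R[OF sq]] by eventually_elim (simp add: decay_def glue_def)
qed

text \<open>The solvability functional is bilinear, the integral of f E, whereas
  \<open>cinner_L2R\<close> conjugates its second argument; the conjugate taken here cancels that
  one.\<close>

definition decay_cnj :: "complex \<Rightarrow> complex \<Rightarrow> L2R" where
  "decay_cnj kp km = abs_L2R (\<lambda>x. cnj (decay kp km x))"

lemma cinner_decay_cnj: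
  assumes "Re kp > 0" "Re km > 0"
  shows "cinner_L2R F (decay_cnj kp km) = ell kp (rep_L2R F) + ell km (\<lambda>x. rep_L2R F (- x))"
proof -
  note sq = square_integrable_decay[OF assms]
  have "cinner_L2R F (decay_cnj kp km) = cinner_L2R (abs_L2R (rep_L2R F)) (abs_L2R (\<lambda>x. cnj (decay kp km x)))"
    by (simp add: decay_cnj_def abs_rep_L2R)
  also have "\<dots> = (\<integral>x. rep_L2R F x * decay kp km x \<partial>lborel)"
    by (subst cinner_abs_L2R) (auto simp: square_integrable_rep square_integrable_cnj sq)
  also have "\<dots> = (LBINT x:{0<..}. rep_L2R F x * decay kp km x) + (LBINT x:{0<..}. rep_L2R F (- x) * decay kp km (- x))"
    by (rule integral_split_line[OF square_integrable_times[OF square_integrable_rep sq]])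
  also have "(LBINT x:{0<..}. rep_L2R F x * decay kp km x) = ell kp (rep_L2R F)"
    unfolding ell_def by (rule set_lebesgue_integral_cong) (auto simp: decay_def glue_def)
  also have "(LBINT x:{0<..}. rep_L2R F (- x) * decay kp km (- x)) = ell km (\<lambda>x. rep_L2R F (- x))"
    unfolding ell_def by (rule set_lebesgue_integral_cong) (auto simp: decay_def glue_def)
  finally show ?thesis .
qed

lemma ell_cong_AE:
  assumes "hsq f" "hsq g" "AEpos x. f x = g x"
  shows "ell k f = ell k g"
proof -
  have eq: "indicator {0<..} x *\<^sub>R (exp (- k * of_real x) * h x) = exp (- k * of_real x) * half_cut h x" for h x
    by (simp add: half_cut_def split: split_indicator)
  have "(\<lambda>x. exp (- k * of_real x) * half_cut h x) \<in> borel_measurable lborel" if "hsq h" for h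
  proof -
    have "(\<lambda>x::real. exp (- k * of_real x)) \<in> borel_measurable borel"
      by (intro borel_measurable_continuous_onI continuous_intros)
    then show ?thesis
      using that by (auto simp: hsq_def square_integrable_def intro!: borel_measurable_times)
  qed
  moreover have "AE x in lborel. exp (- k * of_real x) * half_cut f x = exp (- k * of_real x) * half_cut g x"
    using assms(3) by eventually_elim (simp add: half_cut_def)
  ultimately show ?thesis
    unfolding ell_def set_lebesgue_integral_def eq
    using assms(1,2) by (intro integral_cong_AE) auto
qed

text \<open>The function exp(-k x) / (2k) is a square-integrable solution of w' = k w - exp(-k x),
  so \<open>ell_unique\<close> reads the transform off its value at 0.\<close>

lemma ell_exp:
  assumes "Re k > 0"
  shows "ell k (\<lambda>x. exp (- k * of_real x)) = 1 / (2 * k)"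
proof -
  have [simp]: "k \<noteq> 0" using assms by auto
  let ?w = "\<lambda>x. 1 / (2 * k) * exp (- k * of_real x)"
  have "primitive ?w (\<lambda>x. k * ?w x - exp (- k * of_real x))"
    using primitive_scale[OF primitive_exp[of "- k"], of "1 / (2 * k)"]
    by (rule primitive_cong') (auto simp: field_simps)
  from ell_unique[OF this assms hsq_exp[OF assms] hsq_scale[OF hsq_exp[OF assms]]]
  show ?thesis by simp
qed

section \<open>Resolvent points and the simple eigenvalue\<close>

context
  fixes Vp Vm \<alpha> z kp km :: complex
  assumes sq: "kp\<^sup>2 = Vp - z" "km\<^sup>2 = Vm - z" and re: "Re kp > 0" "Re km > 0"
begin

abbreviation (input) "T \<equiv> op_minus (L_op Vp Vm \<alpha>) z"
abbreviation (input) "\<psi> \<equiv> decay_cnj kp km"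
abbreviation (input) "E \<equiv> abs_L2R (decay kp km)"

text \<open>The number \<open>c\<close> is u(0). The two identities from
  \<open>half_sol_boundary\<close> are added and the jump condition replaces the derivatives. The
  statement covers both cases: it bounds the resolvent if the factor is nonzero and gives the
  orthogonality condition if it is zero.\<close>

lemma graph_necessary:
  obtains C where "C \<ge> 0" "\<And>U F. (U, F) \<in> T \<Longrightarrow>
    \<exists>c. (kp + km + \<alpha>) * c = cinner_L2R F \<psi> \<and> (norm U)\<^sup>2 \<le> C * ((cmod c)\<^sup>2 + (norm F)\<^sup>2)"
proof -
  obtain A where A: "A \<ge> 0" "\<And>f u v. hsq f \<Longrightarrow> half_sol (kp\<^sup>2) f u v \<Longrightarrow> (hnorm u)\<^sup>2 \<le> A * ((cmod (u 0))\<^sup>2 + (hnorm f)\<^sup>2)"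
    by (rule half_sol_bound[OF re(1)]) (rule that)
  obtain B where B: "B \<ge> 0" "\<And>f u v. hsq f \<Longrightarrow> half_sol (km\<^sup>2) f u v \<Longrightarrow> (hnorm u)\<^sup>2 \<le> B * ((cmod (u 0))\<^sup>2 + (hnorm f)\<^sup>2)"
    by (rule half_sol_bound[OF re(2)]) (rule that)
  show ?thesis
  proof (rule that[of "A + B"])
    fix U F assume UF: "(U, F) \<in> T"
    obtain ur vr ul vl where s: "half_sol (kp\<^sup>2) (rep_L2R F) ur vr" "half_sol (km\<^sup>2) (\<lambda>x. rep_L2R F (- x)) ul vl"
      "ur 0 = ul 0" "vr 0 + vl 0 = \<alpha> * ur 0"
      "AEpos x. rep_L2R U x = ur x" "AEpos x. rep_L2R U (- x) = ul x"
      by (rule graph_imp_half_sols[OF UF, folded sq])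
    have b: "vr 0 + kp * ur 0 = ell kp (rep_L2R F)" "vl 0 + km * ul 0 = ell km (\<lambda>x. rep_L2R F (- x))"
      using half_sol_boundary[OF s(1) re(1) hsq_rep(1)] half_sol_boundary[OF s(2) re(2) hsq_rep(2)] .
    have "(kp + km + \<alpha>) * ur 0 = (vr 0 + kp * ur 0) + (vl 0 + km * ul 0)"
      using s(3) s(4)[symmetric] by (simp add: algebra_simps)
    then have 1: "(kp + km + \<alpha>) * ur 0 = cinner_L2R F \<psi>"
      by (simp add: b cinner_decay_cnj re)
    have "(norm U)\<^sup>2 = (hnorm ur)\<^sup>2 + (hnorm ul)\<^sup>2"
      by (rule norm_L2R_halves[OF _ _ s(5,6)]) (use s in \<open>auto simp: half_sol_def\<close>)
    also have "\<dots> \<le> A * ((cmod (ur 0))\<^sup>2 + (hnorm (rep_L2R F))\<^sup>2) + B * ((cmod (ul 0))\<^sup>2 + (hnorm (\<lambda>x. rep_L2R F (- x)))\<^sup>2)"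
      by (intro add_mono A(2)[OF hsq_rep(1) s(1)] B(2)[OF hsq_rep(2) s(2)])
    also have "\<dots> \<le> A * ((cmod (ur 0))\<^sup>2 + (norm F)\<^sup>2) + B * ((cmod (ur 0))\<^sup>2 + (norm F)\<^sup>2)"
      using A(1) B(1) s(3) by (intro add_mono mult_left_mono) (auto simp: norm_L2R_reps)
    finally show "\<exists>c. (kp + km + \<alpha>) * c = cinner_L2R F \<psi> \<and> (norm U)\<^sup>2 \<le> (A + B) * ((cmod c)\<^sup>2 + (norm F)\<^sup>2)"
      using 1 by (auto simp: distrib_right intro!: exI[of _ "ur 0"])
  qed (use A B in auto)
qed

lemma graph_sufficient:
  assumes c: "(kp + km + \<alpha>) * c = cinner_L2R F \<psi>"
  shows "F \<in> Range T"
proof -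
  obtain ur vr where r: "half_sol (kp\<^sup>2) (rep_L2R F) ur vr" "ur 0 = c"
    by (rule half_sol_exists[OF re(1) hsq_rep(1)])
  obtain ul vl where l: "half_sol (km\<^sup>2) (\<lambda>x. rep_L2R F (- x)) ul vl" "ul 0 = c"
    by (rule half_sol_exists[OF re(2) hsq_rep(2)])
  have b: "vr 0 + kp * c = ell kp (rep_L2R F)" "vl 0 + km * c = ell km (\<lambda>x. rep_L2R F (- x))"
    using half_sol_boundary[OF r(1) re(1) hsq_rep(1)] half_sol_boundary[OF l(1) re(2) hsq_rep(2)] r(2) l(2) by simp_all
  have "(vr 0 + kp * c) + (vl 0 + km * c) = (kp + km + \<alpha>) * c"
    unfolding b c by (simp add: cinner_decay_cnj re)
  then have jump: "vr 0 + vl 0 = \<alpha> * ur 0"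
    by (simp add: r(2) algebra_simps)
  have h: "hsq ur" "hsq ul" using r(1) l(1) by (auto simp: half_sol_def)
  obtain U where U: "AEpos x. rep_L2R U x = ur x" "AEpos x. rep_L2R U (- x) = ul x"
    by (rule L2R_glue[OF h])
  have "(U, F) \<in> T"
    by (rule half_sols_imp_graph[OF r(1)[unfolded sq] l(1)[unfolded sq] _ jump U]) (simp add: r(2) l(2))
  then show ?thesis by blast
qed

lemma resolvent_if_nonresonant:
  assumes D: "kp + km + \<alpha> \<noteq> 0"
  shows "op_inj T" "Range T = UNIV" "op_ker T = {0}" "z \<in> resolvent_set (L_op Vp Vm \<alpha>)"
proof -
  obtain C where C: "C \<ge> 0" "\<And>U F. (U, F) \<in> T \<Longrightarrow>
    \<exists>c. (kp + km + \<alpha>) * c = cinner_L2R F \<psi> \<and> (norm U)\<^sup>2 \<le> C * ((cmod c)\<^sup>2 + (norm F)\<^sup>2)"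
    by (rule graph_necessary) blast
  \<comment> \<open>The scalar equation and Cauchy-Schwarz bound |c| by the norm of \<open>F\<close>
    times norm \<psi> / |kp + km + \<alpha>|; inserting this into the bound for \<open>U\<close>
    gives the constant.\<close>
  define K where "K = sqrt (C * ((norm \<psi> / cmod (kp + km + \<alpha>))\<^sup>2 + 1))"
  have bound: "norm U \<le> K * norm F" if UF: "(U, F) \<in> T" for U F
  proof -
    obtain c where c: "(kp + km + \<alpha>) * c = cinner_L2R F \<psi>" "(norm U)\<^sup>2 \<le> C * ((cmod c)\<^sup>2 + (norm F)\<^sup>2)"
      using C(2)[OF UF] by blast
    have "cmod (kp + km + \<alpha>) * cmod c \<le> norm F * norm \<psi>"
      using norm_cinner_L2R_le[of F \<psi>] by (simp add: c(1)[symmetric] norm_mult)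
    then have "cmod c \<le> norm \<psi> / cmod (kp + km + \<alpha>) * norm F"
      using D by (simp add: field_simps)
    then have "(cmod c)\<^sup>2 \<le> (norm \<psi> / cmod (kp + km + \<alpha>) * norm F)\<^sup>2"
      by (intro power_mono) auto
    then have "(cmod c)\<^sup>2 + (norm F)\<^sup>2 \<le> ((norm \<psi> / cmod (kp + km + \<alpha>))\<^sup>2 + 1) * (norm F)\<^sup>2"
      by (simp only: power_mult_distrib distrib_right mult_1_left add_mono order_refl)
    then have "C * ((cmod c)\<^sup>2 + (norm F)\<^sup>2) \<le> C * (((norm \<psi> / cmod (kp + km + \<alpha>))\<^sup>2 + 1) * (norm F)\<^sup>2)"
      by (rule mult_left_mono[OF _ C(1)])
    also have "\<dots> = (K * norm F)\<^sup>2"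
      using C(1) by (simp add: K_def power_mult_distrib)
    finally have "(norm U)\<^sup>2 \<le> (K * norm F)\<^sup>2"
      using c(2) by linarith
    then show ?thesis
      by (rule power2_le_imp_le) (use C(1) in \<open>simp add: K_def\<close>)
  qed
  show R: "Range T = UNIV"
  proof (rule UNIV_eq_I[symmetric])
    show "F \<in> Range T" for F
      by (rule graph_sufficient[of "cinner_L2R F \<psi> / (kp + km + \<alpha>)"]) (use D in simp)
  qed
  show k: "op_ker T = {0}"
    using bound[of _ 0] L_op_minus_zero by (auto simp: op_ker_def)
  then show i: "op_inj T" by (simp add: L_op_minus_inj_iff)
  show "z \<in> resolvent_set (L_op Vp Vm \<alpha>)"
    using i R bound by (auto simp: resolvent_set_def intro!: exI[of _ K])
qed

text \<open>The product is the integral of E^2, not of |E|^2, so positivity alone does not suffice.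
  It equals 1/(2 kp) + 1/(2 km) = (kp + km) / (2 kp km), whose numerator has positive real
  part.\<close>

lemma cinner_decay_ne_0:
  assumes D: "kp + km + \<alpha> = 0"
  shows "cinner_L2R E \<psi> \<noteq> 0"
proof -
  have [simp]: "kp \<noteq> 0" "km \<noteq> 0" "kp + km \<noteq> 0"
    using re by (auto simp: complex_eq_iff)
  have "cinner_L2R E \<psi> = ell kp (\<lambda>x. exp (- kp * of_real x)) + ell km (\<lambda>x. exp (- km * of_real x))"
    unfolding cinner_decay_cnj[OF re]
    using ell_cong_AE[OF hsq_rep(1) hsq_exp[OF re(1)] rep_decay(1)[OF re]]
      ell_cong_AE[OF hsq_rep(2) hsq_exp[OF re(2)] rep_decay(2)[OF re]] by simp
  also have "\<dots> = (kp + km) / (2 * kp * km)"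
    by (simp only: ell_exp re) (simp add: field_simps)
  finally show ?thesis by simp
qed

lemma resonant_kernel:
  assumes D: "kp + km + \<alpha> = 0"
  shows "op_ker T = cspan {E}"
proof -
  have jump: "- kp + - km = \<alpha> * 1" using D by (metis add_eq_0_iff minus_add_distrib mult_1_right)
  have "(E, 0) \<in> T"
  proof (rule half_sols_imp_graph[OF _ _ _ _ rep_decay[OF re]])
    show "half_sol (Vp - z) (rep_L2R 0) (\<lambda>x. exp (- kp * of_real x)) (\<lambda>x. - kp * exp (- kp * of_real x))"
      "half_sol (Vm - z) (\<lambda>x. rep_L2R 0 (- x)) (\<lambda>x. exp (- km * of_real x)) (\<lambda>x. - km * exp (- km * of_real x))"
      unfolding half_sol_rep_zero sq[symmetric] by (intro half_sol_exp re)+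
  qed (use jump in auto)
  then have "(0 + c *C E, 0 + c *C 0) \<in> T" for c
    by (intro L_op_minus_comb L_op_minus_zero)
  then have 1: "c *C E \<in> op_ker T" for c by (simp add: op_ker_def)
  have 2: "\<exists>c. U = c *C E" if U: "(U, 0) \<in> T" for U
  proof -
    obtain ur vr ul vl where s: "half_sol (kp\<^sup>2) (\<lambda>x. 0) ur vr" "half_sol (km\<^sup>2) (\<lambda>x. 0) ul vl" "ur 0 = ul 0"
      "AEpos x. rep_L2R U x = ur x" "AEpos x. rep_L2R U (- x) = ul x"
      by (rule graph_imp_half_sols[OF U, unfolded half_sol_rep_zero, folded sq])
    have h: "ur x = ur 0 * exp (- kp * of_real x)" "ul x = ul 0 * exp (- km * of_real x)" if "x > 0" for x
      using homogeneous_half_sol[OF s(1) re(1), of x] homogeneous_half_sol[OF s(2) re(2), of x] that by simp_all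
    have "U = ur 0 *C E"
    proof (rule L2R_eqI)
      show "AEpos x. rep_L2R U x = rep_L2R (ur 0 *C E) x"
        using s(4) rep_scaleC[of "ur 0" E] rep_decay(1)[OF re]
        by eventually_elim (simp add: h)
      show "AEpos x. rep_L2R U (- x) = rep_L2R (ur 0 *C E) (- x)"
        using s(5) AE_reflect[OF rep_scaleC[of "ur 0" E]] rep_decay(2)[OF re]
        by eventually_elim (simp add: h s(3))
    qed
    then show ?thesis by blast
  qed
  show ?thesis
    unfolding complex_vector.span_singleton using 1 by (auto simp: op_ker_def dest!: 2)
qed

lemma resonant_range:
  assumes D: "kp + km + \<alpha> = 0"
  shows "Range T = {F. cinner_L2R F \<psi> = 0}"
proof -
  obtain C where C: "\<And>U F. (U, F) \<in> T \<Longrightarrow>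
    \<exists>c. (kp + km + \<alpha>) * c = cinner_L2R F \<psi> \<and> (norm U)\<^sup>2 \<le> C * ((cmod c)\<^sup>2 + (norm F)\<^sup>2)"
    by (rule graph_necessary) blast
  have "cinner_L2R F \<psi> = 0" if "F \<in> Range T" for F
    using that C D by fastforce
  moreover have "F \<in> Range T" if "cinner_L2R F \<psi> = 0" for F
    by (rule graph_sufficient[of 0]) (use that in simp)
  ultimately show ?thesis by blast
qed

text \<open>If U is killed by the power n + 1, its image under \<open>T\<close> is killed by the
  power n, hence by induction is a multiple of \<open>E\<close>. As an element of the range it is
  also annihilated by the functional, which is nonzero on \<open>E\<close>, so the image is
  0.\<close>

lemma resonant_root_space:
  assumes D: "kp + km + \<alpha> = 0"
  shows "root_space (L_op Vp Vm \<alpha>) z = op_ker T"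
proof -
  have z: "c = 0" if "c *C E \<in> Range T" for c
    using that cinner_decay_ne_0[OF D] by (simp add: resonant_range[OF D] cinner_scaleC_left)
  have "op_ker (T ^^ n) \<subseteq> op_ker T" for n
  proof (induction n)
    case 0
    show ?case using L_op_minus_zero by (auto simp: op_ker_def)
  next
    case (Suc n)
    show ?case
    proof
      fix U assume "U \<in> op_ker (T ^^ Suc n)"
      then obtain Y where Y: "(U, Y) \<in> T" "(Y, 0) \<in> T ^^ n"
        unfolding op_ker_def by (metis mem_Collect_eq relpow_Suc_D2)
      have "Y \<in> op_ker T" using Suc Y(2) by (auto simp: op_ker_def)
      then obtain c where c: "Y = c *C E"
        by (auto simp: resonant_kernel[OF D] complex_vector.span_singleton)
      then have "c = 0" using z Y(1) by blast
      then show "U \<in> op_ker T" using Y(1) c by (simp add: op_ker_def)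
    qed
  qed
  moreover have "op_ker T = op_ker (T ^^ 1)" by simp
  ultimately show ?thesis
    unfolding root_space_def by blast
qed

text \<open>The range is the kernel of a functional that is nonzero on \<open>E\<close>: one extra
  vector fills the space, and the range by itself is a proper subspace.\<close>

lemma resonant_codim:
  assumes D: "kp + km + \<alpha> = 0"
  shows "cspan (Range T \<union> {E}) = UNIV" "codim (Range T) = 1"
proof -
  let ?M = "{F. cinner_L2R F \<psi> = 0}"
  have n: "cinner_L2R E \<psi> \<noteq> 0" by (rule cinner_decay_ne_0[OF D])
  show s: "cspan (Range T \<union> {E}) = UNIV"
  proof (rule UNIV_eq_I[symmetric])
    fix F
    define t where "t = cinner_L2R F \<psi> / cinner_L2R E \<psi>"
    have "F + (- t) *C E \<in> ?M"
      unfolding mem_Collect_eq cinner_add_left cinner_scaleC_left using n by (simp add: t_def)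
    then have "(F + (- t) *C E) + t *C E \<in> cspan (Range T \<union> {E})"
      unfolding resonant_range[OF D]
      by (intro complex_vector.span_add complex_vector.span_scale complex_vector.span_base) auto
    then show "F \<in> cspan (Range T \<union> {E})" by simp
  qed
  show "codim (Range T) = 1"
    unfolding codim_def
  proof (rule Least_equality)
    show "\<exists>B. finite B \<and> card B = 1 \<and> cspan (Range T \<union> B) = UNIV"
      using s by (intro exI[of _ "{E}"]) auto
    fix m assume m: "\<exists>B. finite B \<and> card B = m \<and> cspan (Range T \<union> B) = UNIV"
    show "1 \<le> m"
    proof (rule ccontr)
      assume "\<not> 1 \<le> m"
      then have "m = 0" by simp
      obtain B where B: "finite B" "card B = m" "cspan (Range T \<union> B) = UNIV" using m by blast
      with \<open>m = 0\<close> have "B = {}" by simp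
      with B have "cspan (Range T) = UNIV" by simp
      moreover have "cspan (Range T) = Range T"
        using subspace_orthogonal by (simp add: resonant_range[OF D] complex_vector.span_eq_iff)
      ultimately show False
        using n by (auto simp: resonant_range[OF D])
    qed
  qed
qed

lemma resonant_dim:
  assumes D: "kp + km + \<alpha> = 0"
  shows "E \<noteq> 0" "cdim (op_ker T) = 1"
proof -
  show ne: "E \<noteq> 0"
    using cinner_decay_ne_0[OF D] by (auto simp: cinner_zero_left)
  then show "cdim (op_ker T) = 1"
    unfolding resonant_kernel[OF D]
    by (subst complex_vector.dim_eq_card[of "{E}"]) (auto simp: complex_vector.span_span)
qed

lemma Fredholm_off_half_lines:
  "fredholm T \<and> fredholm_index T = 0"
proof (cases "kp + km + \<alpha> = 0")
  case True
  have "finite_dim (op_ker T)"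
    unfolding finite_dim_def resonant_kernel[OF True] by (intro exI[of _ "{E}"]) auto
  moreover have "finite_codim (Range T)"
    unfolding finite_codim_def using resonant_codim(1)[OF True] by (intro exI[of _ "{E}"]) auto
  moreover have "closed (Range T)"
    unfolding resonant_range[OF True] by (rule closed_orthogonal)
  ultimately show ?thesis
    by (simp add: fredholm_def fredholm_index_def resonant_dim[OF True] resonant_codim[OF True])
next
  case False
  note R = resolvent_if_nonresonant[OF False]
  have "finite_dim (op_ker T)"
    unfolding finite_dim_def R by (intro exI[of _ "{}"]) auto
  moreover have "finite_codim (Range T)"
    unfolding finite_codim_def R by (intro exI[of _ "{}"]) auto
  moreover have "codim (Range T) = 0"
    unfolding codim_def R by (rule Least_eq_0) auto
  moreover have "cdim (op_ker T) = 0"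
    unfolding R by (subst complex_vector.dim_eq_card[of "{}"]) (auto simp: complex_vector.independent_empty)
  ultimately show ?thesis
    by (simp add: fredholm_def fredholm_index_def R)
qed

end

section \<open>The spectrum\<close>

lemma half_line_iff: "z \<in> half_line C \<longleftrightarrow> Im z = Im C \<and> Re C \<le> Re z"
proof
  assume "Im z = Im C \<and> Re C \<le> Re z"
  then have "z = C + of_real (Re z - Re C)" "Re z - Re C \<ge> 0" by (simp_all add: complex_eq_iff)
  then show "z \<in> half_line C" unfolding half_line_def by blast
qed (auto simp: half_line_def)

text \<open>A complex number has purely imaginary square roots exactly when it is real and
  nonpositive; applied to C - z this describes the half-line starting at \<open>C\<close>.\<close>

lemma half_line_iff_csqrt: "z \<in> half_line C \<longleftrightarrow> Re (csqrt (C - z)) = 0"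
proof -
  define k where "k = csqrt (C - z)"
  have k: "Re k * Re k - Im k * Im k = Re C - Re z" "2 * (Im k * Re k) = Im C - Im z"
    using power2_csqrt[of "C - z"] by (simp_all add: k_def[symmetric] power2_eq_square complex_eq_iff)
  show ?thesis
    unfolding half_line_iff k_def[symmetric]
  proof
    assume h: "Im z = Im C \<and> Re C \<le> Re z"
    show "Re k = 0"
    proof (rule ccontr)
      assume ne: "Re k \<noteq> 0"
      then have "Im k = 0" using h k(2) by simp
      then have "Re k * Re k \<le> 0" using h k(1) by simp
      moreover have "0 < Re k * Re k" using ne by (auto simp: zero_less_mult_iff)
      ultimately show False by simp
    qed
  next
    assume "Re k = 0"
    then have "Re C - Re z = - (Im k * Im k)" "Im C - Im z = 0" using k by simp_all
    moreover have "0 \<le> Im k * Im k" by simp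
    ultimately show "Im z = Im C \<and> Re C \<le> Re z" by linarith
  qed
qed

lemma closed_half_line: "closed (half_line C)"
proof -
  have "half_line C = {z. Im z = Im C} \<inter> {z. Re C \<le> Re z}" by (auto simp: half_line_iff)
  then show ?thesis
    by (simp add: closed_Int closed_Collect_eq closed_Collect_le continuous_on_Re continuous_on_Im)
qed

text \<open>The complement is stable under leftward horizontal rays, which all enter a common half-plane.\<close>

lemma connected_compl_half_lines: "connected (- (half_line A \<union> half_line B))"
proof -
  let ?S = "- (half_line A \<union> half_line B)"
  define m where "m = min (Re A) (Re B)"
  define P where "P = {z. Re z < m}"
  define ray where "ray z = (\<lambda>t. z - of_real t) ` {0::real..}" for z :: complex
  have P: "connected P" "P \<subseteq> ?S"
    unfolding P_def by (intro convex_connected convex_halfspace_Re_lt) (auto simp: half_line_iff m_def)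
  have r: "connected (ray z)" for z
    unfolding ray_def by (intro connected_continuous_image continuous_intros convex_connected convex_real_interval)
  have rS: "ray z \<subseteq> ?S" if "z \<in> ?S" for z
    using that by (auto simp: ray_def half_line_iff)
  have meet: "ray z \<inter> P \<noteq> {}" for z
  proof -
    have "z - of_real (max 0 (Re z - m + 1)) \<in> ray z" by (auto simp: ray_def)
    moreover have "z - of_real (max 0 (Re z - m + 1)) \<in> P" by (auto simp: P_def)
    ultimately show ?thesis by blast
  qed
  have z0: "A - of_real (\<bar>Re A - m\<bar> + 1) \<in> P" by (auto simp: P_def abs_if)
  have c: "connected (\<Union>z\<in>?S. ray z \<union> P)"
  proof (rule connected_Union)
    show "connected C" if "C \<in> (\<lambda>z. ray z \<union> P) ` ?S" for C
      using that r P(1) meet by (auto intro!: connected_Un)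
    show "\<Inter> ((\<lambda>z. ray z \<union> P) ` ?S) \<noteq> {}" using z0 by blast
  qed
  have "z \<in> ray z" for z by (auto simp: ray_def intro!: image_eqI[of _ _ 0])
  then have "(\<Union>z\<in>?S. ray z \<union> P) = ?S"
    using rS P(2) by blast
  with c show ?thesis by simp
qed

lemma Re_divide_inner: "Re (w / a) = (w \<bullet> a) / (cmod a)\<^sup>2"
  by (simp add: Re_divide' inner_complex_def)

text \<open>The sum of the roots is -\<alpha> and the difference of their squares is Vp - Vm, so
  their difference is -(Vp - Vm)/\<alpha> and both roots are explicit. Positivity of both real parts
  says |Re((Vp - Vm)/\<alpha>)| < -Re \<alpha>, which after multiplication by |\<alpha>|^2 is the
  condition defining \<Omega>.\<close>

lemma resonance_imp_Omega:
  assumes sq: "kp\<^sup>2 = Vp - z" "km\<^sup>2 = Vm - z" and re: "Re kp > 0" "Re km > 0" and D: "kp + km + \<alpha> = 0"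
  shows "\<alpha> \<in> Omega_set Vp Vm" "z = z_eig Vp Vm \<alpha>"
    "kp = - (\<alpha> / 2 + (Vp - Vm) / (2 * \<alpha>))" "km = - (\<alpha> / 2 - (Vp - Vm) / (2 * \<alpha>))"
proof -
  have a: "\<alpha> = - (kp + km)" using D by (simp add: add_eq_0_iff)
  have [simp]: "\<alpha> \<noteq> 0" using re by (auto simp: a complex_eq_iff)
  have "Vp - Vm = kp\<^sup>2 - km\<^sup>2" by (simp add: sq)
  then have d: "(kp - km) * (- \<alpha>) = Vp - Vm"
    unfolding a by (simp add: algebra_simps power2_eq_square)
  have e: "(Vp - Vm) / (2 * \<alpha>) = - (kp - km) / 2"
    unfolding d[symmetric] by (simp add: field_simps)
  show kp: "kp = - (\<alpha> / 2 + (Vp - Vm) / (2 * \<alpha>))" and km: "km = - (\<alpha> / 2 - (Vp - Vm) / (2 * \<alpha>))"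
    unfolding e unfolding a by (simp_all add: field_simps)
  have "z = Vp - (\<alpha> / 2 + (Vp - Vm) / (2 * \<alpha>))\<^sup>2"
    using sq(1) kp by (metis add_diff_cancel_left' diff_diff_eq2 power2_minus)
  also have "\<dots> = z_eig Vp Vm \<alpha>"
    by (simp add: z_eig_def field_simps power2_eq_square)
  finally show "z = z_eig Vp Vm \<alpha>" .
  define q where "q = ((Vp - Vm) \<bullet> \<alpha>) / (cmod \<alpha>)\<^sup>2"
  have q: "Re ((Vp - Vm) / (2 * \<alpha>)) = q / 2"
    using Re_divide_inner[of "Vp - Vm" \<alpha>] by (simp add: q_def divide_divide_eq_left[symmetric] mult.commute del: divide_divide_eq_left)
  have "Re \<alpha> + q < 0" "Re \<alpha> - q < 0"
    using re unfolding arg_cong[OF kp, of Re] arg_cong[OF km, of Re] by (simp_all add: q)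
  then have "\<bar>q\<bar> < - Re \<alpha>" by linarith
  then have "\<bar>q\<bar> * (cmod \<alpha>)\<^sup>2 < - Re \<alpha> * (cmod \<alpha>)\<^sup>2"
    by (intro mult_strict_right_mono) auto
  then show "\<alpha> \<in> Omega_set Vp Vm"
    by (simp add: Omega_set_def q_def abs_divide mult.commute)
qed

lemma Omega_imp_resonance:
  assumes "\<alpha> \<in> Omega_set Vp Vm"
  defines "kp \<equiv> - (\<alpha> / 2 + (Vp - Vm) / (2 * \<alpha>))" and "km \<equiv> - (\<alpha> / 2 - (Vp - Vm) / (2 * \<alpha>))"
  shows "kp\<^sup>2 = Vp - z_eig Vp Vm \<alpha>" "km\<^sup>2 = Vm - z_eig Vp Vm \<alpha>" "Re kp > 0" "Re km > 0" "kp + km + \<alpha> = 0"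
proof -
  have o: "\<bar>(Vp - Vm) \<bullet> \<alpha>\<bar> < - (cmod \<alpha>)\<^sup>2 * Re \<alpha>"
    using assms(1) by (simp add: Omega_set_def)
  then have [simp]: "\<alpha> \<noteq> 0" by auto
  show "kp\<^sup>2 = Vp - z_eig Vp Vm \<alpha>" "km\<^sup>2 = Vm - z_eig Vp Vm \<alpha>"
    by (simp_all add: kp_def km_def z_eig_def field_simps power2_eq_square)
  show "kp + km + \<alpha> = 0" by (simp add: kp_def km_def)
  define q where "q = ((Vp - Vm) \<bullet> \<alpha>) / (cmod \<alpha>)\<^sup>2"
  have q: "Re ((Vp - Vm) / (2 * \<alpha>)) = q / 2"
    using Re_divide_inner[of "Vp - Vm" \<alpha>] by (simp add: q_def divide_divide_eq_left[symmetric] mult.commute del: divide_divide_eq_left)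
  have "\<bar>q\<bar> < - Re \<alpha>"
    using o by (simp add: q_def abs_divide pos_divide_less_eq mult.commute)
  then show "Re kp > 0" "Re km > 0"
    by (simp_all add: kp_def km_def q abs_less_iff)
qed

lemma decay_eq_u_eig:
  "decay (- (\<alpha> / 2 + (Vp - Vm) / (2 * \<alpha>))) (- (\<alpha> / 2 - (Vp - Vm) / (2 * \<alpha>))) = u_eig Vp Vm \<alpha>"
  by (rule ext) (simp only: decay_def glue_def u_eig_def minus_minus of_real_minus mult_minus_left mult_minus_right)

theorem theorem2p12:
  fixes Vp Vm \<alpha> :: complex
  defines "L \<equiv> L_op Vp Vm \<alpha>"
  shows "spectrum L = continuous_spectrum L \<union> point_spectrum L \<and>
    (\<forall>k\<in>{1, 2, 3, 4, 5}. continuous_spectrum L = essential_spectrum k L) \<and>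
    continuous_spectrum L = half_line Vp \<union> half_line Vm \<and>
    point_spectrum L = discrete_spectrum L \<and>
    point_spectrum L = (if \<alpha> \<in> Omega_set Vp Vm then {z_eig Vp Vm \<alpha>} else {}) \<and>
    (\<alpha> \<in> Omega_set Vp Vm \<longrightarrow>
       op_ker (op_minus L (z_eig Vp Vm \<alpha>)) = cspan {abs_L2R (u_eig Vp Vm \<alpha>)})"
proof -
  define S where "S = half_line Vp \<union> half_line Vm"
  define P where "P = (if \<alpha> \<in> Omega_set Vp Vm then {z_eig Vp Vm \<alpha>} else {})"
  define kp where "kp z = csqrt (Vp - z)" for z
  define km where "km z = csqrt (Vm - z)" for z
  have sq: "(kp z)\<^sup>2 = Vp - z" "(km z)\<^sup>2 = Vm - z" for z
    by (simp_all add: kp_def km_def)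
  have re0: "Re (kp z) \<ge> 0" "Re (km z) \<ge> 0" for z
    unfolding kp_def km_def by (metis csqrt_principal less_eq_real_def)+
  have S: "z \<in> S \<longleftrightarrow> Re (kp z) = 0 \<or> Re (km z) = 0" for z
    by (simp add: S_def half_line_iff_csqrt kp_def km_def)
  have re: "Re (kp z) > 0" "Re (km z) > 0" if "z \<notin> S" for z
    using that re0[of z] by (auto simp: S order_less_le)
  \<comment> \<open>A root with positive real part is the principal one. This identifies the
    explicit roots of \<open>Omega_imp_resonance\<close> with the chosen \<open>kp z\<close> and
    \<open>km z\<close>.\<close>
  have unique: "Re k > 0 \<Longrightarrow> csqrt (k\<^sup>2) = k" for k
    by (rule csqrt_square) simp
  have res: "kp z + km z + \<alpha> = 0 \<longleftrightarrow> z \<in> P" if z: "z \<notin> S" for z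
  proof
    assume "kp z + km z + \<alpha> = 0"
    from resonance_imp_Omega[OF sq re[OF z] this] show "z \<in> P" by (simp add: P_def)
  next
    assume "z \<in> P"
    then have o: "\<alpha> \<in> Omega_set Vp Vm" "z = z_eig Vp Vm \<alpha>" by (auto simp: P_def split: if_splits)
    note r = Omega_imp_resonance[OF o(1)]
    show "kp z + km z + \<alpha> = 0"
      using r(5) unique[OF r(3)] unique[OF r(4)] unfolding r(1,2) kp_def km_def o(2) by simp
  qed
  have PS: "z \<notin> S" if "z \<in> P" for z
  proof -
    have o: "\<alpha> \<in> Omega_set Vp Vm" "z = z_eig Vp Vm \<alpha>" using that by (auto simp: P_def split: if_splits)
    note r = Omega_imp_resonance[OF o(1)]
    show ?thesis
      using r(3,4) unique[OF r(3)] unique[OF r(4)] unfolding S kp_def km_def o(2) r(1,2) by simp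
  qed
  have on: "op_inj (op_minus L z)" "closure (Range (op_minus L z)) = UNIV" "Range (op_minus L z) \<noteq> UNIV" if "z \<in> S" for z
    using ker_on_half_lines[OF sq] closure_Range_on_half_lines[OF sq re0] Range_on_half_lines_ne_UNIV[OF sq] that
    by (auto simp: S L_def L_op_minus_inj_iff)
  \<comment> \<open>A closed dense range would be the whole space. Since every one of the first four
    sets requires a closed range, no point of \<open>S\<close> lies in any of them.\<close>
  have not_closed: "\<not> closed (Range (op_minus L z))" if "z \<in> S" for z
    using on[OF that] by (metis closure_closed)
  have fred: "fredholm (op_minus L z)" "fredholm_index (op_minus L z) = 0" if "z \<notin> S" for z
    using Fredholm_off_half_lines[OF sq re[OF that]] by (simp_all add: L_def)
  have rho: "op_inj (op_minus L z)" "Range (op_minus L z) = UNIV" "z \<in> resolvent_set L" if "z \<notin> S" "z \<notin> P" for z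
    using resolvent_if_nonresonant[OF sq re[OF that(1)]] res[OF that(1)] that(2) by (simp_all add: L_def)
  have eig: "\<not> op_inj (op_minus L z)" "root_space L z = op_ker (op_minus L z)"
    "op_ker (op_minus L z) = cspan {abs_L2R (decay (kp z) (km z))}" if "z \<in> P" for z
  proof -
    have D: "kp z + km z + \<alpha> = 0" using res[OF PS[OF that]] that by simp
    note k = resonant_kernel[OF sq re[OF PS[OF that]] D] resonant_dim(1)[OF sq re[OF PS[OF that]] D]
    show "root_space L z = op_ker (op_minus L z)"
      unfolding L_def by (rule resonant_root_space[OF sq re[OF PS[OF that]] D])
    show k': "op_ker (op_minus L z) = cspan {abs_L2R (decay (kp z) (km z))}"
      unfolding L_def by (rule k(1))
    show "\<not> op_inj (op_minus L z)"
      using k' k(2) complex_vector.span_base[of "abs_L2R (decay (kp z) (km z))" "{abs_L2R (decay (kp z) (km z))}"]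
      by (auto simp: L_def L_op_minus_inj_iff)
  qed
  have rho_iff: "z \<in> resolvent_set L \<longleftrightarrow> z \<notin> S \<and> z \<notin> P" for z
    using rho on eig by (auto simp: resolvent_set_def)
  have spec: "spectrum L = S \<union> P"
    by (auto simp: spectrum_def rho_iff)
  have inj_iff: "op_inj (op_minus L z) \<longleftrightarrow> z \<notin> P" for z
    using rho(1) on(1) eig(1) by blast
  have point: "point_spectrum L = P"
    by (simp add: point_spectrum_def inj_iff)
  have cont: "continuous_spectrum L = S"
    unfolding continuous_spectrum_def inj_iff using rho(2) on(2,3) PS by blast
  have D1: "Delta1 L = - S"
    using fred not_closed by (auto simp: Delta1_def semi_fredholm_def fredholm_def)
  have D2: "Delta2 L = - S"
    using fred not_closed by (auto simp: Delta2_def fredholm_def)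
  have D3: "Delta3 L = - S"
    using fred not_closed by (auto simp: Delta3_def fredholm_def)
  have D4: "Delta4 L = - S"
    using fred not_closed by (auto simp: Delta4_def fredholm_def)
  have D5: "Delta5 L = - S"
  proof -
    have "- S - P \<noteq> {}"
    proof
      \<comment> \<open>Two points to the left of both half-lines, while \<open>P\<close> has at
        most one element: one of them is a resolvent point.\<close>
      define w where "w t = Complex (min (Re Vp) (Re Vm) - t) 0" for t
      assume "- S - P = {}"
      moreover have "w 1 \<notin> S" "w 2 \<notin> S" by (auto simp: S_def half_line_iff w_def)
      ultimately have "w 1 \<in> P" "w 2 \<in> P" by auto
      then show False by (auto simp: P_def w_def complex_eq_iff split: if_splits)
    qed
    then have ne: "- S \<noteq> {}" "- S \<inter> resolvent_set L \<noteq> {}" by (auto simp: rho_iff)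
    \<comment> \<open>The first set is a single component and it meets the resolvent set, so the
      union defining the fifth set is that component.\<close>
    have "components (- S) = {- S}"
      using connected_compl_half_lines[of Vp Vm] ne by (simp add: components_eq_sing_iff S_def)
    then show ?thesis
      unfolding Delta5_def D1 using ne by auto
  qed
  have "discrete_spectrum L = P"
  proof -
    have "z isolated_in spectrum L" if "z \<in> P" for z
      unfolding isolated_in_def spec
    \<comment> \<open>The complement of the half-lines is itself an isolating neighbourhood, since
      \<open>P\<close> is at most a singleton and misses \<open>S\<close>.\<close>
    proof (intro conjI exI[of _ "- S"])
      show "open (- S)" by (simp add: S_def closed_half_line open_Compl open_Int)
      show "- S \<inter> (S \<union> P) = {z}" using that PS[OF that] by (auto simp: P_def split: if_splits)
    qed (use that in auto)
    moreover have "finite_dim (root_space L z)" if "z \<in> P" for z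
      using fred(1)[OF PS[OF that]] eig(2)[OF that] by (simp add: fredholm_def)
    moreover have "closed (Range (op_minus L z))" if "z \<in> P" for z
      using fred(1)[OF PS[OF that]] by (simp add: fredholm_def)
    ultimately show ?thesis
      by (auto simp: discrete_spectrum_def point)
  qed
  moreover have "op_ker (op_minus L (z_eig Vp Vm \<alpha>)) = cspan {abs_L2R (u_eig Vp Vm \<alpha>)}" if o: "\<alpha> \<in> Omega_set Vp Vm"
  proof -
    note r = Omega_imp_resonance[OF o]
    show ?thesis
      using resonant_kernel[OF r] by (simp only: L_def decay_eq_u_eig)
  qed
  ultimately show ?thesis
    using spec point cont D1 D2 D3 D4 D5 by (auto simp: essential_spectrum_def S_def P_def)
qed

end
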